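(* Let $(M,\mathcal{U},\Sigma,X,\Delta)$ be the hybrid control system of a controlled mechanical system on $M=T^*Q$ with position-dependent impacts on $S=h^{-1}(0)\subset Q$ (as specified in the context), with optimal Hamiltonian $H:T^*M\to\mathbb{R}$. It lifts to the Hamiltonian impact system $(T^*M,\Sigma^*,X_H,\tilde{\Delta})$ such that: 1. $\Sigma^*=\pi_M^{-1}(\Sigma)$. 2. If $H$ has the form $H(x,p)=\beta_x(p,p)+p(f(x))+V(x)$, with $\beta_x$ a symmetric bilinear form on $T_x^*M$, $f$ a vector field on $M$ and $V:M\to\mathbb{R}$, then there exists a unique solution $\tilde{\Delta}:\Sigma^*\to T^*M$ to the extended reset equation $$(\mathrm{Id}\times\tilde{\Delta})^*\vartheta_H=\iota^*\vartheta_H,\qquad \pi_M\circ\tilde{\Delta}=\Delta\circ\pi_M|_{\Sigma^*}.$$ 3. Suppose that, in addition to $H$ having the form in item 2, the reset $\Delta:\Sigma\to M$ is an embedding, $\Delta^*\beta=\beta$, and $\Delta^*V=V$. Then the unique solution to the extended reset equation is a linear bundle isomorphism (covering $\Delta$).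
   Context: Setting. $Q$ is a smooth manifold (configuration space), $M=T^*Q$ with projection $\pi_Q:T^*Q\to Q$ and canonical symplectic form $\omega\in\Omega^2(T^*Q)$, $G:M\to\mathbb{R}$ is the smooth Hamiltonian of the uncontrolled mechanical system, and $X_G$ its Hamiltonian vector field. $\mathcal{U}\subset\mathbb{R}^m$ is the closed set of admissible controls, and the control is an external force, a smooth map $F:\mathcal{U}\to\Omega^1(Q)$. The controlled vector field $X=X(x,u)$ is defined by $i_X\omega-dG+\pi_Q^*F(u)=0$; thus $X=X_G+X_F$, where $\pi_Q^*dh(X_F)=0$ for any $F$. The location of impact $S=h^{-1}(0)\subset Q$ is a smooth embedded co-dimension 1 submanifold, and the guard is $\Sigma=\{x\in T^*Q|_S:\pi_Q^*dh(X_G)>0\}\subset M$. The reset $\Delta:\Sigma\to M$ is the reset of the mechanical impact: it is the identity on the position $q$ and changes the momentum $y$ by the corner conditions $y^+=y^-+\varepsilon\,dh$, $G^+=G^-$. As for any hybrid control system, $\Delta$ is smooth, $\Delta(\Sigma)$ is a smooth embedded submanifold, $\Sigma\cap\Delta(\Sigma)=\emptyset$, and $\overline{\Sigma}\cap\overline{\Delta(\Sigma)}$ has co-dimension at least 2. Optimal Hamiltonian. For a smooth running cost $\ell(x,u)$, $H(x,p)=\min_u[\ell(x,u)+\langle p,X(x,u)\rangle]$ for $(x,p)\in T^*M$. Standing assumptions: the minimizing control is uniquely determined by the vanishing of the $u$-derivative of the bracket, depends smoothly on $(x,p)$, $H$ is smooth, and $\Delta$ is an immersion. Lifted system. $\pi_M:T^*M\to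 M$ is the projection, $X_H$ the Hamiltonian vector field of $H$ on $T^*M$, and $\Sigma^*=\{(x,p)\in T^*M: x\in\Sigma,\ \pi_M^*\pi_Q^*dh(X_H)>0\}$ is the extended guard. $\vartheta_H=p_i\,dx^i-H\,dt\in\Omega^1(\mathbb{R}\times T^*M)$, with $x^i$ coordinates on $M$ and $p_i$ the dual coordinates; $\mathrm{Id}$ is the identity of the time factor $\mathbb{R}$, and $\iota:\mathbb{R}\times\Sigma^*\hookrightarrow\mathbb{R}\times T^*M$ is the inclusion. The extended reset is a map $\tilde\Delta$ solving the extended reset equation displayed in item 2. Meaning of the invariance conditions in item 3. $\Delta^*V=V$ means $V(\Delta(x))=V(x)$ for $x\in\Sigma$. $\Delta^*\beta=\beta$ means $\beta_{\Delta(x)}\big(p\circ(\Delta_*^f)^{-1},p\circ(\Delta_*^f)^{-1}\big)=\beta_x(p,p)$ for all $x\in\Sigma$, $p\in T^*_xM$, where $\Delta_*^f:T_xM\to T_{\Delta(x)}M$ is the augmented differential, defined by $\Delta_*^f\cdot u=\Delta_*\cdot u$ for $u\in T_x\Sigma$ and $\Delta_*^f\cdot f(x)=f(\Delta(x))$. *)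

theory Defs
  imports "HOL-Analysis.Analysis"
begin

section \<open>Smooth manifolds given by an atlas\<close>

text \<open>
  \<open>C_k k f W\<close> is intended for open \<open>W\<close> only: continuous differentiability is iterated over all
  directional derivatives.
\<close>

fun C_k :: "nat \<Rightarrow> ('a::real_normed_vector \<Rightarrow> 'b::real_normed_vector) \<Rightarrow> 'a set \<Rightarrow> bool" where
  "C_k 0 f W \<longleftrightarrow> continuous_on W f"
| "C_k (Suc k) f W \<longleftrightarrow>
     f differentiable_on W \<and> (\<forall>v. C_k k (\<lambda>x. frechet_derivative f (at x) v) W)"

definition C_inf :: "('a::real_normed_vector \<Rightarrow> 'b::real_normed_vector) \<Rightarrow> 'a set \<Rightarrow> bool" where
  "C_inf f W \<longleftrightarrow> (\<forall>k. C_k k f W)"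

text \<open>
  A chart is a pair of its domain and its coordinate map.  An atlas carries its own point set
  (the union of the chart domains) and topology, so no topology on the type of points is used.
  The dimension is \<open>DIM('a)\<close>, hence at least 1; this is no restriction here, since
  a manifold of dimension 0 has no submanifold of codimension 1 other than the empty set.
\<close>

type_synonym ('p, 'a) chart = "'p set \<times> ('p \<Rightarrow> 'a)"
type_synonym ('p, 'a) atlas = "('p, 'a) chart set"

definition mcarrier :: "('p, 'a) atlas \<Rightarrow> 'p set" where
  "mcarrier A = (\<Union>c\<in>A. fst c)"

definition mtopology :: "('p, 'a::euclidean_space) atlas \<Rightarrow> 'p topology" where
  "mtopology A = topology (\<lambda>U. U \<subseteq> mcarrier A \<and> (\<forall>(D, \<phi>)\<in>A. open (\<phi> ` (U \<inter> D))))"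

definition smooth_manifold :: "('p, 'a::euclidean_space) atlas \<Rightarrow> bool" where
  "smooth_manifold A \<longleftrightarrow>
     (\<forall>(D, \<phi>)\<in>A. inj_on \<phi> D) \<and>
     (\<forall>(D, \<phi>)\<in>A. \<forall>(E, \<psi>)\<in>A.
        open (\<phi> ` (D \<inter> E)) \<and> C_inf (\<psi> \<circ> inv_into D \<phi>) (\<phi> ` (D \<inter> E))) \<and>
     Hausdorff_space (mtopology A) \<and> second_countable (mtopology A)"

lemma openin_mtopology:
  assumes "\<And>D \<phi>. (D, \<phi>) \<in> A \<Longrightarrow> inj_on \<phi> D"
  shows "openin (mtopology A) U \<longleftrightarrow>
           U \<subseteq> mcarrier A \<and> (\<forall>(D, \<phi>)\<in>A. open (\<phi> ` (U \<inter> D)))"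
proof -
  have "istopology (\<lambda>U. U \<subseteq> mcarrier A \<and> (\<forall>(D, \<phi>)\<in>A. open (\<phi> ` (U \<inter> D))))"
    unfolding istopology_def
  proof (intro conjI allI impI)
    fix U V
    assume U: "U \<subseteq> mcarrier A \<and> (\<forall>(D, \<phi>)\<in>A. open (\<phi> ` (U \<inter> D)))"
      and V: "V \<subseteq> mcarrier A \<and> (\<forall>(D, \<phi>)\<in>A. open (\<phi> ` (V \<inter> D)))"
    show "U \<inter> V \<subseteq> mcarrier A" using U by blast
    show "\<forall>(D, \<phi>)\<in>A. open (\<phi> ` (U \<inter> V \<inter> D))"
    proof clarify
      fix D \<phi> assume c: "(D, \<phi>) \<in> A"
      have "\<phi> ` (U \<inter> V \<inter> D) = \<phi> ` (U \<inter> D) \<inter> \<phi> ` (V \<inter> D)"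
        using assms[OF c] by (auto simp: inj_on_def)
      then show "open (\<phi> ` (U \<inter> V \<inter> D))" using U V c by fastforce
    qed
  next
    fix K
    assume K: "\<forall>U\<in>K. U \<subseteq> mcarrier A \<and> (\<forall>(D, \<phi>)\<in>A. open (\<phi> ` (U \<inter> D)))"
    show "\<Union>K \<subseteq> mcarrier A" using K by blast
    show "\<forall>(D, \<phi>)\<in>A. open (\<phi> ` (\<Union>K \<inter> D))"
    proof clarify
      fix D \<phi> assume c: "(D, \<phi>) \<in> A"
      have "\<phi> ` (\<Union>K \<inter> D) = (\<Union>U\<in>K. \<phi> ` (U \<inter> D))" by auto
      moreover have "open (\<Union>U\<in>K. \<phi> ` (U \<inter> D))"
        by (rule open_UN) (use K c in fastforce)
      ultimately show "open (\<phi> ` (\<Union>K \<inter> D))" by simp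
    qed
  qed
  then show ?thesis by (simp add: mtopology_def)
qed

definition euc :: "('a::euclidean_space, 'a) atlas" where
  "euc = {(UNIV, \<lambda>x. x)}"

definition prod_atlas ::
    "('p, 'a) atlas \<Rightarrow> ('r, 'b) atlas \<Rightarrow> ('p \<times> 'r, 'a \<times> 'b) atlas" (infixr "\<times>\<^sub>M" 70) where
  "A \<times>\<^sub>M B = {(D \<times> E, map_prod \<phi> \<psi>) | D \<phi> E \<psi>. (D, \<phi>) \<in> A \<and> (E, \<psi>) \<in> B}"

text \<open>
  Smoothness on an arbitrary subset \<open>S\<close> is local extendability to a smooth map; for open
  \<open>S\<close> this is the usual smoothness, for embedded submanifolds it agrees with smoothness
  for the induced structure.
\<close>

definition smooth_map_on ::
    "('p, 'a::euclidean_space) atlas \<Rightarrow> ('r, 'b::euclidean_space) atlas \<Rightarrow> 'p set \<Rightarrow>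
     ('p \<Rightarrow> 'r) \<Rightarrow> bool" where
  "smooth_map_on A B S f \<longleftrightarrow>
     (\<forall>x\<in>S. \<exists>(D, \<phi>)\<in>A. \<exists>(E, \<psi>)\<in>B. x \<in> D \<and> f x \<in> E \<and>
        (\<exists>W g. open W \<and> \<phi> x \<in> W \<and> W \<subseteq> \<phi> ` D \<and> C_inf g W \<and>
           (\<forall>y\<in>D \<inter> S. \<phi> y \<in> W \<longrightarrow> f y \<in> E \<and> \<psi> (f y) = g (\<phi> y))))"

section \<open>Tangent vectors, differentials and submanifolds\<close>

text \<open>
  Every point gets a preferred chart.  The tangent space at \<open>x\<close> is the model space
  \<open>'a\<close>: a tangent vector is represented by its components in \<open>chart_at A x\<close>.
  Correspondingly the cotangent space at \<open>x\<close> is \<open>'a \<Rightarrow>\<^sub>L real\<close>, and a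
  1-form is a function of type \<open>'p \<Rightarrow> 'a \<Rightarrow> real\<close>.
\<close>

definition chart_at :: "('p, 'a) atlas \<Rightarrow> 'p \<Rightarrow> ('p, 'a) chart" where
  "chart_at A x = (SOME c. c \<in> A \<and> x \<in> fst c)"

definition mderiv ::
    "('p, 'a::euclidean_space) atlas \<Rightarrow> ('r, 'b::euclidean_space) atlas \<Rightarrow>
     ('p \<Rightarrow> 'r) \<Rightarrow> 'p \<Rightarrow> 'a \<Rightarrow> 'b" where
  "mderiv A B f x =
     (let (D, \<phi>) = chart_at A x; (E, \<psi>) = chart_at B (f x)
      in frechet_derivative (\<psi> \<circ> f \<circ> inv_into D \<phi>) (at (\<phi> x)))"

definition diff_fun :: "('p, 'a::euclidean_space) atlas \<Rightarrow> ('p \<Rightarrow> real) \<Rightarrow> 'p \<Rightarrow> 'a \<Rightarrow> real" where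
  "diff_fun A f = mderiv A euc f"

definition pullback ::
    "('p, 'a::euclidean_space) atlas \<Rightarrow> ('r, 'b::euclidean_space) atlas \<Rightarrow> ('p \<Rightarrow> 'r) \<Rightarrow>
     ('r \<Rightarrow> 'b \<Rightarrow> real) \<Rightarrow> 'p \<Rightarrow> 'a \<Rightarrow> real" where
  "pullback A B f \<theta> x v = \<theta> (f x) (mderiv A B f x v)"

definition curve_through ::
    "('p, 'a::euclidean_space) atlas \<Rightarrow> 'p set \<Rightarrow> 'p \<Rightarrow> 'a \<Rightarrow> (real \<Rightarrow> 'p) \<Rightarrow> bool" where
  "curve_through A S x v \<gamma> \<longleftrightarrow>
     (\<exists>e>0. smooth_map_on euc A {-e<..<e} \<gamma> \<and> \<gamma> ` {-e<..<e} \<subseteq> S) \<and>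
     \<gamma> 0 = x \<and> mderiv euc A \<gamma> 0 1 = v"

definition tangent_space :: "('p, 'a::euclidean_space) atlas \<Rightarrow> 'p set \<Rightarrow> 'p \<Rightarrow> 'a set" where
  "tangent_space A S x = {v. \<exists>\<gamma>. curve_through A S x v \<gamma>}"

text \<open>
  Differential of a map that is defined on a submanifold \<open>S\<close> only; it is meaningful on
  \<open>tangent_space A S x\<close>.
\<close>

definition mderiv_on ::
    "('p, 'a::euclidean_space) atlas \<Rightarrow> ('r, 'b::euclidean_space) atlas \<Rightarrow> 'p set \<Rightarrow>
     ('p \<Rightarrow> 'r) \<Rightarrow> 'p \<Rightarrow> 'a \<Rightarrow> 'b" where
  "mderiv_on A B S f x v =
     (THE w. \<exists>\<gamma>. curve_through A S x v \<gamma> \<and> mderiv euc B (f \<circ> \<gamma>) 0 1 = w)"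

definition pullback_on ::
    "('p, 'a::euclidean_space) atlas \<Rightarrow> ('r, 'b::euclidean_space) atlas \<Rightarrow> 'p set \<Rightarrow>
     ('p \<Rightarrow> 'r) \<Rightarrow> ('r \<Rightarrow> 'b \<Rightarrow> real) \<Rightarrow> 'p \<Rightarrow> 'a \<Rightarrow> real" where
  "pullback_on A B S f \<theta> x v = \<theta> (f x) (mderiv_on A B S f x v)"

text \<open>A chart of the maximal atlas.\<close>

definition compatible_chart :: "('p, 'a::euclidean_space) atlas \<Rightarrow> ('p, 'a) chart \<Rightarrow> bool" where
  "compatible_chart A c \<longleftrightarrow>
     (case c of (D, \<phi>) \<Rightarrow>
        openin (mtopology A) D \<and> inj_on \<phi> D \<and> open (\<phi> ` D) \<and>
        smooth_map_on A euc D \<phi> \<and> smooth_map_on euc A (\<phi> ` D) (inv_into D \<phi>))"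

definition embedded_submanifold ::
    "('p, 'a::euclidean_space) atlas \<Rightarrow> nat \<Rightarrow> 'p set \<Rightarrow> bool" where
  \<comment> \<open>the second argument is the codimension\<close>
  "embedded_submanifold A d S \<longleftrightarrow>
     S \<subseteq> mcarrier A \<and>
     (\<forall>x\<in>S. \<exists>D \<phi> W. compatible_chart A (D, \<phi>) \<and> x \<in> D \<and>
        subspace W \<and> dim W + d = DIM('a) \<and> \<phi> ` (D \<inter> S) = \<phi> ` D \<inter> W)"

text \<open>
  For a set that need not be a submanifold, having codimension at least \<open>d\<close> means being
  covered by countably many embedded submanifolds of codimension at least \<open>d\<close>.
\<close>

definition codim_at_least ::
    "('p, 'a::euclidean_space) atlas \<Rightarrow> nat \<Rightarrow> 'p set \<Rightarrow> bool" where
  "codim_at_least A d C \<longleftrightarrow>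
     (\<exists>\<N>. countable \<N> \<and> (\<forall>N\<in>\<N>. \<exists>k\<ge>d. embedded_submanifold A k N) \<and> C \<subseteq> \<Union>\<N>)"

definition immersion_on ::
    "('p, 'a::euclidean_space) atlas \<Rightarrow> ('r, 'b::euclidean_space) atlas \<Rightarrow> 'p set \<Rightarrow>
     ('p \<Rightarrow> 'r) \<Rightarrow> bool" where
  "immersion_on A B S f \<longleftrightarrow>
     smooth_map_on A B S f \<and> (\<forall>x\<in>S. inj_on (mderiv_on A B S f x) (tangent_space A S x))"

definition smooth_embedding_on ::
    "('p, 'a::euclidean_space) atlas \<Rightarrow> ('r, 'b::euclidean_space) atlas \<Rightarrow> 'p set \<Rightarrow>
     ('p \<Rightarrow> 'r) \<Rightarrow> bool" where
  "smooth_embedding_on A B S f \<longleftrightarrow>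
     immersion_on A B S f \<and> embedding_map (subtopology (mtopology A) S) (mtopology B) f"

section \<open>The cotangent bundle\<close>

type_synonym ('p, 'a) cot = "'p \<times> ('a \<Rightarrow>\<^sub>L real)"

text \<open>The coordinate vector of a chart in direction \<open>b\<close>, as a tangent vector at \<open>x\<close>.\<close>

definition coord_vector ::
    "('p, 'a::euclidean_space) atlas \<Rightarrow> ('p, 'a) chart \<Rightarrow> 'p \<Rightarrow> 'a \<Rightarrow> 'a" where
  "coord_vector A c x b =
     (case c of (D, \<phi>) \<Rightarrow>
        frechet_derivative (snd (chart_at A x) \<circ> inv_into D \<phi>) (at (\<phi> x)) b)"

text \<open>
  The cotangent bundle with its natural charts \<open>(x\<^sup>i, p\<^sub>i)\<close>; the dual coordinates
  \<open>p\<^sub>i\<close> are collected in one vector of the model space.  Its points are the pairs of a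
  point of the base and a covector at that point, and \<open>fst\<close> is the bundle projection.
\<close>

definition cot_chart ::
    "('p, 'a::euclidean_space) atlas \<Rightarrow> ('p, 'a) chart \<Rightarrow> (('p, 'a) cot, 'a \<times> 'a) chart" where
  "cot_chart A c =
     (fst c \<times> UNIV,
      \<lambda>(x, p). (snd c x, \<Sum>b\<in>Basis. blinfun_apply p (coord_vector A c x b) *\<^sub>R b))"

definition cotangent ::
    "('p, 'a::euclidean_space) atlas \<Rightarrow> (('p, 'a) cot, 'a \<times> 'a) atlas" where
  "cotangent A = cot_chart A ` A"

text \<open>
  The tautological form \<open>p\<^sub>i dx\<^sup>i\<close> and the symplectic form \<open>dx\<^sup>i \<and> dp\<^sub>i\<close>.  Tangent
  vectors of the cotangent bundle at \<open>z\<close> are already given by their components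
  \<open>(dx\<^sup>i, dp\<^sub>i)\<close> in the natural chart \<open>chart_at (cotangent A) z\<close>.
\<close>

definition liouville_form ::
    "('p, 'a::euclidean_space) atlas \<Rightarrow> ('p, 'a) cot \<Rightarrow> 'a \<times> 'a \<Rightarrow> real" where
  "liouville_form A z v = snd (snd (chart_at (cotangent A) z) z) \<bullet> fst v"

definition symplectic_form ::
    "('p, 'a::euclidean_space) atlas \<Rightarrow> ('p, 'a) cot \<Rightarrow> 'a \<times> 'a \<Rightarrow> 'a \<times> 'a \<Rightarrow> real" where
  "symplectic_form A z v w = fst v \<bullet> snd w - fst w \<bullet> snd v"

definition ham_vector_field ::
    "('p, 'a::euclidean_space) atlas \<Rightarrow> (('p, 'a) cot \<Rightarrow> real) \<Rightarrow> ('p, 'a) cot \<Rightarrow> 'a \<times> 'a" where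
  "ham_vector_field A H z =
     (THE X. \<forall>w. symplectic_form A z X w = diff_fun (cotangent A) H z w)"

text \<open>\<open>\<vartheta>\<^sub>H = p\<^sub>i dx\<^sup>i - H dt\<close> on the product of the time axis with the cotangent bundle\<close>

definition theta_form ::
    "('p, 'a::euclidean_space) atlas \<Rightarrow> (('p, 'a) cot \<Rightarrow> real) \<Rightarrow>
     real \<times> ('p, 'a) cot \<Rightarrow> real \<times> ('a \<times> 'a) \<Rightarrow> real" where
  "theta_form A H z v =
     pullback (euc \<times>\<^sub>M cotangent A) (cotangent A) snd (liouville_form A) z v
     - H (snd z) * diff_fun (euc \<times>\<^sub>M cotangent A) fst z v"

section \<open>Controlled mechanical systems with position-dependent impacts\<close>

text \<open>
  \<open>Q\<close> is the atlas of the configuration space, \<open>G\<close> the uncontrolled Hamiltonian,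
  \<open>F\<close> the control force and \<open>l\<close> the running cost.
\<close>

type_synonym ('q, 'a) phase = "('q, 'a) cot"
type_synonym ('q, 'a) extended = "(('q, 'a) cot, 'a \<times> 'a) cot"

definition controlled_field ::
    "('q, 'a::euclidean_space) atlas \<Rightarrow> (('q, 'a) phase \<Rightarrow> real) \<Rightarrow>
     ('u \<Rightarrow> 'q \<Rightarrow> 'a \<Rightarrow>\<^sub>L real) \<Rightarrow> ('q, 'a) phase \<Rightarrow> 'u \<Rightarrow> 'a \<times> 'a" where
  "controlled_field Q G F x u =
     (THE X. \<forall>w. symplectic_form Q x X w - diff_fun (cotangent Q) G x w
                 + pullback (cotangent Q) Q fst (\<lambda>q. blinfun_apply (F u q)) x w = 0)"

definition impact_location :: "('q, 'a::euclidean_space) atlas \<Rightarrow> ('q \<Rightarrow> real) \<Rightarrow> 'q set" where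
  "impact_location Q h = {q \<in> mcarrier Q. h q = 0}"

definition guard ::
    "('q, 'a::euclidean_space) atlas \<Rightarrow> (('q, 'a) phase \<Rightarrow> real) \<Rightarrow> ('q \<Rightarrow> real) \<Rightarrow>
     ('q, 'a) phase set" where
  "guard Q G h =
     {x \<in> mcarrier (cotangent Q). fst x \<in> impact_location Q h \<and>
        pullback (cotangent Q) Q fst (diff_fun Q h) x (ham_vector_field Q G x) > 0}"

text \<open>The corner conditions; the multiplier \<open>\<epsilon>\<close> may depend on the point of the guard.\<close>

definition impact_reset ::
    "('q, 'a::euclidean_space) atlas \<Rightarrow> (('q, 'a) phase \<Rightarrow> real) \<Rightarrow> ('q \<Rightarrow> real) \<Rightarrow>
     (('q, 'a) phase \<Rightarrow> ('q, 'a) phase) \<Rightarrow> bool" where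
  "impact_reset Q G h \<Delta> \<longleftrightarrow>
     (\<forall>x\<in>guard Q G h.
        fst (\<Delta> x) = fst x \<and>
        (\<exists>\<epsilon>. \<forall>v. blinfun_apply (snd (\<Delta> x)) v
                   = blinfun_apply (snd x) v + \<epsilon> * diff_fun Q h (fst x) v) \<and>
        G (\<Delta> x) = G x)"

definition hybrid_reset ::
    "('p, 'a::euclidean_space) atlas \<Rightarrow> 'p set \<Rightarrow> ('p \<Rightarrow> 'p) \<Rightarrow> bool" where
  "hybrid_reset M \<Sigma> \<Delta> \<longleftrightarrow>
     smooth_map_on M M \<Sigma> \<Delta> \<and>
     (\<exists>d. embedded_submanifold M d (\<Delta> ` \<Sigma>)) \<and>
     \<Sigma> \<inter> \<Delta> ` \<Sigma> = {} \<and>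
     codim_at_least M 2 (mtopology M closure_of \<Sigma> \<inter> mtopology M closure_of (\<Delta> ` \<Sigma>))"

section \<open>The optimal Hamiltonian and the lifted system\<close>

definition control_bracket ::
    "('q, 'a::euclidean_space) atlas \<Rightarrow> (('q, 'a) phase \<Rightarrow> real) \<Rightarrow>
     ('u \<Rightarrow> 'q \<Rightarrow> 'a \<Rightarrow>\<^sub>L real) \<Rightarrow> (('q, 'a) phase \<Rightarrow> 'u \<Rightarrow> real) \<Rightarrow>
     ('q, 'a) extended \<Rightarrow> 'u \<Rightarrow> real" where
  "control_bracket Q G F l z u =
     l (fst z) u + blinfun_apply (snd z) (controlled_field Q G F (fst z) u)"

definition optimal_hamiltonian ::
    "('q, 'a::euclidean_space) atlas \<Rightarrow> (('q, 'a) phase \<Rightarrow> real) \<Rightarrow> 'u set \<Rightarrow>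
     ('u \<Rightarrow> 'q \<Rightarrow> 'a \<Rightarrow>\<^sub>L real) \<Rightarrow> (('q, 'a) phase \<Rightarrow> 'u \<Rightarrow> real) \<Rightarrow>
     ('q, 'a) extended \<Rightarrow> real" where
  "optimal_hamiltonian Q G U F l z = (LEAST r. r \<in> control_bracket Q G F l z ` U)"

text \<open>
  The minimum is attained, the minimizer is the only critical point of the bracket in the closed
  control set, and it depends smoothly on the point of the extended phase space.
\<close>

definition regular_minimizer ::
    "('q, 'a::euclidean_space) atlas \<Rightarrow> (('q, 'a) phase \<Rightarrow> real) \<Rightarrow> ('u::euclidean_space) set \<Rightarrow>
     ('u \<Rightarrow> 'q \<Rightarrow> 'a \<Rightarrow>\<^sub>L real) \<Rightarrow> (('q, 'a) phase \<Rightarrow> 'u \<Rightarrow> real) \<Rightarrow> bool" where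
  "regular_minimizer Q G U F l \<longleftrightarrow>
     (\<exists>us. smooth_map_on (cotangent (cotangent Q)) euc (mcarrier (cotangent (cotangent Q))) us \<and>
        (\<forall>z\<in>mcarrier (cotangent (cotangent Q)).
           is_arg_min (control_bracket Q G F l z) (\<lambda>u. u \<in> U) (us z) \<and>
           (\<forall>u\<in>U. (control_bracket Q G F l z has_derivative (\<lambda>_. 0)) (at u within U)
                   \<longleftrightarrow> u = us z)))"

definition extended_guard ::
    "('q, 'a::euclidean_space) atlas \<Rightarrow> (('q, 'a) phase \<Rightarrow> real) \<Rightarrow> ('q \<Rightarrow> real) \<Rightarrow>
     (('q, 'a) extended \<Rightarrow> real) \<Rightarrow> ('q, 'a) extended set" where
  "extended_guard Q G h H =
     {z \<in> mcarrier (cotangent (cotangent Q)). fst z \<in> guard Q G h \<and>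
        pullback (cotangent (cotangent Q)) (cotangent Q) fst
          (pullback (cotangent Q) Q fst (diff_fun Q h)) z
          (ham_vector_field (cotangent Q) H z) > 0}"

definition solves_extended_reset ::
    "('p, 'a::euclidean_space) atlas \<Rightarrow> ('p \<Rightarrow> 'p) \<Rightarrow> (('p, 'a) cot \<Rightarrow> real) \<Rightarrow>
     ('p, 'a) cot set \<Rightarrow> (('p, 'a) cot \<Rightarrow> ('p, 'a) cot) \<Rightarrow> bool" where
  "solves_extended_reset M \<Delta> H S D \<longleftrightarrow>
     smooth_map_on (cotangent M) (cotangent M) S D \<and>
     (\<forall>z\<in>UNIV \<times> S. \<forall>v\<in>tangent_space (euc \<times>\<^sub>M cotangent M) (UNIV \<times> S) z.
        pullback_on (euc \<times>\<^sub>M cotangent M) (euc \<times>\<^sub>M cotangent M) (UNIV \<times> S)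
          (map_prod id D) (theta_form M H) z v
        = pullback_on (euc \<times>\<^sub>M cotangent M) (euc \<times>\<^sub>M cotangent M) (UNIV \<times> S)
            id (theta_form M H) z v) \<and>
     (\<forall>z\<in>S. fst (D z) = \<Delta> (fst z))"

definition quadratic_hamiltonian ::
    "('p, 'a::euclidean_space) atlas \<Rightarrow> (('p, 'a) cot \<Rightarrow> real) \<Rightarrow>
     ('p \<Rightarrow> ('a \<Rightarrow>\<^sub>L real) \<Rightarrow> ('a \<Rightarrow>\<^sub>L real) \<Rightarrow> real) \<Rightarrow> ('p \<Rightarrow> 'a) \<Rightarrow> ('p \<Rightarrow> real) \<Rightarrow> bool" where
  "quadratic_hamiltonian M H \<beta> f V \<longleftrightarrow>
     (\<forall>x\<in>mcarrier M.
        bilinear (\<beta> x) \<and> (\<forall>p p'. \<beta> x p p' = \<beta> x p' p) \<and>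
        (\<forall>p. H (x, p) = \<beta> x p p + blinfun_apply p (f x) + V x))"

definition augmented_differential ::
    "('p, 'a::euclidean_space) atlas \<Rightarrow> 'p set \<Rightarrow> ('p \<Rightarrow> 'p) \<Rightarrow> ('p \<Rightarrow> 'a) \<Rightarrow> 'p \<Rightarrow> 'a \<Rightarrow> 'a" where
  "augmented_differential M \<Sigma> \<Delta> f x =
     (THE L. linear L \<and> (\<forall>u\<in>tangent_space M \<Sigma> x. L u = mderiv_on M M \<Sigma> \<Delta> x u) \<and>
             L (f x) = f (\<Delta> x))"

definition invariant_potential :: "'p set \<Rightarrow> ('p \<Rightarrow> 'p) \<Rightarrow> ('p \<Rightarrow> real) \<Rightarrow> bool" where
  "invariant_potential \<Sigma> \<Delta> V \<longleftrightarrow> (\<forall>x\<in>\<Sigma>. V (\<Delta> x) = V x)"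

definition invariant_form ::
    "('p, 'a::euclidean_space) atlas \<Rightarrow> 'p set \<Rightarrow> ('p \<Rightarrow> 'p) \<Rightarrow> ('p \<Rightarrow> 'a) \<Rightarrow>
     ('p \<Rightarrow> ('a \<Rightarrow>\<^sub>L real) \<Rightarrow> ('a \<Rightarrow>\<^sub>L real) \<Rightarrow> real) \<Rightarrow> bool" where
  "invariant_form M \<Sigma> \<Delta> f \<beta> \<longleftrightarrow>
     (\<forall>x\<in>\<Sigma>. \<forall>p.
        let p' = p o\<^sub>L Blinfun (inv (augmented_differential M \<Sigma> \<Delta> f x))
        in \<beta> (\<Delta> x) p' p' = \<beta> x p p)"

text \<open>
  Linear bundle isomorphism from the cotangent bundle restricted to \<open>S\<close> onto the cotangent
  bundle restricted to \<open>\<Delta> ` S\<close>, covering \<open>\<Delta>\<close>.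
\<close>

definition linear_bundle_iso ::
    "('p, 'a::euclidean_space) atlas \<Rightarrow> 'p set \<Rightarrow> ('p \<Rightarrow> 'p) \<Rightarrow>
     (('p, 'a) cot \<Rightarrow> ('p, 'a) cot) \<Rightarrow> bool" where
  "linear_bundle_iso M S \<Delta> D \<longleftrightarrow>
     bij_betw D (S \<times> UNIV) (\<Delta> ` S \<times> UNIV) \<and>
     smooth_map_on (cotangent M) (cotangent M) (S \<times> UNIV) D \<and>
     smooth_map_on (cotangent M) (cotangent M) (\<Delta> ` S \<times> UNIV) (inv_into (S \<times> UNIV) D) \<and>
     (\<forall>x\<in>S. \<exists>L. linear L \<and> bij L \<and> (\<forall>p. D (x, p) = (\<Delta> x, L p)))"

end

theory Submission
  imports Defs
begin

text \<open>
  The control acts by vertical forces, so the envelope theorem gives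
  \<open>d/ds H(x, p + s dh) = dh(X\<^sub>G)\<close> along the fibres of \<open>T\<^sup>*M\<close>.  Its right-hand side does not
  involve \<open>p\<close>; this makes the extended guard the full preimage of the guard and, for a quadratic
  \<open>H\<close>, forces \<open>\<beta>(\<cdot>, dh) = 0\<close> and \<open>dh(f) = dh(X\<^sub>G)\<close>.

  The \<open>dx\<close>-part of the extended reset equation fixes the new covector on \<open>\<Delta>\<^sub>*T\<Sigma> = ker dh\<close>, hence
  up to a multiple of \<open>dh\<close>, and the \<open>dt\<close>-part is conservation of \<open>H\<close>.  As \<open>\<beta>(\<cdot>, dh) = 0\<close>, the latter
  is an affine equation for the multiplier with leading coefficient \<open>dh(f)\<close> at \<open>\<Delta>(x)\<close>.  This does
  not vanish: differentiate \<open>G \<circ> \<Delta> = G\<close> in the vertical direction \<open>dh\<close>.  The solution is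
  \<open>p \<circ> (\<Delta>\<^sub>*\<^sup>f)\<^sup>-\<^sup>1 + \<lambda> dh\<close>, and under the invariance conditions \<open>\<lambda> = 0\<close>.

  Smoothness is local extendability.  In charts the augmented differential is extended off the
  guard by an explicit formula in a local extension of \<open>\<Delta>\<close>, and smoothness of the inverse bundle
  map comes from the inverse function theorem for a local diffeomorphism that extends \<open>\<Delta>\<close>.
\<close>

section \<open>Calculus of smooth maps between Euclidean spaces\<close>

text \<open>The envelope identity is obtained without differentiating the minimizer. With the
  control frozen at \<open>us (x, p)\<close>, the bracket is an upper bound for \<open>H\<close>
  that is affine along the fibre line and touches \<open>H\<close> at \<open>s = 0\<close>; so
  \<open>H\<close> minus an affine function has a maximum there. The identity holds over the whole
  phase space and not only over the guard. This matters because the momentum is corrected in the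
  fibre over the reset state \<open>\<Delta> x\<close>, which is not a guard point.

  The corner conditions give no regularity of the multiplier \<epsilon> as a function of the state.
  The image under \<Delta> of a vertical line in the guard is nevertheless a differentiable curve,
  because \<Delta> is smooth, and it stays on a vertical line with direction dh. Its velocity is
  therefore a multiple of dh, which is all that energy conservation needs.

  The submanifold S and its equation h are related only as sets. That the tangent spaces of the
  guard are the kernels of dh, pulled back to the phase space, has to be derived: dh cannot vanish
  at guard points, and a count of dimensions does the rest.\<close>

lemma C_k_cong:
  assumes "open W" "\<And>x. x \<in> W \<Longrightarrow> f x = g x" "C_k k g W"
  shows "C_k k f W"
  using assms(2,3)
proof (induction k arbitrary: f g)
  case 0
  then show ?case by (metis C_k.simps(1) continuous_on_cong)
next
  case (Suc k)
  have g: "(g has_derivative frechet_derivative g (at x)) (at x)" if "x \<in> W" for x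
    using Suc.prems(2) that assms(1)
    by (simp add: differentiable_on_eq_differentiable_at frechet_derivative_works)
  have f: "(f has_derivative frechet_derivative g (at x)) (at x)" if "x \<in> W" for x
    using has_derivative_transform_within_open[OF g[OF that] assms(1) that] Suc.prems(1) by metis
  have "C_k k (\<lambda>x. frechet_derivative f (at x) v) W" for v
  proof (rule Suc.IH)
    show "frechet_derivative f (at x) v = frechet_derivative g (at x) v" if "x \<in> W" for x
      using frechet_derivative_at[OF f[OF that]] by simp
  qed (use Suc.prems(2) in simp)
  moreover have "f differentiable_on W"
    using f by (meson differentiable_at_imp_differentiable_on differentiable_def)
  ultimately show ?case by simp
qed

lemma C_k_Suc_derivativeI:
  assumes "open W" and f': "\<And>x. x \<in> W \<Longrightarrow> (f has_derivative f' x) (at x)"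
    and "\<And>v. C_k k (\<lambda>x. f' x v) W"
  shows "C_k (Suc k) f W"
proof -
  have "C_k k (\<lambda>x. frechet_derivative f (at x) v) W" for v
  proof (rule C_k_cong[OF assms(1) _ assms(3)[of v]])
    show "frechet_derivative f (at x) v = f' x v" if "x \<in> W" for x
      using frechet_derivative_at[OF f'[OF that]] by simp
  qed
  moreover have "f differentiable_on W"
    using f' by (meson differentiable_at_imp_differentiable_on differentiable_def)
  ultimately show ?thesis by simp
qed

lemma C_k_SucD:
  assumes "C_k (Suc k) f W" "open W"
  shows "\<And>x. x \<in> W \<Longrightarrow> (f has_derivative frechet_derivative f (at x)) (at x)"
    and "\<And>v. C_k k (\<lambda>x. frechet_derivative f (at x) v) W"
  using assms by (auto simp: differentiable_on_eq_differentiable_at frechet_derivative_works)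

lemma C_k_Suc_imp: "C_k (Suc k) f W \<Longrightarrow> C_k k f W"
  by (induction k arbitrary: f) (auto simp: differentiable_imp_continuous_on)

lemma C_k_subset:
  assumes "C_k k f W" "W' \<subseteq> W"
  shows "C_k k f W'"
  using assms(1)
  by (induction k arbitrary: f)
     (use assms(2) in \<open>auto intro: continuous_on_subset differentiable_on_subset\<close>)

lemma C_k_local:
  assumes "\<And>x. x \<in> W \<Longrightarrow> \<exists>W'. open W' \<and> x \<in> W' \<and> C_k k f W'"
  shows "C_k k f W"
  using assms
proof (induction k arbitrary: f)
  case 0
  then have "continuous (at x) f" if "x \<in> W" for x
    using that by (metis C_k.simps(1) at_within_interior continuous_on_eq_continuous_within interior_open)
  then show ?case by (simp add: continuous_at_imp_continuous_on)
next
  case (Suc k)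
  have "f differentiable (at x)" if "x \<in> W" for x
    using Suc.prems[OF that] by (auto simp: differentiable_on_eq_differentiable_at)
  moreover have "C_k k (\<lambda>x. frechet_derivative f (at x) v) W" for v
    by (rule Suc.IH) (use Suc.prems in \<open>metis C_k_SucD(2)\<close>)
  ultimately show ?case
    by (simp add: differentiable_at_imp_differentiable_on)
qed

lemma C_k_const [simp]: "C_k k (\<lambda>x. c) W"
  by (induction k arbitrary: c) (auto simp: frechet_derivative_const)

lemma C_k_bounded_linear:
  assumes "bounded_linear L"
  shows "C_k k L W"
proof (cases k)
  case 0
  then show ?thesis using assms by (simp add: linear_continuous_on)
next
  case (Suc j)
  have "frechet_derivative L (at x) = L" for x
    using assms bounded_linear_imp_has_derivative frechet_derivative_at by metis
  then show ?thesis using Suc assms bounded_linear_imp_differentiable_on by auto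
qed

lemma C_k_add:
  assumes "open W" "C_k k f W" "C_k k g W"
  shows "C_k k (\<lambda>x. f x + g x) W"
  using assms(2,3)
proof (induction k arbitrary: f g)
  case 0
  then show ?case by (simp add: continuous_on_add)
next
  case (Suc k)
  note f = C_k_SucD[OF Suc.prems(1) assms(1)] and g = C_k_SucD[OF Suc.prems(2) assms(1)]
  show ?case
    by (rule C_k_Suc_derivativeI[OF assms(1) has_derivative_add[OF f(1) g(1)]])
       (assumption | rule Suc.IH f(2) g(2))+
qed

lemma C_k_sum:
  assumes "open W" "\<And>i. i \<in> I \<Longrightarrow> C_k k (f i) W"
  shows "C_k k (\<lambda>x. \<Sum>i\<in>I. f i x) W"
  using assms(2) by (induction I rule: infinite_finite_induct) (auto intro: C_k_add[OF assms(1)])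

lemma C_k_bilinear:
  assumes "bounded_bilinear B" and W: "open W" and "C_k k f W" "C_k k g W"
  shows "C_k k (\<lambda>x. B (f x) (g x)) W"
  using assms(3,4)
proof (induction k arbitrary: f g)
  case 0
  then show ?case by (simp add: assms(1) bounded_bilinear.continuous_on)
next
  case (Suc k)
  note f = C_k_SucD[OF Suc.prems(1) W] and g = C_k_SucD[OF Suc.prems(2) W]
  show ?case
    by (rule C_k_Suc_derivativeI[OF W bounded_bilinear.FDERIV[OF assms(1) f(1) g(1)]])
       (assumption | rule C_k_add[OF W] Suc.IH f(2) g(2) C_k_Suc_imp[OF Suc.prems(1)]
         C_k_Suc_imp[OF Suc.prems(2)])+
qed

lemma C_k_linear_compose:
  assumes "bounded_linear L" and W: "open W" and "C_k k f W"
  shows "C_k k (\<lambda>x. L (f x)) W"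
  using assms(3)
proof (induction k arbitrary: f)
  case 0
  then show ?case by (simp add: assms(1) bounded_linear.continuous_on)
next
  case (Suc k)
  note f = C_k_SucD[OF Suc.prems(1) W]
  show ?case
    by (rule C_k_Suc_derivativeI[OF W bounded_linear.has_derivative[OF assms(1) f(1)]])
       (assumption | rule Suc.IH f(2))+
qed

lemma C_k_Pair:
  assumes "open W" "C_k k f W" "C_k k g W"
  shows "C_k k (\<lambda>x. (f x, g x)) W"
proof -
  have "C_k k (\<lambda>x. (f x, 0)) W" "C_k k (\<lambda>x. (0, g x)) W"
    by (rule C_k_linear_compose[OF _ assms(1)];
        simp add: assms bounded_linear_Pair bounded_linear_ident bounded_linear_zero)+
  from C_k_add[OF assms(1) this] show ?thesis by simp
qed

lemma linear_Basis_expansion: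
  fixes L :: "'a::euclidean_space \<Rightarrow> 'b::real_vector"
  assumes "linear L"
  shows "L v = (\<Sum>b\<in>Basis. (v \<bullet> b) *\<^sub>R L b)"
proof -
  have "L v = L (\<Sum>b\<in>Basis. (v \<bullet> b) *\<^sub>R b)" by (simp add: euclidean_representation)
  also have "\<dots> = (\<Sum>b\<in>Basis. (v \<bullet> b) *\<^sub>R L b)" using assms by (simp add: linear_sum linear_scale)
  finally show ?thesis .
qed

text \<open>The chain rule evaluates the derivative of \<open>f\<close> in a direction that depends
  on \<open>x\<close>, whereas \<open>C_k\<close> speaks only of fixed directions. Expanding over
  \<open>Basis\<close> leaves scalar coefficients times derivatives of \<open>f\<close> in fixed
  directions composed with \<open>g\<close>, and these fall under the induction hypothesis.\<close>

lemma C_k_compose: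
  fixes f :: "'b::euclidean_space \<Rightarrow> 'c::real_normed_vector"
  assumes "open W" "open W'" "C_k k f W'" "C_k k g W" "g ` W \<subseteq> W'"
  shows "C_k k (\<lambda>x. f (g x)) W"
  using assms(3,4)
proof (induction k arbitrary: f)
  case 0
  then show ?case using continuous_on_compose2[OF _ _ assms(5)] by simp
next
  case (Suc k)
  note f = C_k_SucD[OF Suc.prems(1) assms(2)] and g = C_k_SucD[OF Suc.prems(2) assms(1)]
  have D: "((\<lambda>x. f (g x)) has_derivative
      (\<lambda>v. \<Sum>b\<in>Basis. (frechet_derivative g (at x) v \<bullet> b) *\<^sub>R frechet_derivative f (at (g x)) b)) (at x)"
    if x: "x \<in> W" for x
  proof -
    have fx: "(f has_derivative frechet_derivative f (at (g x))) (at (g x))"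
      using f(1) assms(5) x by blast
    have "linear (frechet_derivative f (at (g x)))" using fx has_derivative_linear by blast
    then have "(\<lambda>v. frechet_derivative f (at (g x)) (frechet_derivative g (at x) v)) =
        (\<lambda>v. \<Sum>b\<in>Basis. (frechet_derivative g (at x) v \<bullet> b) *\<^sub>R frechet_derivative f (at (g x)) b)"
      by (intro ext) (rule linear_Basis_expansion)
    then show ?thesis using has_derivative_compose[OF g(1)[OF x] fx] by simp
  qed
  show ?case
    by (rule C_k_Suc_derivativeI[OF assms(1) D])
       (assumption | rule C_k_sum[OF assms(1)] C_k_bilinear[OF bounded_bilinear_scaleR assms(1)]
          C_k_linear_compose[OF bounded_linear_inner_left assms(1)] g(2)
          Suc.IH[OF f(2) C_k_Suc_imp[OF Suc.prems(2)]])+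
qed

text \<open>The derivative of the inverse is a product of inverses again, so every step of the
  induction gains one order.\<close>

lemma C_k_inverse_real: "C_k k (inverse :: real \<Rightarrow> real) (- {0})"
proof (induction k)
  case 0
  then show ?case by (simp add: continuous_on_inverse)
next
  case (Suc k)
  have o: "open (- {0::real})" by (rule open_Compl) (rule closed_singleton)
  show ?case
    by (rule C_k_Suc_derivativeI[OF o has_derivative_inverse'])
       (simp | assumption | rule C_k_linear_compose[OF bounded_linear_minus[OF bounded_linear_ident] o]
         C_k_bilinear[OF bounded_bilinear_mult o] Suc)+
qed

lemma C_inf_cong: "open W \<Longrightarrow> (\<And>x. x \<in> W \<Longrightarrow> f x = g x) \<Longrightarrow> C_inf g W \<Longrightarrow> C_inf f W"
  unfolding C_inf_def by (metis C_k_cong)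

lemma C_inf_subset: "C_inf f W \<Longrightarrow> W' \<subseteq> W \<Longrightarrow> C_inf f W'"
  unfolding C_inf_def by (metis C_k_subset)

lemma C_inf_local:
  assumes "\<And>x. x \<in> W \<Longrightarrow> \<exists>W'. open W' \<and> x \<in> W' \<and> C_inf f W'"
  shows "C_inf f W"
  using assms unfolding C_inf_def by (metis C_k_local)

lemma C_inf_const [simp]: "C_inf (\<lambda>x. c) W"
  by (simp add: C_inf_def)

lemma C_inf_bounded_linear: "bounded_linear L \<Longrightarrow> C_inf L W"
  by (simp add: C_inf_def C_k_bounded_linear)

lemma C_inf_id [simp]: "C_inf (\<lambda>x. x) W"
  by (simp add: C_inf_bounded_linear bounded_linear_ident)

lemma C_inf_add: "open W \<Longrightarrow> C_inf f W \<Longrightarrow> C_inf g W \<Longrightarrow> C_inf (\<lambda>x. f x + g x) W"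
  by (simp add: C_inf_def C_k_add)

lemma C_inf_sum: "open W \<Longrightarrow> (\<And>i. i \<in> I \<Longrightarrow> C_inf (f i) W) \<Longrightarrow> C_inf (\<lambda>x. \<Sum>i\<in>I. f i x) W"
  by (simp add: C_inf_def C_k_sum)

lemma C_inf_bilinear:
  "bounded_bilinear B \<Longrightarrow> open W \<Longrightarrow> C_inf f W \<Longrightarrow> C_inf g W \<Longrightarrow> C_inf (\<lambda>x. B (f x) (g x)) W"
  by (simp add: C_inf_def C_k_bilinear)

lemmas C_inf_scaleR = C_inf_bilinear[OF bounded_bilinear_scaleR]
  and C_inf_mult = C_inf_bilinear[OF bounded_bilinear_mult]
  and C_inf_inner = C_inf_bilinear[OF bounded_bilinear_inner]

lemma C_inf_linear_compose:
  "bounded_linear L \<Longrightarrow> open W \<Longrightarrow> C_inf f W \<Longrightarrow> C_inf (\<lambda>x. L (f x)) W"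
  by (simp add: C_inf_def C_k_linear_compose)

lemmas C_inf_fst = C_inf_linear_compose[OF bounded_linear_fst]
  and C_inf_snd = C_inf_linear_compose[OF bounded_linear_snd]
  and C_inf_uminus = C_inf_linear_compose[OF bounded_linear_minus[OF bounded_linear_ident]]

lemma C_inf_diff: "open W \<Longrightarrow> C_inf f W \<Longrightarrow> C_inf g W \<Longrightarrow> C_inf (\<lambda>x. f x - g x) W"
  using C_inf_add[OF _ _ C_inf_uminus, of W f g] by simp

lemma C_inf_Pair: "open W \<Longrightarrow> C_inf f W \<Longrightarrow> C_inf g W \<Longrightarrow> C_inf (\<lambda>x. (f x, g x)) W"
  by (simp add: C_inf_def C_k_Pair)

lemma C_inf_compose:
  fixes f :: "'b::euclidean_space \<Rightarrow> 'c::real_normed_vector"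
  shows "open W \<Longrightarrow> open W' \<Longrightarrow> C_inf f W' \<Longrightarrow> C_inf g W \<Longrightarrow> g ` W \<subseteq> W' \<Longrightarrow> C_inf (\<lambda>x. f (g x)) W"
  by (simp add: C_inf_def C_k_compose)

lemma C_inf_divide:
  fixes f g :: "_ \<Rightarrow> real"
  assumes "open W" "C_inf f W" "C_inf g W" "\<And>x. x \<in> W \<Longrightarrow> g x \<noteq> 0"
  shows "C_inf (\<lambda>x. f x / g x) W"
proof -
  have o: "open (- {0::real})" by (rule open_Compl) (rule closed_singleton)
  have "C_inf (\<lambda>x. inverse (g x)) W"
    by (rule C_inf_compose[OF assms(1) o _ assms(3)]) (use assms(4) C_k_inverse_real in \<open>auto simp: C_inf_def\<close>)
  from C_inf_mult[OF assms(1,2) this] show ?thesis by (simp add: divide_inverse)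
qed

lemma C_inf_has_derivative:
  assumes "C_inf f W" "open W" "x \<in> W"
  shows "(f has_derivative frechet_derivative f (at x)) (at x)"
  using assms C_k_SucD(1) unfolding C_inf_def by blast

lemma C_inf_continuous_on: "C_inf f W \<Longrightarrow> continuous_on W f"
  unfolding C_inf_def by (metis C_k.simps(1))

lemma C_inf_frechet_derivative:
  assumes "C_inf f W" "open W"
  shows "C_inf (\<lambda>x. frechet_derivative f (at x) v) W"
  using assms C_k_SucD(2) unfolding C_inf_def by blast

section \<open>Smooth families of linear maps and the smooth inverse function theorem\<close>

lemma C_k_linear_apply:
  fixes A :: "'x::real_normed_vector \<Rightarrow> 'b::euclidean_space \<Rightarrow> 'c::real_normed_vector"
  assumes "open W" "\<And>x. x \<in> W \<Longrightarrow> linear (A x)" "\<And>b. b \<in> Basis \<Longrightarrow> C_k k (\<lambda>x. A x b) W" "C_k k v W"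
  shows "C_k k (\<lambda>x. A x (v x)) W"
proof (rule C_k_cong[OF assms(1)])
  show "A x (v x) = (\<Sum>b\<in>Basis. (v x \<bullet> b) *\<^sub>R A x b)" if "x \<in> W" for x
    using linear_Basis_expansion assms(2)[OF that] by blast
  show "C_k k (\<lambda>x. \<Sum>b\<in>Basis. (v x \<bullet> b) *\<^sub>R A x b) W"
    by (intro C_k_sum C_k_bilinear[OF bounded_bilinear_scaleR] 
        C_k_linear_compose[OF bounded_linear_inner_left] assms)
qed

text \<open>Families of linear maps stay plain functions throughout, and their smoothness is tested
  on basis vectors only. This suffices to apply them to a smoothly varying vector, by expanding that
  vector.\<close>

lemma C_inf_linear_apply:
  fixes A :: "'x::real_normed_vector \<Rightarrow> 'b::euclidean_space \<Rightarrow> 'c::real_normed_vector"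
  assumes "open W" "\<And>x. x \<in> W \<Longrightarrow> linear (A x)" "\<And>b. b \<in> Basis \<Longrightarrow> C_inf (\<lambda>x. A x b) W" "C_inf v W"
  shows "C_inf (\<lambda>x. A x (v x)) W"
  using assms by (simp add: C_inf_def C_k_linear_apply)

lemma C_inf_frechet_apply:
  fixes f :: "'b::euclidean_space \<Rightarrow> 'c::euclidean_space" and g :: "'x::euclidean_space \<Rightarrow> 'b"
  assumes "open W" "open W'" "C_inf f W'" "C_inf g W" "C_inf v W" "g ` W \<subseteq> W'"
  shows "C_inf (\<lambda>x. frechet_derivative f (at (g x)) (v x)) W"
proof (rule C_inf_linear_apply[OF assms(1), where A = "\<lambda>x. frechet_derivative f (at (g x))"])
  show "linear (frechet_derivative f (at (g x)))" if "x \<in> W" for x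
    using C_inf_has_derivative[OF assms(3,2)] assms(6) that has_derivative_linear by blast
  show "C_inf (\<lambda>x. frechet_derivative f (at (g x)) b) W" for b
    by (rule C_inf_compose[OF assms(1,2) C_inf_frechet_derivative[OF assms(3,2)] assms(4,6)])
qed (use assms in auto)

text \<open>Only first-order information about the inverse. Its higher smoothness needs smoothness
  of the inversion of linear maps, which is itself derived from this lemma; hence the split from
  \<open>C_inf_inverse_function\<close>.\<close>

lemma C_inf_inverse_function_aux:
  fixes f :: "'a::euclidean_space \<Rightarrow> 'a"
  assumes "open U" "C_inf f U" "x0 \<in> U" and inj: "inj (frechet_derivative f (at x0))"
  obtains U' V g where "open U'" "U' \<subseteq> U" "x0 \<in> U'" "open V" "f x0 \<in> V" "homeomorphism U' V f g"
    "\<And>y. y \<in> V \<Longrightarrow> bij (frechet_derivative f (at (g y)))"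
    "\<And>y. y \<in> V \<Longrightarrow> (g has_derivative inv (frechet_derivative f (at (g y)))) (at y)"
proof -
  let ?D = "\<lambda>x. frechet_derivative f (at x)"
  have D: "(f has_derivative ?D x) (at x)" if "x \<in> U" for x
    using C_inf_has_derivative assms that by blast
  then have bl: "bounded_linear (?D x)" if "x \<in> U" for x
    using that has_derivative_bounded_linear by blast
  let ?f' = "\<lambda>x. Blinfun (?D x)"
  have app: "blinfun_apply (?f' x) = ?D x" if "x \<in> U" for x
    using bl[OF that] by (simp add: bounded_linear_Blinfun_apply)
  \<comment> \<open>In finite dimension, continuity on each vector is continuity in the operator
    norm.\<close>
  have cont: "continuous_on U ?f'"
  proof (rule continuous_on_blinfun_componentwise)
    fix i :: 'a
    have "continuous_on U (\<lambda>x. ?D x i)"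
      by (rule C_inf_continuous_on[OF C_inf_frechet_derivative[OF assms(2,1)]])
    then show "continuous_on U (\<lambda>x. ?f' x i)"
      by (rule continuous_on_cong[THEN iffD1, rotated -1]) (auto simp: app)
  qed
  have lin: "linear (?D x0)" using bl[OF assms(3)] by (simp add: bounded_linear.linear)
  obtain L where L: "linear L" "L \<circ> ?D x0 = id"
    using linear_injective_left_inverse[OF lin inj] by blast
  have "Blinfun L o\<^sub>L ?f' x0 = id_blinfun"
    by (rule blinfun_eqI)
      (use L app[OF assms(3)] in \<open>auto simp: bounded_linear_Blinfun_apply linear_conv_bounded_linear dest: fun_cong\<close>)
  note ift = inverse_function_theorem[of U f ?f' x0, OF assms(1) _ cont assms(3) this]
  obtain U' V g g' where *: "open U'" "U' \<subseteq> U" "x0 \<in> U'" "open V" "f x0 \<in> V" "homeomorphism U' V f g"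
    "\<And>y. y \<in> V \<Longrightarrow> (g has_derivative (g' y)) (at y)"
    "\<And>y. y \<in> V \<Longrightarrow> g' y = inv (blinfun_apply (?f' (g y)))"
    "\<And>y. y \<in> V \<Longrightarrow> bij (blinfun_apply (?f' (g y)))"
    by (rule ift) (use D app in auto)
  have "g y \<in> U" if "y \<in> V" for y
    using *(2,6) that by (auto simp: homeomorphism_def)
  then show ?thesis
    using *(7-9) app by (intro that[OF *(1-6)]) (metis, metis)
qed

text \<open>The inverse function theorem for \<open>\<Phi>(x, v) = (x, A x v)\<close> yields differentiability of the inverse;
  higher smoothness follows by differentiating \<open>A x (inv (A x) y) = y\<close>.\<close>

lemma C_inf_inverse_linear:
  fixes A :: "'x::euclidean_space \<Rightarrow> 'b::euclidean_space \<Rightarrow> 'b"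
  assumes W: "open W" and lin: "\<And>x. x \<in> W \<Longrightarrow> linear (A x)"
    and smooth: "\<And>b. b \<in> Basis \<Longrightarrow> C_inf (\<lambda>x. A x b) W" and x0: "x0 \<in> W" and inj: "inj (A x0)"
  obtains W' where "open W'" "x0 \<in> W'" "W' \<subseteq> W" "\<And>x. x \<in> W' \<Longrightarrow> bij (A x)"
    "\<And>v. C_inf (\<lambda>x. inv (A x) v) W'"
proof -
  define \<Phi> where "\<Phi> = (\<lambda>z. (fst z, A (fst z) (snd z)))"
  let ?U = "W \<times> (UNIV :: 'b set)"
  have oU: "open ?U" using W by (simp add: open_Times)
  have Af: "C_inf (\<lambda>z. A (fst z) (snd z)) ?U"
  proof (rule C_inf_linear_apply[OF oU, where A = "\<lambda>z. A (fst z)"])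
    show "C_inf (\<lambda>z. A (fst z) b) ?U" if "b \<in> Basis" for b
      by (rule C_inf_compose[OF oU W smooth[OF that] C_inf_fst[OF oU C_inf_id]]) auto
  qed (use lin oU in \<open>auto intro: C_inf_snd\<close>)
  have \<Phi>: "C_inf \<Phi> ?U" unfolding \<Phi>_def
    by (intro C_inf_Pair oU Af C_inf_fst C_inf_id)
  have D: "fst (frechet_derivative \<Phi> (at (x, v)) (u, w)) = u"
    "frechet_derivative \<Phi> (at (x, v)) (0, w) = (0, A x w)" if x: "x \<in> W" for x v u w
  proof -
    let ?D = "frechet_derivative \<Phi> (at (x, v))"
    have D: "(\<Phi> has_derivative ?D) (at (x, v))"
      using C_inf_has_derivative[OF \<Phi> oU] x by simp
    have "((\<lambda>z. fst (\<Phi> z)) has_derivative (\<lambda>z. fst (?D z))) (at (x, v))"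
      using has_derivative_fst[OF D] .
    moreover have "((\<lambda>z. fst (\<Phi> z)) has_derivative fst) (at (x, v))"
      by (simp add: \<Phi>_def bounded_linear_imp_has_derivative bounded_linear_fst)
    ultimately have "(\<lambda>z. fst (?D z)) = fst" using has_derivative_unique by blast
    then show "fst (?D (u, w)) = u" by (metis fst_conv)
    have "((\<lambda>w. (x, w)) has_derivative (\<lambda>w. (0, w))) (at v)"
      by (auto intro!: derivative_eq_intros)
    then have "((\<lambda>w. \<Phi> (x, w)) has_derivative (\<lambda>w. ?D (0, w))) (at v)"
      using has_derivative_compose[of "\<lambda>w. (x, w)" _ v UNIV \<Phi> ?D] D by simp
    moreover have "bounded_linear (A x)" using lin[OF x] by (simp add: linear_conv_bounded_linear)
    then have "((\<lambda>w. \<Phi> (x, w)) has_derivative (\<lambda>w. (0, A x w))) (at v)"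
      by (auto simp: \<Phi>_def intro!: derivative_eq_intros bounded_linear_imp_has_derivative)
    ultimately have "(\<lambda>w. ?D (0, w)) = (\<lambda>w. (0, A x w))" using has_derivative_unique by blast
    then show "?D (0, w) = (0, A x w)" by metis
  qed
  \<comment> \<open>The derivative is block triangular, with the identity and \<open>A x0\<close> on
    the diagonal.\<close>
  have "inj (frechet_derivative \<Phi> (at (x0, 0)))"
  proof -
    have "linear (frechet_derivative \<Phi> (at (x0, 0)))"
      using C_inf_has_derivative[OF \<Phi> oU] x0 has_derivative_linear by blast
    moreover have "z = 0" if "frechet_derivative \<Phi> (at (x0, 0)) z = 0" for z
    proof -
      have "fst z = 0" using D(1)[OF x0, of 0 "fst z" "snd z"] that by simp
      then have "A x0 (snd z) = 0" using D(2)[OF x0, of 0 "snd z"] that by (metis prod.collapse snd_conv snd_zero)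
      then have "snd z = 0" using inj lin[OF x0] by (metis injD linear_0)
      then show ?thesis using \<open>fst z = 0\<close> by (simp add: prod_eq_iff)
    qed
    ultimately show ?thesis by (simp add: linear_injective_0)
  qed
  moreover have "(x0, 0) \<in> ?U" using x0 by simp
  ultimately obtain U' V G where *: "open U'" "U' \<subseteq> ?U" "(x0, 0) \<in> U'" "open V" "\<Phi> (x0, 0) \<in> V"
    "homeomorphism U' V \<Phi> G"
    "\<And>y. y \<in> V \<Longrightarrow> bij (frechet_derivative \<Phi> (at (G y)))"
    "\<And>y. y \<in> V \<Longrightarrow> (G has_derivative inv (frechet_derivative \<Phi> (at (G y)))) (at y)"
    using C_inf_inverse_function_aux[OF oU \<Phi>] by metis
  have G: "fst (G (x, y)) = x" "A x (snd (G (x, y))) = y" "x \<in> W" if "(x, y) \<in> V" for x y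
  proof -
    have "G (x, y) \<in> U'" "\<Phi> (G (x, y)) = (x, y)"
      using *(6) that by (auto simp: homeomorphism_def)
    then show "fst (G (x, y)) = x" "A x (snd (G (x, y))) = y" "x \<in> W"
      using *(2) by (auto simp: \<Phi>_def)
  qed
  define W' where "W' = (\<lambda>x. (x, 0)) -` V"
  have W': "open W'" unfolding W'_def
    by (rule open_vimage[OF *(4)]) (intro continuous_intros)
  have sub: "W' \<subseteq> W" using G(3) by (auto simp: W'_def)
  have bij: "bij (A x)" if x: "x \<in> W'" for x
  proof -
    have V: "(x, 0) \<in> V" using x by (simp add: W'_def)
    obtain v where v: "G (x, 0) = (x, v)" using G(1)[OF V] by (metis prod.collapse)
    have "inj (frechet_derivative \<Phi> (at (x, v)))" using *(7)[OF V] v by (simp add: bij_is_inj)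
    then have "inj (A x)"
      using D(2)[OF G(3)[OF V], of v] by (auto simp: inj_def) (metis prod.inject)
    then show ?thesis
      using linear_injective_imp_surjective lin sub x by (metis bij_def subsetD)
  qed
  have inv: "A x (inv (A x) y) = y" "linear (inv (A x))" if "x \<in> W'" for x y
    using bij[OF that] lin[of x] sub that inj_linear_imp_inv_linear[of "A x"]
    by (auto simp: bij_is_surj surj_f_inv_f bij_is_inj)
  have GB: "snd (G (x, y)) = inv (A x) y" if "x \<in> W'" "(x, y) \<in> V" for x y
    using G[OF that(2)] bij[OF that(1)] by (metis bij_inv_eq_iff)
  \<comment> \<open>Over \<open>x\<close> the set \<open>V\<close> contains only a neighbourhood of
    0, so \<open>y\<close> itself may fall outside. A small positive multiple
    \<open>t *\<^sub>R y\<close> lies inside, and linearity of \<open>inv (A x)\<close> undoes the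
    scaling.\<close>
  have dB: "\<exists>d. ((\<lambda>x. inv (A x) y) has_derivative d) (at x)" if x: "x \<in> W'" for x y
  proof -
    have "((\<lambda>t. (x, t *\<^sub>R y)) \<longlongrightarrow> (x, 0 *\<^sub>R y)) (at_right (0::real))"
      by (intro tendsto_intros)
    then have "\<forall>\<^sub>F t in at_right (0::real). (x, t *\<^sub>R y) \<in> V"
      by (rule topological_tendstoD) (use *(4) x in \<open>auto simp: W'_def\<close>)
    moreover have "\<forall>\<^sub>F t in at_right (0::real). t > 0"
      by (simp add: eventually_at_right_less)
    ultimately have "\<exists>t>0. (x, t *\<^sub>R y) \<in> V"
      by (metis (mono_tags, lifting) eventually_conj eventually_happens' trivial_limit_at_right_real)
    then obtain t :: real where t: "t > 0" "(x, t *\<^sub>R y) \<in> V" by blast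
    have o: "open (W' \<inter> (\<lambda>x. (x, t *\<^sub>R y)) -` V)"
      by (intro open_Int W' open_vimage[OF *(4)] continuous_intros)
    have "\<exists>d. ((\<lambda>x'. (1 / t) *\<^sub>R snd (G (x', t *\<^sub>R y))) has_derivative d) (at x)"
    proof -
      have "((\<lambda>x'. (x', t *\<^sub>R y)) has_derivative (\<lambda>u. (u, 0))) (at x)"
        by (auto intro!: derivative_eq_intros)
      from has_derivative_compose[OF this *(8)[OF t(2)]]
      show ?thesis by (intro exI) (rule has_derivative_scaleR_right[OF has_derivative_snd])
    qed
    then obtain d where d: "((\<lambda>x'. (1 / t) *\<^sub>R snd (G (x', t *\<^sub>R y))) has_derivative d) (at x)" by blast
    have "((\<lambda>x. inv (A x) y) has_derivative d) (at x)"
      by (rule has_derivative_transform_within_open[OF d o])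
         (use x t GB inv(2) in \<open>auto simp: linear_scale\<close>)
    then show ?thesis by blast
  qed
  have formula: "((\<lambda>x. inv (A x) y) has_derivative (\<lambda>u. - inv (A x)
      (\<Sum>b\<in>Basis. (inv (A x) y \<bullet> b) *\<^sub>R frechet_derivative (\<lambda>x. A x b) (at x) u))) (at x)"
    if x: "x \<in> W'" for x y
  proof -
    obtain d where d: "((\<lambda>x. inv (A x) y) has_derivative d) (at x)" using dB[OF x] by blast
    have xW: "x \<in> W" using sub x by blast
    have "((\<lambda>x. \<Sum>b\<in>Basis. (inv (A x) y \<bullet> b) *\<^sub>R A x b) has_derivative
        (\<lambda>u. \<Sum>b\<in>Basis. (inv (A x) y \<bullet> b) *\<^sub>R frechet_derivative (\<lambda>x. A x b) (at x) u
                      + (d u \<bullet> b) *\<^sub>R A x b)) (at x)"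
      by (intro has_derivative_sum has_derivative_scaleR has_derivative_inner_left d
            C_inf_has_derivative[OF smooth W xW])
    then have 1: "((\<lambda>x. A x (inv (A x) y)) has_derivative
        (\<lambda>u. \<Sum>b\<in>Basis. (inv (A x) y \<bullet> b) *\<^sub>R frechet_derivative (\<lambda>x. A x b) (at x) u
                      + (d u \<bullet> b) *\<^sub>R A x b)) (at x)"
      by (rule has_derivative_transform_within_open[OF _ W xW])
         (rule linear_Basis_expansion[OF lin, symmetric])
    have 2: "((\<lambda>x. A x (inv (A x) y)) has_derivative (\<lambda>u. 0)) (at x)"
      by (rule has_derivative_transform_within_open[OF has_derivative_const W' x])
         (use inv in auto)
    have "d u = - inv (A x)
      (\<Sum>b\<in>Basis. (inv (A x) y \<bullet> b) *\<^sub>R frechet_derivative (\<lambda>x. A x b) (at x) u)" for u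
    proof -
      have "(\<Sum>b\<in>Basis. (inv (A x) y \<bullet> b) *\<^sub>R frechet_derivative (\<lambda>x. A x b) (at x) u) + A x (d u) = 0"
        using fun_cong[OF has_derivative_unique[OF 1 2], of u] linear_Basis_expansion[OF lin[OF xW], of "d u"]
        by (simp add: sum.distrib)
      then have "A x (d u) = - (\<Sum>b\<in>Basis. (inv (A x) y \<bullet> b) *\<^sub>R frechet_derivative (\<lambda>x. A x b) (at x) u)"
        by (simp add: eq_neg_iff_add_eq_0 add.commute)
      from arg_cong[OF this, of "inv (A x)"] show ?thesis
        using inv_f_f[OF bij_is_inj[OF bij[OF x]]] linear_neg[OF inv(2)[OF x]] by simp
    qed
    then show ?thesis using d by presburger
  qed
  have "C_k k (\<lambda>x. inv (A x) y) W'" for k y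
  proof (induction k arbitrary: y)
    case 0
    have "isCont (\<lambda>x. inv (A x) y) x" if "x \<in> W'" for x
      using dB[OF that] has_derivative_continuous by blast
    then show ?case by (simp add: continuous_at_imp_continuous_on)
  next
    case (Suc k)
    have s: "C_k k (\<lambda>x. frechet_derivative (\<lambda>x. A x b) (at x) u) W'" if "b \<in> Basis" for b u
      using C_k_subset[OF _ sub] C_inf_frechet_derivative[OF smooth[OF that] W] by (auto simp: C_inf_def)
    show ?case
    proof (rule C_k_Suc_derivativeI[OF W' formula])
      fix u
      have "C_k k (\<lambda>x. inv (A x)
        (\<Sum>b\<in>Basis. (inv (A x) y \<bullet> b) *\<^sub>R frechet_derivative (\<lambda>x. A x b) (at x) u)) W'"
        by (rule C_k_linear_apply[OF W', where A = "\<lambda>x. inv (A x)"])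
          (use inv(2) in \<open>auto intro!: C_k_sum W' C_k_bilinear[OF bounded_bilinear_scaleR] s Suc
            C_k_linear_compose[OF bounded_linear_inner_left]\<close>)
      then show "C_k k (\<lambda>x. - inv (A x)
        (\<Sum>b\<in>Basis. (inv (A x) y \<bullet> b) *\<^sub>R frechet_derivative (\<lambda>x. A x b) (at x) u)) W'"
        by (rule C_k_linear_compose[OF bounded_linear_minus[OF bounded_linear_ident] W'])
    qed
  qed
  then have "C_inf (\<lambda>x. inv (A x) v) W'" for v by (simp add: C_inf_def)
  moreover have "x0 \<in> W'"
    using *(5) lin[OF x0] by (simp add: W'_def \<Phi>_def linear_0)
  ultimately show ?thesis using that W' sub bij by blast
qed

text \<open>Bootstrapping: the derivative of \<open>g\<close> is the inverted derivative of
  \<open>f\<close>, a smooth family by \<open>C_inf_inverse_linear\<close>, composed with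
  \<open>g\<close>. If \<open>g\<close> is of class k, so is its derivative, and \<open>g\<close>
  gains one order.\<close>

theorem C_inf_inverse_function:
  fixes f :: "'a::euclidean_space \<Rightarrow> 'a"
  assumes U: "open U" and f: "C_inf f U" and "x0 \<in> U" and inj: "inj (frechet_derivative f (at x0))"
  obtains U' V g where "open U'" "U' \<subseteq> U" "x0 \<in> U'" "open V" "f x0 \<in> V" "homeomorphism U' V f g" "C_inf g V"
proof -
  obtain U' V g where *: "open U'" "U' \<subseteq> U" "x0 \<in> U'" "open V" "f x0 \<in> V" "homeomorphism U' V f g"
    "\<And>y. y \<in> V \<Longrightarrow> bij (frechet_derivative f (at (g y)))"
    "\<And>y. y \<in> V \<Longrightarrow> (g has_derivative inv (frechet_derivative f (at (g y)))) (at y)"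
    using C_inf_inverse_function_aux[OF assms] by metis
  have lin: "linear (frechet_derivative f (at x))" if "x \<in> U" for x
    using C_inf_has_derivative[OF f U that] has_derivative_linear by blast
  have "C_k k g V" for k
  proof (induction k)
    case 0
    show ?case using *(6) by (simp add: homeomorphism_def)
  next
    case (Suc k)
    show ?case
    proof (rule C_k_Suc_derivativeI[OF *(4) *(8)])
      fix v
      show "C_k k (\<lambda>y. inv (frechet_derivative f (at (g y))) v) V"
      proof (rule C_k_local)
        fix y assume y: "y \<in> V"
        have gy: "g y \<in> U" using *(2,6) y by (auto simp: homeomorphism_def)
        obtain W' where W': "open W'" "g y \<in> W'" "W' \<subseteq> U"
          "\<And>v. C_inf (\<lambda>x. inv (frechet_derivative f (at x)) v) W'"
          using C_inf_inverse_linear[OF U lin C_inf_frechet_derivative[OF f U] gy] *(7)[OF y]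
          by (metis bij_is_inj)
        let ?V = "V \<inter> g -` W'"
        have o: "open ?V"
          using *(6) *(4) W'(1) continuous_open_preimage by (auto simp: homeomorphism_def)
        have "C_k k (\<lambda>y. inv (frechet_derivative f (at (g y))) v) ?V"
          by (rule C_k_compose[OF o W'(1), where g = g and f = "\<lambda>x. inv (frechet_derivative f (at x)) v"])
             (use W'(4) C_k_subset[OF Suc] in \<open>auto simp: C_inf_def\<close>)
        then show "\<exists>W'. open W' \<and> y \<in> W' \<and> C_k k (\<lambda>y. inv (frechet_derivative f (at (g y))) v) W'"
          using o y W'(2) by blast
      qed
    qed
  qed
  then show ?thesis using that *(1-6) by (simp add: C_inf_def)
qed

section \<open>Charts, differentials and smooth maps\<close>

abbreviation cinv :: "('p, 'a) chart \<Rightarrow> 'a \<Rightarrow> 'p" where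
  "cinv c \<equiv> inv_into (fst c) (snd c)"

text \<open>
  The conditions of \<open>smooth_manifold\<close> without Hausdorff and countability, which are tedious to
  transfer to products and cotangent bundles and not of a local nature.
\<close>

definition smooth_atlas :: "('p, 'a::euclidean_space) atlas \<Rightarrow> bool" where
  "smooth_atlas A \<longleftrightarrow>
     (\<forall>c\<in>A. inj_on (snd c) (fst c)) \<and>
     (\<forall>c\<in>A. \<forall>c'\<in>A. open (snd c ` (fst c \<inter> fst c')) \<and>
        C_inf (snd c' \<circ> cinv c) (snd c ` (fst c \<inter> fst c')))"

lemma smooth_manifold_atlas: "smooth_manifold A \<Longrightarrow> smooth_atlas A"
  unfolding smooth_manifold_def smooth_atlas_def by (auto simp: split_beta)

lemma
  assumes "smooth_atlas A" "c \<in> A"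
  shows smooth_atlas_inj: "inj_on (snd c) (fst c)"
    and smooth_atlas_cinv [simp]: "x \<in> fst c \<Longrightarrow> cinv c (snd c x) = x"
    and smooth_atlas_open: "open (snd c ` fst c)"
  using assms by (auto simp: smooth_atlas_def) (metis Int_absorb)

lemma
  assumes "smooth_atlas A" "c \<in> A" "c' \<in> A"
  shows smooth_atlas_open_Int: "open (snd c ` (fst c \<inter> fst c'))"
    and smooth_atlas_transition: "C_inf (snd c' \<circ> cinv c) (snd c ` (fst c \<inter> fst c'))"
  using assms by (auto simp: smooth_atlas_def)

lemma smooth_atlas_image_IntD:
  assumes "smooth_atlas A" "c \<in> A" "x \<in> fst c" "snd c x \<in> snd c ` (fst c \<inter> T)"
  shows "x \<in> T"
  using inj_on_image_mem_iff[OF smooth_atlas_inj[OF assms(1,2)], of x "fst c \<inter> T"] assms(3,4) by auto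

lemma chart_at:
  assumes "x \<in> mcarrier A"
  shows "chart_at A x \<in> A" "x \<in> fst (chart_at A x)"
proof -
  have "\<exists>c. c \<in> A \<and> x \<in> fst c" using assms by (auto simp: mcarrier_def)
  from someI_ex[OF this] show "chart_at A x \<in> A" "x \<in> fst (chart_at A x)"
    by (auto simp: chart_at_def)
qed

lemma mcarrierI: "c \<in> A \<Longrightarrow> x \<in> fst c \<Longrightarrow> x \<in> mcarrier A"
  by (auto simp: mcarrier_def)

text \<open>\<open>mderiv\<close> is bound to the preferred charts and has a value even where no
  derivative exists. This relation works in arbitrary charts and asserts the derivative. It also
  requires that \<open>f\<close> stays in the target chart near \<open>x\<close>, since
  \<open>snd c'\<close> carries no information outside its domain; this makes the relation closed
  under composition.\<close>

definition has_diff ::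
    "('p, 'a::real_normed_vector) chart \<Rightarrow> ('r, 'b::real_normed_vector) chart \<Rightarrow> ('p \<Rightarrow> 'r) \<Rightarrow> 'p \<Rightarrow>
     ('a \<Rightarrow> 'b) \<Rightarrow> bool" where
  "has_diff c c' f x L \<longleftrightarrow> inj_on (snd c) (fst c) \<and> inj_on (snd c') (fst c') \<and> x \<in> fst c \<and>
     (\<forall>\<^sub>F \<xi> in nhds (snd c x). f (cinv c \<xi>) \<in> fst c') \<and>
     ((\<lambda>\<xi>. snd c' (f (cinv c \<xi>))) has_derivative L) (at (snd c x))"

lemma has_diff_domain: "has_diff c c' f x L \<Longrightarrow> x \<in> fst c" "has_diff c c' f x L \<Longrightarrow> f x \<in> fst c'"
  unfolding has_diff_def using eventually_nhds_x_imp_x by fastforce+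

lemma has_diff_linear: "has_diff c c' f x L \<Longrightarrow> linear L"
  unfolding has_diff_def using has_derivative_linear by blast

lemma has_diff_unique: "has_diff c c' f x L \<Longrightarrow> has_diff c c' f x L' \<Longrightarrow> L = L'"
  unfolding has_diff_def using has_derivative_unique by blast

lemma has_diff_compose:
  assumes f: "has_diff c c' f x L" and g: "has_diff c' c'' g (f x) L'"
  shows "has_diff c c'' (\<lambda>x. g (f x)) x (\<lambda>v. L' (L v))"
proof -
  let ?f = "\<lambda>\<xi>. snd c' (f (cinv c \<xi>))" and ?g = "\<lambda>\<xi>. snd c'' (g (cinv c' \<xi>))"
  have x: "cinv c (snd c x) = x" using f by (simp add: has_diff_def)
  have D: "(?f has_derivative L) (at (snd c x))" "(?g has_derivative L') (at (?f (snd c x)))"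
    using f g x by (auto simp: has_diff_def)
  have E: "\<forall>\<^sub>F \<xi> in nhds (snd c x). cinv c' (?f \<xi>) = f (cinv c \<xi>)"
    by (rule eventually_mono[of "\<lambda>\<xi>. f (cinv c \<xi>) \<in> fst c'"]) (use f in \<open>auto simp: has_diff_def\<close>)
  have "?f \<midarrow>snd c x\<rightarrow> ?f (snd c x)"
    using D(1) has_derivative_continuous isCont_def by blast
  then have "filterlim ?f (nhds (?f (snd c x))) (nhds (snd c x))"
    by (rule tendsto_at_iff_tendsto_nhds[THEN iffD1])
  then have "\<forall>\<^sub>F \<xi> in nhds (snd c x). g (cinv c' (?f \<xi>)) \<in> fst c''"
    by (rule eventually_compose_filterlim[rotated]) (use g x in \<open>simp add: has_diff_def\<close>)
  with E have "\<forall>\<^sub>F \<xi> in nhds (snd c x). g (f (cinv c \<xi>)) \<in> fst c''"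
    by eventually_elim simp
  moreover have "((\<lambda>\<xi>. snd c'' (g (f (cinv c \<xi>)))) has_derivative (\<lambda>v. L' (L v))) (at (snd c x))"
  proof (rule has_derivative_transform_eventually[OF has_derivative_compose[OF D]])
    show "\<forall>\<^sub>F \<xi> in at (snd c x). ?g (?f \<xi>) = snd c'' (g (f (cinv c \<xi>)))"
      unfolding eventually_at_filter by (rule eventually_mono[OF E]) simp
    show "?g (?f (snd c x)) = snd c'' (g (f (cinv c (snd c x))))"
      using eventually_nhds_x_imp_x[OF E] by simp
  qed simp
  ultimately show ?thesis using f g by (auto simp: has_diff_def)
qed

lemma has_diff_cong:
  assumes "has_diff c c' f x L" "\<forall>\<^sub>F \<xi> in nhds (snd c x). f (cinv c \<xi>) = g (cinv c \<xi>)"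
  shows "has_diff c c' g x L"
proof -
  have "\<forall>\<^sub>F \<xi> in nhds (snd c x). f (cinv c \<xi>) \<in> fst c'"
    using assms(1) by (simp add: has_diff_def)
  then have "\<forall>\<^sub>F \<xi> in nhds (snd c x). g (cinv c \<xi>) \<in> fst c'"
    using assms(2) by eventually_elim simp
  moreover have "((\<lambda>\<xi>. snd c' (g (cinv c \<xi>))) has_derivative L) (at (snd c x))"
  proof (rule has_derivative_transform_eventually)
    show "((\<lambda>\<xi>. snd c' (f (cinv c \<xi>))) has_derivative L) (at (snd c x))"
      using assms(1) by (simp add: has_diff_def)
    show "\<forall>\<^sub>F \<xi> in at (snd c x). snd c' (f (cinv c \<xi>)) = snd c' (g (cinv c \<xi>))"
      unfolding eventually_at_filter by (rule eventually_mono[OF assms(2)]) simp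
    show "snd c' (f (cinv c (snd c x))) = snd c' (g (cinv c (snd c x)))"
      using eventually_nhds_x_imp_x[OF assms(2)] by simp
  qed simp
  ultimately show ?thesis using assms(1) by (auto simp: has_diff_def)
qed

definition transition :: "('p, 'a::real_normed_vector) chart \<Rightarrow> ('p, 'a) chart \<Rightarrow> 'p \<Rightarrow> 'a \<Rightarrow> 'a" where
  "transition c c' x = frechet_derivative (snd c' \<circ> cinv c) (at (snd c x))"

lemma has_diff_transition:
  assumes "smooth_atlas A" "c \<in> A" "c' \<in> A" "x \<in> fst c" "x \<in> fst c'"
  shows "has_diff c c' (\<lambda>x. x) x (transition c c' x)"
proof -
  note o = smooth_atlas_open_Int[OF assms(1-3)]
  have x: "snd c x \<in> snd c ` (fst c \<inter> fst c')" using assms by blast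
  have "\<forall>\<^sub>F \<xi> in nhds (snd c x). cinv c \<xi> \<in> fst c'"
    using eventually_nhds_in_open[OF o x] by eventually_elim (use assms in auto)
  then show ?thesis
    using C_inf_has_derivative[OF smooth_atlas_transition[OF assms(1-3)] o x] assms
      smooth_atlas_inj[OF assms(1,2)] smooth_atlas_inj[OF assms(1,3)]
    by (simp add: has_diff_def transition_def comp_def)
qed

lemma has_diff_ident:
  assumes "smooth_atlas A" "c \<in> A" "x \<in> fst c"
  shows "has_diff c c (\<lambda>x. x) x (\<lambda>v. v)"
proof -
  have x: "snd c x \<in> snd c ` fst c" using assms by blast
  note o = smooth_atlas_open[OF assms(1,2)]
  have "((\<lambda>\<xi>. snd c (cinv c \<xi>)) has_derivative (\<lambda>v. v)) (at (snd c x))"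
    by (rule has_derivative_transform_within_open[OF has_derivative_ident o x])
       (simp add: f_inv_into_f)
  moreover have "\<forall>\<^sub>F \<xi> in nhds (snd c x). cinv c \<xi> \<in> fst c"
    using eventually_nhds_in_open[OF o x] by eventually_elim (simp add: inv_into_into)
  ultimately show ?thesis using assms smooth_atlas_inj[OF assms(1,2)] by (simp add: has_diff_def)
qed

lemma transition_self: 
  assumes "smooth_atlas A" "c \<in> A" "x \<in> fst c" shows "transition c c x = (\<lambda>v. v)"
  by (rule has_diff_unique[OF has_diff_transition[OF assms(1,2,2,3,3)] has_diff_ident[OF assms]])

lemma transition_compose:
  assumes "smooth_atlas A" "c \<in> A" "c' \<in> A" "c'' \<in> A" "x \<in> fst c" "x \<in> fst c'" "x \<in> fst c''"
  shows "transition c' c'' x (transition c c' x v) = transition c c'' x v"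
  by (rule fun_cong[OF has_diff_unique[OF has_diff_compose[OF
        has_diff_transition[OF assms(1,2,3,5,6)] has_diff_transition[OF assms(1,3,4,6,7)]]
        has_diff_transition[OF assms(1,2,4,5,7)]]])

text \<open>Tangent vectors are stored by their components in the preferred chart. Seen as a change
  of chart, \<open>coord_vector\<close> inherits its rules from the cocycle property of transition
  maps.\<close>

lemma coord_vector_transition: "coord_vector A c x = transition c (chart_at A x) x"
  by (auto simp: coord_vector_def transition_def split_beta)

lemma
  assumes "smooth_atlas A" "c \<in> A" "x \<in> fst c"
  shows has_diff_coord_vector: "has_diff c (chart_at A x) (\<lambda>x. x) x (coord_vector A c x)"
    and linear_coord_vector: "linear (coord_vector A c x)"
    and bij_coord_vector: "bij (coord_vector A c x)"
    and coord_vector_inverse: "coord_vector A c x (transition (chart_at A x) c x v) = v"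
      "transition (chart_at A x) c x (coord_vector A c x v) = v"
proof -
  note at = chart_at[OF mcarrierI[OF assms(2,3)]]
  show *: "has_diff c (chart_at A x) (\<lambda>x. x) x (coord_vector A c x)"
    using has_diff_transition[OF assms(1,2) at(1) assms(3) at(2)] by (simp add: coord_vector_transition)
  show "linear (coord_vector A c x)" using has_diff_linear[OF *] .
  show 1: "coord_vector A c x (transition (chart_at A x) c x v) = v" for v
    using transition_compose[of A "chart_at A x" c "chart_at A x" x v] transition_self[of A "chart_at A x" x]
      assms at by (simp add: coord_vector_transition)
  show 2: "transition (chart_at A x) c x (coord_vector A c x v) = v" for v
    using transition_compose[of A c "chart_at A x" c x v] transition_self[of A c x]
      assms at by (simp add: coord_vector_transition)
  show "bij (coord_vector A c x)"
    by (rule o_bij[of "transition (chart_at A x) c x"]) (simp_all add: fun_eq_iff 1 2)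
qed

lemma coord_vector_change:
  assumes "smooth_atlas A" "c \<in> A" "c' \<in> A" "x \<in> fst c" "x \<in> fst c'"
  shows "coord_vector A c' x (transition c c' x v) = coord_vector A c x v"
  using transition_compose[of A c c' "chart_at A x"] assms chart_at[OF mcarrierI[OF assms(2,4)]]
  by (simp add: coord_vector_transition)

lemma coord_vector_chart_at:
  assumes "smooth_atlas A" "x \<in> mcarrier A"
  shows "coord_vector A (chart_at A x) x = (\<lambda>v. v)"
  using transition_self[OF assms(1) chart_at[OF assms(2)]] by (simp add: coord_vector_transition)

text \<open>Frees \<open>mderiv\<close> from the preferred charts, which need not suit the map at
  hand: composing with chart changes on both sides computes it in any pair of charts.\<close>

lemma mderiv_eq:
  assumes A: "smooth_atlas A" and B: "smooth_atlas B" and c: "c \<in> A" and c': "c' \<in> B"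
    and f: "has_diff c c' f x L"
  shows "mderiv A B f x (coord_vector A c x v) = coord_vector B c' (f x) (L v)"
proof -
  note d = has_diff_domain[OF f]
  note at = chart_at[OF mcarrierI[OF c d(1)]] and at' = chart_at[OF mcarrierI[OF c' d(2)]]
  have "has_diff (chart_at A x) (chart_at B (f x)) f x
      (\<lambda>v. coord_vector B c' (f x) (L (transition (chart_at A x) c x v)))"
    using has_diff_compose[OF has_diff_compose[OF has_diff_transition[OF A at(1) c at(2) d(1)] f]
        has_diff_coord_vector[OF B c' d(2)]] by simp
  then have "((\<lambda>\<xi>. snd (chart_at B (f x)) (f (cinv (chart_at A x) \<xi>))) has_derivative
      (\<lambda>v. coord_vector B c' (f x) (L (transition (chart_at A x) c x v)))) (at (snd (chart_at A x) x))"
    by (simp add: has_diff_def)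
  from frechet_derivative_at[OF this, symmetric]
  have "mderiv A B f x = (\<lambda>v. coord_vector B c' (f x) (L (transition (chart_at A x) c x v)))"
    by (simp add: mderiv_def Let_def split_beta comp_def)
  then show ?thesis using coord_vector_inverse(2)[OF A c d(1)] by simp
qed

definition mdifferentiable ::
    "('p, 'a::euclidean_space) atlas \<Rightarrow> ('r, 'b::euclidean_space) atlas \<Rightarrow> ('p \<Rightarrow> 'r) \<Rightarrow> 'p \<Rightarrow> bool" where
  "mdifferentiable A B f x \<longleftrightarrow> (\<exists>c\<in>A. \<exists>c'\<in>B. \<exists>L. has_diff c c' f x L)"

lemma mdifferentiableI: "c \<in> A \<Longrightarrow> c' \<in> B \<Longrightarrow> has_diff c c' f x L \<Longrightarrow> mdifferentiable A B f x"
  by (auto simp: mdifferentiable_def)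

lemma mdifferentiable_carrier:
  "mdifferentiable A B f x \<Longrightarrow> x \<in> mcarrier A" "mdifferentiable A B f x \<Longrightarrow> f x \<in> mcarrier B"
  by (auto simp: mdifferentiable_def intro: mcarrierI dest: has_diff_domain)

lemma mdifferentiable_has_diff:
  assumes A: "smooth_atlas A" and B: "smooth_atlas B" and c: "c \<in> A" "x \<in> fst c"
    and c': "c' \<in> B" "f x \<in> fst c'" and "mdifferentiable A B f x"
  obtains L where "has_diff c c' f x L"
    "\<And>v. mderiv A B f x (coord_vector A c x v) = coord_vector B c' (f x) (L v)"
proof -
  obtain k k' L where k: "k \<in> A" "k' \<in> B" and f: "has_diff k k' f x L"
    using assms(7) by (auto simp: mdifferentiable_def)
  note d = has_diff_domain[OF f]
  have "has_diff c c' f x (\<lambda>v. transition k' c' (f x) (L (transition c k x v)))"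
    using has_diff_compose[OF has_diff_compose[OF has_diff_transition[OF A c(1) k(1) c(2) d(1)] f]
        has_diff_transition[OF B k(2) c'(1) d(2) c'(2)]] by simp
  then show ?thesis using that mderiv_eq[OF A B c(1) c'(1)] by blast
qed

lemma has_diff_mderiv:
  assumes A: "smooth_atlas A" and B: "smooth_atlas B" and f: "mdifferentiable A B f x"
  shows "has_diff (chart_at A x) (chart_at B (f x)) f x (mderiv A B f x)"
proof -
  note car = mdifferentiable_carrier[OF f]
  obtain L where L: "has_diff (chart_at A x) (chart_at B (f x)) f x L"
    "\<And>v. mderiv A B f x (coord_vector A (chart_at A x) x v) = coord_vector B (chart_at B (f x)) (f x) (L v)"
    using mdifferentiable_has_diff[OF A B chart_at[OF car(1)] chart_at[OF car(2)] f] by metis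
  then have "mderiv A B f x = L"
    using coord_vector_chart_at[OF A car(1)] coord_vector_chart_at[OF B car(2)] by auto
  with L(1) show ?thesis by simp
qed

lemma linear_mderiv:
  "smooth_atlas A \<Longrightarrow> smooth_atlas B \<Longrightarrow> mdifferentiable A B f x \<Longrightarrow> linear (mderiv A B f x)"
  by (rule has_diff_linear[OF has_diff_mderiv])

lemma
  assumes A: "smooth_atlas A" and B: "smooth_atlas B" and C: "smooth_atlas C"
    and f: "mdifferentiable A B f x" and g: "mdifferentiable B C g (f x)"
  shows mdifferentiable_compose: "mdifferentiable A C (\<lambda>x. g (f x)) x"
    and mderiv_compose: "mderiv A C (\<lambda>x. g (f x)) x v = mderiv B C g (f x) (mderiv A B f x v)"
proof -
  note fd = has_diff_mderiv[OF A B f] and gd = has_diff_mderiv[OF B C g]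
  note gf = has_diff_compose[OF fd gd]
  show *: "mdifferentiable A C (\<lambda>x. g (f x)) x"
    by (rule mdifferentiableI[OF chart_at(1)[OF mdifferentiable_carrier(1)[OF f]]
          chart_at(1)[OF mdifferentiable_carrier(2)[OF g]] gf])
  show "mderiv A C (\<lambda>x. g (f x)) x v = mderiv B C g (f x) (mderiv A B f x v)"
    by (rule fun_cong[OF has_diff_unique[OF has_diff_mderiv[OF A C *] gf]])
qed

lemma mderiv_cong:
  assumes A: "smooth_atlas A" and B: "smooth_atlas B"
    and "has_diff c c' f x L" "c \<in> A" "c' \<in> B" "\<forall>\<^sub>F \<xi> in nhds (snd c x). f (cinv c \<xi>) = g (cinv c \<xi>)"
  shows "mderiv A B g x = mderiv A B f x"
proof
  fix v
  have "f x = g x"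
    using eventually_nhds_x_imp_x[OF assms(6)] assms(3) by (simp add: has_diff_def)
  moreover have "\<exists>w. v = coord_vector A c x w"
    using coord_vector_inverse(1)[OF A assms(4) has_diff_domain(1)[OF assms(3)]] by metis
  ultimately show "mderiv A B g x v = mderiv A B f x v"
    using mderiv_eq[OF A B assms(4,5,3)] mderiv_eq[OF A B assms(4,5) has_diff_cong[OF assms(3,6)]] by force
qed

section \<open>Smooth maps through local extensions in charts\<close>

definition local_rep ::
    "('p, 'a::euclidean_space) atlas \<Rightarrow> ('r, 'b::euclidean_space) atlas \<Rightarrow> 'p set \<Rightarrow> ('p \<Rightarrow> 'r) \<Rightarrow>
     ('p, 'a) chart \<Rightarrow> ('r, 'b) chart \<Rightarrow> 'a set \<Rightarrow> ('a \<Rightarrow> 'b) \<Rightarrow> bool" where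
  "local_rep A B S f c c' W g \<longleftrightarrow> c \<in> A \<and> c' \<in> B \<and> open W \<and> W \<subseteq> snd c ` fst c \<and> C_inf g W \<and>
     (\<forall>y\<in>fst c \<inter> S. snd c y \<in> W \<longrightarrow> f y \<in> fst c' \<and> snd c' (f y) = g (snd c y))"

lemma local_repD:
  assumes "local_rep A B S f c c' W g"
  shows "c \<in> A" "c' \<in> B" "open W" "W \<subseteq> snd c ` fst c" "C_inf g W"
    "\<And>y. y \<in> fst c \<Longrightarrow> y \<in> S \<Longrightarrow> snd c y \<in> W \<Longrightarrow> f y \<in> fst c'"
    "\<And>y. y \<in> fst c \<Longrightarrow> y \<in> S \<Longrightarrow> snd c y \<in> W \<Longrightarrow> snd c' (f y) = g (snd c y)"
  using assms unfolding local_rep_def by blast+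

lemma smooth_map_on_iff_local_rep:
  "smooth_map_on A B S f \<longleftrightarrow>
     (\<forall>x\<in>S. \<exists>c c' W g. x \<in> fst c \<and> snd c x \<in> W \<and> local_rep A B S f c c' W g)"
  unfolding smooth_map_on_def split_beta local_rep_def by (intro ball_cong refl) blast

definition smooth_at ::
    "('p, 'a::euclidean_space) atlas \<Rightarrow> ('r, 'b::euclidean_space) atlas \<Rightarrow> 'p set \<Rightarrow> ('p \<Rightarrow> 'r) \<Rightarrow> 'p \<Rightarrow> bool" where
  "smooth_at A B S f x \<longleftrightarrow> (\<exists>c c' W g. x \<in> fst c \<and> snd c x \<in> W \<and> local_rep A B S f c c' W g)"

lemma smooth_atI:
  assumes A: "smooth_atlas A" and c: "c \<in> A" "x \<in> fst c" and c': "c' \<in> B"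
    and W: "open W" "snd c x \<in> W" "C_inf g W"
    and f: "\<And>y. y \<in> fst c \<Longrightarrow> y \<in> S \<Longrightarrow> snd c y \<in> W \<Longrightarrow> f y \<in> fst c' \<and> snd c' (f y) = g (snd c y)"
  shows "smooth_at A B S f x"
proof -
  let ?W = "W \<inter> snd c ` fst c"
  have "local_rep A B S f c c' ?W g" "snd c x \<in> ?W"
    using c c' W f smooth_atlas_open[OF A c(1)] C_inf_subset[OF W(3), of ?W] by (auto simp: local_rep_def)
  then show ?thesis using c(2) unfolding smooth_at_def by blast
qed

lemma smooth_map_onI: "(\<And>x. x \<in> S \<Longrightarrow> smooth_at A B S f x) \<Longrightarrow> smooth_map_on A B S f"
  unfolding smooth_map_on_iff_local_rep smooth_at_def by blast

lemma smooth_map_on_cong_subset: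
  assumes f: "smooth_map_on A B S f" and "S' \<subseteq> S" "\<And>x. x \<in> S' \<Longrightarrow> g x = f x"
  shows "smooth_map_on A B S' g"
  unfolding smooth_map_on_iff_local_rep
proof
  fix x assume x: "x \<in> S'"
  then obtain c c' W u where 1: "x \<in> fst c" "snd c x \<in> W" "local_rep A B S f c c' W u"
    using f assms(2) unfolding smooth_map_on_iff_local_rep by (meson subsetD)
  have "local_rep A B S' g c c' W u"
    using 1(3) assms(2,3) by (auto simp: local_rep_def)
  then show "\<exists>c c' W u. x \<in> fst c \<and> snd c x \<in> W \<and> local_rep A B S' g c c' W u"
    using 1 by blast
qed

lemma smooth_map_on_carrier:
  assumes "smooth_map_on A B S f" "x \<in> S"
  shows "x \<in> mcarrier A" "f x \<in> mcarrier B"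
proof -
  obtain c c' W u where 1: "x \<in> fst c" "snd c x \<in> W" "local_rep A B S f c c' W u"
    using assms unfolding smooth_map_on_iff_local_rep by meson
  show "x \<in> mcarrier A" "f x \<in> mcarrier B"
    using mcarrierI[OF local_repD(1)[OF 1(3)] 1(1)]
      mcarrierI[OF local_repD(2)[OF 1(3)] local_repD(6)[OF 1(3,1) assms(2) 1(2)]] .
qed

text \<open>Smoothness provides some pair of charts, while later arguments need a prescribed pair.
  The representative is conjugated by the transition maps, on the open set of points where both
  transitions apply: \<open>Y\<close> takes care of the source and \<open>Z\<close> of the
  target.\<close>

lemma smooth_map_on_charts:
  assumes A: "smooth_atlas A" and B: "smooth_atlas B" and f: "smooth_map_on A B S f" and x: "x \<in> S"
    and c: "c \<in> A" "x \<in> fst c" and c': "c' \<in> B" "f x \<in> fst c'"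
  obtains W g where "local_rep A B S f c c' W g" "snd c x \<in> W"
proof -
  obtain k k' X v where 1: "x \<in> fst k" "snd k x \<in> X" "local_rep A B S f k k' X v"
    using f x unfolding smooth_map_on_iff_local_rep by meson
  note 2 = local_repD[OF 1(3)]
  have fx: "f x \<in> fst k'" "snd k' (f x) = v (snd k x)" using 2(6,7) 1(1,2) x by auto
  let ?t = "snd k \<circ> cinv c" and ?O = "snd c ` (fst c \<inter> fst k)"
  let ?t' = "snd c' \<circ> cinv k'" and ?O' = "snd k' ` (fst k' \<inter> fst c')"
  note oO = smooth_atlas_open_Int[OF A c(1) 2(1)] and tO = smooth_atlas_transition[OF A c(1) 2(1)]
  note oO' = smooth_atlas_open_Int[OF B 2(2) c'(1)] and tO' = smooth_atlas_transition[OF B 2(2) c'(1)]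
  define Y where "Y = ?O \<inter> ?t -` X"
  have oY: "open Y" unfolding Y_def
    using continuous_open_preimage[OF C_inf_continuous_on[OF tO] oO 2(3)] .
  have "C_inf ?t Y" by (rule C_inf_subset[OF tO]) (simp add: Y_def)
  then have s: "C_inf (\<lambda>\<xi>. v (?t \<xi>)) Y"
    by (rule C_inf_compose[OF oY 2(3) 2(5)]) (auto simp: Y_def)
  define Z where "Z = Y \<inter> (\<lambda>\<xi>. v (?t \<xi>)) -` ?O'"
  have oZ: "open Z" unfolding Z_def
    using continuous_open_preimage[OF C_inf_continuous_on[OF s] oY oO'] .
  have "C_inf (\<lambda>\<xi>. v (?t \<xi>)) Z" by (rule C_inf_subset[OF s]) (simp add: Z_def)
  then have s': "C_inf (\<lambda>\<xi>. ?t' (v (?t \<xi>))) Z"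
    by (rule C_inf_compose[OF oZ oO' tO']) (auto simp: Z_def)
  have "v (snd k x) \<in> ?O'" unfolding fx(2)[symmetric] using fx(1) c'(2) by blast
  then have "snd c x \<in> Z"
    using c 1(1,2) by (simp add: Z_def Y_def smooth_atlas_cinv[OF A c(1)])
  moreover have "local_rep A B S f c c' Z (\<lambda>\<xi>. ?t' (v (?t \<xi>)))"
    unfolding local_rep_def
  proof (intro conjI ballI impI c(1) c'(1) oZ s')
    show "Z \<subseteq> snd c ` fst c" by (auto simp: Z_def Y_def)
    fix y assume y: "y \<in> fst c \<inter> S" "snd c y \<in> Z"
    then have "snd c y \<in> ?O" by (simp add: Z_def Y_def)
    then have k: "y \<in> fst k"
      using y(1) smooth_atlas_image_IntD[OF A c(1)] by blast
    have t: "?t (snd c y) = snd k y" using y(1) smooth_atlas_cinv[OF A c(1)] by simp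
    have X: "snd k y \<in> X" "v (snd k y) \<in> ?O'" using y(2) t by (auto simp: Z_def Y_def)
    have fy: "f y \<in> fst k'" "snd k' (f y) = v (snd k y)" using 2(6,7) k y(1) X(1) by auto
    then show "f y \<in> fst c'"
      using X(2) smooth_atlas_image_IntD[OF B 2(2) fy(1)] by simp
    show "snd c' (f y) = ?t' (v (?t (snd c y)))"
      unfolding t fy(2)[symmetric] using smooth_atlas_cinv[OF B 2(2) fy(1)] by simp
  qed
  ultimately show ?thesis using that by blast
qed

lemma smooth_map_on_compose:
  assumes A: "smooth_atlas A" and B: "smooth_atlas B" and C: "smooth_atlas C"
    and f: "smooth_map_on A B S f" and g: "smooth_map_on B C T g" and sub: "f ` S \<subseteq> T"
  shows "smooth_map_on A C S (\<lambda>x. g (f x))"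
proof (rule smooth_map_onI)
  fix x assume x: "x \<in> S"
  then have fx: "f x \<in> T" using sub by blast
  note c = chart_at[OF smooth_map_on_carrier(1)[OF f x]] and c' = chart_at[OF smooth_map_on_carrier(2)[OF f x]]
    and c'' = chart_at[OF smooth_map_on_carrier(2)[OF g fx]]
  let ?c = "chart_at A x" and ?c' = "chart_at B (f x)" and ?c'' = "chart_at C (g (f x))"
  obtain W u where 1: "local_rep A B S f ?c ?c' W u" "snd ?c x \<in> W"
    using smooth_map_on_charts[OF A B f x c c'] .
  obtain X v where 2: "local_rep B C T g ?c' ?c'' X v" "snd ?c' (f x) \<in> X"
    using smooth_map_on_charts[OF B C g fx c' c''] .
  note u = local_repD[OF 1(1)] and v = local_repD[OF 2(1)]
  define Z where "Z = W \<inter> u -` X"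
  have oZ: "open Z" unfolding Z_def
    using continuous_open_preimage[OF C_inf_continuous_on[OF u(5)] u(3) v(3)] .
  have "C_inf (\<lambda>\<xi>. v (u \<xi>)) Z"
    by (rule C_inf_compose[OF oZ v(3) v(5)]) (auto simp: Z_def intro: C_inf_subset[OF u(5)])
  moreover have "snd ?c x \<in> Z" using 1(2) 2(2) u(7)[OF c(2) x] by (simp add: Z_def)
  moreover have "g (f y) \<in> fst ?c'' \<and> snd ?c'' (g (f y)) = v (u (snd ?c y))"
    if "y \<in> fst ?c" "y \<in> S" "snd ?c y \<in> Z" for y
    using u(6,7)[of y] v(6,7)[of "f y"] that sub by (auto simp: Z_def)
  ultimately show "smooth_at A C S (\<lambda>x. g (f x)) x"
    by (intro smooth_atI[OF A c c''(1) oZ])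
qed

text \<open>The local extension agrees with \<open>f\<close> on \<open>S\<close> only. Its
  derivative is one of \<open>f\<close> itself as soon as \<open>S\<close> contains a whole
  neighbourhood of \<open>x\<close>, which is what \<open>interior\<close> says in charts.\<close>

lemma smooth_map_on_mdifferentiable:
  assumes A: "smooth_atlas A" and B: "smooth_atlas B" and f: "smooth_map_on A B S f" and x: "x \<in> S"
    and interior: "\<And>c. c \<in> A \<Longrightarrow> x \<in> fst c \<Longrightarrow> \<forall>\<^sub>F \<xi> in nhds (snd c x). cinv c \<xi> \<in> S"
  shows "mdifferentiable A B f x"
proof -
  obtain c c' W g where 1: "x \<in> fst c" "snd c x \<in> W" "local_rep A B S f c c' W g"
    using f x unfolding smooth_map_on_iff_local_rep by meson
  note 2 = local_repD[OF 1(3)]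
  have ev: "\<forall>\<^sub>F \<xi> in nhds (snd c x). f (cinv c \<xi>) \<in> fst c' \<and> g \<xi> = snd c' (f (cinv c \<xi>))"
    using eventually_nhds_in_open[OF 2(3) 1(2)] interior[OF 2(1) 1(1)]
  proof eventually_elim
    case (elim \<xi>)
    have "cinv c \<xi> \<in> fst c" "snd c (cinv c \<xi>) = \<xi>"
      using elim(1) 2(4) by (auto simp: inv_into_into f_inv_into_f subset_iff)
    then show ?case using 2(6,7)[of "cinv c \<xi>"] elim by simp
  qed
  have "((\<lambda>\<xi>. snd c' (f (cinv c \<xi>))) has_derivative frechet_derivative g (at (snd c x))) (at (snd c x))"
  proof (rule has_derivative_transform_eventually[OF C_inf_has_derivative[OF 2(5,3) 1(2)]])
    show "\<forall>\<^sub>F \<xi> in at (snd c x). g \<xi> = snd c' (f (cinv c \<xi>))"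
      unfolding eventually_at_filter by (rule eventually_mono[OF ev]) simp
    show "g (snd c x) = snd c' (f (cinv c (snd c x)))"
      using eventually_nhds_x_imp_x[OF ev] by simp
  qed simp
  moreover have "\<forall>\<^sub>F \<xi> in nhds (snd c x). f (cinv c \<xi>) \<in> fst c'"
    using ev by (rule eventually_mono) simp
  ultimately show ?thesis
    using 1(1) smooth_atlas_inj[OF A 2(1)] smooth_atlas_inj[OF B 2(2)]
    by (intro mdifferentiableI[OF 2(1,2)]) (simp add: has_diff_def)
qed

lemma smooth_map_on_carrier_mdifferentiable:
  assumes A: "smooth_atlas A" and B: "smooth_atlas B" and f: "smooth_map_on A B (mcarrier A) f"
    and x: "x \<in> mcarrier A"
  shows "mdifferentiable A B f x"
proof (rule smooth_map_on_mdifferentiable[OF A B f x])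
  fix c assume c: "c \<in> A" "x \<in> fst c"
  then have "snd c x \<in> snd c ` fst c" by blast
  from eventually_nhds_in_open[OF smooth_atlas_open[OF A c(1)] this]
  show "\<forall>\<^sub>F \<xi> in nhds (snd c x). cinv c \<xi> \<in> mcarrier A"
    by eventually_elim (rule mcarrierI[OF c(1) inv_into_into])
qed

section \<open>Euclidean spaces as manifolds, and smooth functions in charts\<close>

lemma smooth_atlas_euc: "smooth_atlas euc"
  by (auto simp: smooth_atlas_def euc_def comp_def inv_into_def)

lemma mcarrier_euc [simp]: "mcarrier euc = UNIV"
  by (auto simp: mcarrier_def euc_def)

lemma chart_at_euc [simp]: "chart_at euc x = (UNIV, \<lambda>x. x)"
  using chart_at(1)[of x euc] by (simp add: euc_def mcarrier_def)

lemma inv_into_ident [simp]: "inv_into UNIV (\<lambda>x. x) = (\<lambda>x. x)"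
  by (simp add: inv_into_def)

lemma coord_vector_euc [simp]: "coord_vector euc (UNIV, \<lambda>x. x) x v = v"
  using coord_vector_chart_at[OF smooth_atlas_euc, of x] by simp

lemma euc_chart: "(UNIV, \<lambda>x. x) \<in> euc"
  by (simp add: euc_def)

lemma smooth_map_on_euc:
  assumes "C_inf g UNIV"
  shows "smooth_map_on euc euc X g"
proof (rule smooth_map_onI)
  show "smooth_at euc euc X g x" for x
    by (rule smooth_atI[OF smooth_atlas_euc euc_chart _ euc_chart open_UNIV _ assms]) simp_all
qed

lemma smooth_function_chart:
  assumes A: "smooth_atlas A" and f: "smooth_map_on A euc (mcarrier A) f" and c: "c \<in> A"
  shows "C_inf (\<lambda>\<xi>. f (cinv c \<xi>)) (snd c ` fst c)"
proof (rule C_inf_local)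
  fix \<xi> assume "\<xi> \<in> snd c ` fst c"
  then obtain x where x: "x \<in> fst c" "\<xi> = snd c x" by blast
  obtain W g where W: "local_rep A euc (mcarrier A) f c (UNIV, \<lambda>x. x) W g" "snd c x \<in> W"
    by (rule smooth_map_on_charts[OF A smooth_atlas_euc f mcarrierI[OF c x(1)] c x(1) euc_chart]) auto
  note g = local_repD[OF W(1)]
  have "f (cinv c \<zeta>) = g \<zeta>" if "\<zeta> \<in> W" for \<zeta>
    using g(7)[of "cinv c \<zeta>"] g(4) that mcarrierI[OF c] by (auto simp: smooth_atlas_cinv[OF A c])
  from C_inf_cong[OF g(3) this g(5)]
  show "\<exists>W'. open W' \<and> \<xi> \<in> W' \<and> C_inf (\<lambda>\<xi>. f (cinv c \<xi>)) W'" using g(3) W(2) x(2) by blast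
qed

lemma diff_fun_chart:
  assumes A: "smooth_atlas A" and f: "smooth_map_on A euc (mcarrier A) f" and c: "c \<in> A" "x \<in> fst c"
  shows "diff_fun A f x (coord_vector A c x v) = frechet_derivative (\<lambda>\<xi>. f (cinv c \<xi>)) (at (snd c x)) v"
proof -
  have "has_diff c (UNIV, \<lambda>x. x) f x (frechet_derivative (\<lambda>\<xi>. f (cinv c \<xi>)) (at (snd c x)))"
    using C_inf_has_derivative[OF smooth_function_chart[OF A f c(1)] smooth_atlas_open[OF A c(1)]] c
      smooth_atlas_inj[OF A c(1)]
    by (simp add: has_diff_def)
  from mderiv_eq[OF A smooth_atlas_euc c(1) _ this] show ?thesis
    by (simp add: diff_fun_def euc_def[symmetric]) (simp add: euc_def)
qed

section \<open>Curves and tangent vectors\<close>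

lemma has_diff_curve_iff:
  "has_diff (UNIV, \<lambda>x. x) c \<gamma> t L \<longleftrightarrow> inj_on (snd c) (fst c) \<and> (\<forall>\<^sub>F s in nhds t. \<gamma> s \<in> fst c) \<and>
     ((\<lambda>s. snd c (\<gamma> s)) has_derivative L) (at t)"
  by (simp add: has_diff_def)

lemma mderiv_curve:
  assumes A: "smooth_atlas A" and c: "c \<in> A" and ev: "\<forall>\<^sub>F s in nhds t. \<gamma> s \<in> fst c"
    and d: "((\<lambda>s. snd c (\<gamma> s)) has_vector_derivative w) (at (t::real))"
  shows "mdifferentiable euc A \<gamma> t" "mderiv euc A \<gamma> t 1 = coord_vector A c (\<gamma> t) w"
proof -
  have 1: "has_diff (UNIV, \<lambda>x. x) c \<gamma> t (\<lambda>s. s *\<^sub>R w)"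
    using ev d smooth_atlas_inj[OF A c] by (simp add: has_diff_curve_iff has_vector_derivative_def)
  show "mdifferentiable euc A \<gamma> t" by (rule mdifferentiableI[OF euc_chart c 1])
  show "mderiv euc A \<gamma> t 1 = coord_vector A c (\<gamma> t) w"
    using mderiv_eq[OF smooth_atlas_euc A euc_chart c 1, of 1] by simp
qed

lemma mdifferentiable_curve:
  assumes A: "smooth_atlas A" and c: "c \<in> A" "\<gamma> t \<in> fst c" and \<gamma>: "mdifferentiable euc A \<gamma> t"
  obtains w where "\<forall>\<^sub>F s in nhds t. \<gamma> s \<in> fst c"
    "((\<lambda>s. snd c (\<gamma> s)) has_vector_derivative w) (at t)"
    "mderiv euc A \<gamma> t 1 = coord_vector A c (\<gamma> t) w"
proof -
  obtain L where L: "has_diff (UNIV, \<lambda>x. x) c \<gamma> t L"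
    by (rule mdifferentiable_has_diff[OF smooth_atlas_euc A euc_chart _ c \<gamma>]) auto
  have ev: "\<forall>\<^sub>F s in nhds t. \<gamma> s \<in> fst c" using L by (simp add: has_diff_curve_iff)
  have "(\<lambda>s. s *\<^sub>R L 1) = L"
    using linear_scale[OF has_diff_linear[OF L], of _ 1, symmetric] by (intro ext) simp
  then have d: "((\<lambda>s. snd c (\<gamma> s)) has_vector_derivative L 1) (at t)"
    unfolding has_vector_derivative_def using L by (simp add: has_diff_curve_iff)
  show ?thesis by (rule that[OF ev d mderiv_curve(2)[OF A c(1) ev d]])
qed

lemma mderiv_curve_cong:
  assumes A: "smooth_atlas A" and \<gamma>: "mdifferentiable euc A \<gamma> t" and ev: "\<forall>\<^sub>F s in nhds t. \<gamma> s = \<delta> s"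
  shows "mdifferentiable euc A \<delta> t" "mderiv euc A \<delta> t = mderiv euc A \<gamma> t"
proof -
  obtain k c L where c: "c \<in> A" and "k \<in> euc" "has_diff k c \<gamma> t L"
    using \<gamma> by (auto simp: mdifferentiable_def)
  then have L: "has_diff (UNIV, \<lambda>x. x) c \<gamma> t L" by (simp add: euc_def)
  show "mdifferentiable euc A \<delta> t"
    by (rule mdifferentiableI[OF euc_chart c has_diff_cong[OF L]]) (simp add: ev)
  show "mderiv euc A \<delta> t = mderiv euc A \<gamma> t"
    by (rule mderiv_cong[OF smooth_atlas_euc A L euc_chart c]) (simp add: ev)
qed

lemma curve_throughD:
  assumes A: "smooth_atlas A" and "curve_through A S x v \<gamma>"
  shows "mdifferentiable euc A \<gamma> 0" "\<gamma> 0 = x" "mderiv euc A \<gamma> 0 1 = v" "\<forall>\<^sub>F t in nhds 0. \<gamma> t \<in> S" "x \<in> S"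
proof -
  obtain e where e: "e > 0" "smooth_map_on euc A {-e<..<e} \<gamma>" "\<gamma> ` {-e<..<e} \<subseteq> S"
    using assms(2) by (auto simp: curve_through_def)
  show x: "\<gamma> 0 = x" "mderiv euc A \<gamma> 0 1 = v" using assms(2) by (auto simp: curve_through_def)
  have ev: "\<forall>\<^sub>F t in nhds 0. t \<in> {-e<..<e}" using e(1) by (intro eventually_nhds_in_open) auto
  show "mdifferentiable euc A \<gamma> 0"
    by (rule smooth_map_on_mdifferentiable[OF smooth_atlas_euc A e(2)]) (use e(1) ev in \<open>auto simp: euc_def\<close>)
  show *: "\<forall>\<^sub>F t in nhds 0. \<gamma> t \<in> S" using ev by eventually_elim (use e(3) in blast)
  show "x \<in> S" using eventually_nhds_x_imp_x[OF *] x by simp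
qed

text \<open>Away from \<open>S\<close> the extension \<open>g\<close> is arbitrary. Along a curve
  that stays in \<open>S\<close> it does describe \<open>f\<close>, so its derivative in the
  direction of the curve has an intrinsic meaning.\<close>

lemma local_rep_curve:
  assumes A: "smooth_atlas A" and B: "smooth_atlas B" and f: "local_rep A B S f c c' W g"
    and \<gamma>: "mdifferentiable euc A \<gamma> (t::real)" "\<forall>\<^sub>F s in nhds t. \<gamma> s \<in> S"
    and x: "\<gamma> t \<in> fst c" "snd c (\<gamma> t) \<in> W"
    and w: "mderiv euc A \<gamma> t 1 = coord_vector A c (\<gamma> t) w"
  shows "mdifferentiable euc B (\<lambda>s. f (\<gamma> s)) t"
    and "mderiv euc B (\<lambda>s. f (\<gamma> s)) t 1 = coord_vector B c' (f (\<gamma> t)) (frechet_derivative g (at (snd c (\<gamma> t))) w)"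
proof -
  note 1 = local_repD[OF f]
  obtain w' where w': "\<forall>\<^sub>F s in nhds t. \<gamma> s \<in> fst c"
    "((\<lambda>s. snd c (\<gamma> s)) has_vector_derivative w') (at t)"
    "mderiv euc A \<gamma> t 1 = coord_vector A c (\<gamma> t) w'"
    using mdifferentiable_curve[OF A 1(1) x(1) \<gamma>(1)] .
  have "w' = w" using w w'(3) bij_coord_vector[OF A 1(1) x(1)] by (metis bij_pointE)
  note d = w'(2)[unfolded this]
  have "(\<lambda>s. snd c (\<gamma> s)) \<midarrow>t\<rightarrow> snd c (\<gamma> t)"
    using has_vector_derivative_continuous[OF d] isCont_def by blast
  then have "((\<lambda>s. snd c (\<gamma> s)) \<longlongrightarrow> snd c (\<gamma> t)) (nhds t)"
    by (rule tendsto_at_iff_tendsto_nhds[THEN iffD1])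
  then have "\<forall>\<^sub>F s in nhds t. snd c (\<gamma> s) \<in> W"
    using topological_tendstoD[OF _ 1(3) x(2)] by blast
  then have ev: "\<forall>\<^sub>F s in nhds t. f (\<gamma> s) \<in> fst c' \<and> g (snd c (\<gamma> s)) = snd c' (f (\<gamma> s))"
    using w'(1) \<gamma>(2) by eventually_elim (use 1(6,7) in simp)
  then have ev': "\<forall>\<^sub>F s in nhds t. f (\<gamma> s) \<in> fst c'" by (rule eventually_mono) simp
  have "((\<lambda>s. g (snd c (\<gamma> s))) has_derivative (\<lambda>s. frechet_derivative g (at (snd c (\<gamma> t))) (s *\<^sub>R w))) (at t)"
    using has_derivative_compose[OF d[unfolded has_vector_derivative_def] C_inf_has_derivative[OF 1(5,3) x(2)]] .
  then have "((\<lambda>s. snd c' (f (\<gamma> s))) has_derivative (\<lambda>s. frechet_derivative g (at (snd c (\<gamma> t))) (s *\<^sub>R w))) (at t)"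
  proof (rule has_derivative_transform_eventually)
    show "\<forall>\<^sub>F s in at t. g (snd c (\<gamma> s)) = snd c' (f (\<gamma> s))"
      unfolding eventually_at_filter by (rule eventually_mono[OF ev]) simp
    show "g (snd c (\<gamma> t)) = snd c' (f (\<gamma> t))" using eventually_nhds_x_imp_x[OF ev] by simp
  qed simp
  then have "((\<lambda>s. snd c' (f (\<gamma> s))) has_vector_derivative frechet_derivative g (at (snd c (\<gamma> t))) w) (at t)"
    using linear_scale[OF has_derivative_linear[OF C_inf_has_derivative[OF 1(5,3) x(2)]]]
    by (simp add: has_vector_derivative_def)
  from mderiv_curve[OF B 1(2) ev' this]
  show "mdifferentiable euc B (\<lambda>s. f (\<gamma> s)) t"
    "mderiv euc B (\<lambda>s. f (\<gamma> s)) t 1 = coord_vector B c' (f (\<gamma> t)) (frechet_derivative g (at (snd c (\<gamma> t))) w)" .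
qed

text \<open>This is why the definite description in \<open>mderiv_on\<close> denotes something:
  whatever curve in \<open>S\<close> realises the tangent vector, the derivative along it is that of
  the same extension \<open>g\<close> in the same direction.\<close>

lemma mderiv_on_local_rep:
  assumes A: "smooth_atlas A" and B: "smooth_atlas B" and f: "local_rep A B S f c c' W g"
    and x: "x \<in> fst c" "snd c x \<in> W" and w: "coord_vector A c x w \<in> tangent_space A S x"
  shows "mderiv_on A B S f x (coord_vector A c x w) =
    coord_vector B c' (f x) (frechet_derivative g (at (snd c x)) w)"
  unfolding mderiv_on_def
proof (rule the_equality)
  have *: "mderiv euc B (f \<circ> \<gamma>) 0 1 = coord_vector B c' (f x) (frechet_derivative g (at (snd c x)) w)"
    if \<gamma>: "curve_through A S x (coord_vector A c x w) \<gamma>" for \<gamma>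
    using local_rep_curve(2)[OF A B f curve_throughD(1,4)[OF A \<gamma>], of w] curve_throughD(2,3)[OF A \<gamma>] x
    by (simp add: comp_def)
  then show "\<exists>\<gamma>. curve_through A S x (coord_vector A c x w) \<gamma> \<and>
      mderiv euc B (f \<circ> \<gamma>) 0 1 = coord_vector B c' (f x) (frechet_derivative g (at (snd c x)) w)"
    using w by (auto simp: tangent_space_def)
  fix u assume "\<exists>\<gamma>. curve_through A S x (coord_vector A c x w) \<gamma> \<and> mderiv euc B (f \<circ> \<gamma>) 0 1 = u"
  then show "u = coord_vector B c' (f x) (frechet_derivative g (at (snd c x)) w)" using * by blast
qed

lemma mderiv_on_curve:
  assumes A: "smooth_atlas A" and B: "smooth_atlas B" and f: "smooth_map_on A B S f"
    and \<gamma>: "curve_through A S x v \<gamma>"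
  shows "mderiv_on A B S f x v = mderiv euc B (\<lambda>t. f (\<gamma> t)) 0 1" "mdifferentiable euc B (\<lambda>t. f (\<gamma> t)) 0"
proof -
  note \<gamma>D = curve_throughD[OF A \<gamma>]
  obtain c c' W g where 1: "x \<in> fst c" "snd c x \<in> W" "local_rep A B S f c c' W g"
    using f \<gamma>D(5) unfolding smooth_map_on_iff_local_rep by meson
  obtain w where w: "v = coord_vector A c x w"
    using coord_vector_inverse(1)[OF A local_repD(1)[OF 1(3)] 1(1)] by metis
  have "v \<in> tangent_space A S x" using \<gamma> by (auto simp: tangent_space_def)
  then show "mderiv_on A B S f x v = mderiv euc B (\<lambda>t. f (\<gamma> t)) 0 1"
    using mderiv_on_local_rep[OF A B 1(3,1,2), of w] local_rep_curve(2)[OF A B 1(3) \<gamma>D(1,4), of w]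
      \<gamma>D(2,3) 1 w by simp
  show "mdifferentiable euc B (\<lambda>t. f (\<gamma> t)) 0"
    using local_rep_curve(1)[OF A B 1(3) \<gamma>D(1,4), of w] \<gamma>D(2,3) 1 w by simp
qed

lemma curve_throughI:
  assumes A: "smooth_atlas A" and c: "c \<in> A" and "e > 0" "C_inf \<kappa> {-e<..<e}"
    and \<gamma>: "\<And>t. \<bar>t\<bar> < e \<Longrightarrow> \<gamma> t \<in> fst c \<inter> S \<and> snd c (\<gamma> t) = \<kappa> t"
    and d: "(\<kappa> has_vector_derivative w) (at 0)"
  shows "curve_through A S (\<gamma> 0) (coord_vector A c (\<gamma> 0) w) \<gamma>"
proof -
  have e: "\<bar>t\<bar> < e \<longleftrightarrow> t \<in> {-e<..<e}" for t by auto
  have "smooth_map_on euc A {-e<..<e} \<gamma>"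
  proof (rule smooth_map_onI)
    fix t assume t: "t \<in> {-e<..<e}"
    show "smooth_at euc A {-e<..<e} \<gamma> t"
      by (rule smooth_atI[OF smooth_atlas_euc euc_chart _ c _ _ assms(4)]) (use t \<gamma> e in auto)
  qed
  moreover have "\<gamma> ` {-e<..<e} \<subseteq> S" using \<gamma> e by auto
  moreover have "mderiv euc A \<gamma> 0 1 = coord_vector A c (\<gamma> 0) w"
  proof (rule mderiv_curve(2)[OF A c])
    have o: "open {-e<..<e}" "0 \<in> {-e<..<e}" using \<open>e > 0\<close> by auto
    show "\<forall>\<^sub>F s in nhds 0. \<gamma> s \<in> fst c"
      using eventually_nhds_in_open[OF o] by eventually_elim (use \<gamma> e in auto)
    show "((\<lambda>s. snd c (\<gamma> s)) has_vector_derivative w) (at 0)"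
      by (rule has_vector_derivative_transform_within_open[OF d o]) (use \<gamma> e in auto)
  qed
  ultimately show ?thesis using \<open>e > 0\<close> by (auto simp: curve_through_def)
qed

section \<open>Cotangent bundles and products\<close>

definition comps :: "('p, 'a::euclidean_space) atlas \<Rightarrow> ('p, 'a) chart \<Rightarrow> 'p \<Rightarrow> ('a \<Rightarrow>\<^sub>L real) \<Rightarrow> 'a" where
  "comps A c x p = (\<Sum>b\<in>Basis. blinfun_apply p (coord_vector A c x b) *\<^sub>R b)"

text \<open>Built as the inverse of \<open>comps A c x\<close>. A covector acts on components in the
  preferred chart, so these are first converted to components in \<open>c\<close>.\<close>

definition covec :: "('p, 'a::euclidean_space) atlas \<Rightarrow> ('p, 'a) chart \<Rightarrow> 'p \<Rightarrow> 'a \<Rightarrow> ('a \<Rightarrow>\<^sub>L real)" where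
  "covec A c x \<pi> = Blinfun (\<lambda>v. \<pi> \<bullet> transition (chart_at A x) c x v)"

lemma cot_chart_simps [simp]:
  "fst (cot_chart A c) = fst c \<times> UNIV" "snd (cot_chart A c) z = (snd c (fst z), comps A c (fst z) (snd z))"
  by (auto simp: cot_chart_def comps_def split_beta)

lemma inner_sum_Basis_linear:
  fixes L :: "'a::euclidean_space \<Rightarrow> real"
  assumes "linear L"
  shows "(\<Sum>b\<in>Basis. L b *\<^sub>R b) \<bullet> v = L v"
  using linear_Basis_expansion[OF assms, of v]
  by (simp add: inner_sum_left mult.commute inner_commute[of v])

lemma comps_inner:
  assumes "smooth_atlas A" "c \<in> A" "x \<in> fst c"
  shows "comps A c x p \<bullet> v = blinfun_apply p (coord_vector A c x v)"
  unfolding comps_def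
  by (rule inner_sum_Basis_linear)
     (use linear_compose[OF linear_coord_vector[OF assms] bounded_linear.linear[OF blinfun.bounded_linear_right]]
      in \<open>simp add: comp_def\<close>)

lemma covec_apply:
  assumes "smooth_atlas A" "c \<in> A" "x \<in> fst c"
  shows "blinfun_apply (covec A c x \<pi>) v = \<pi> \<bullet> transition (chart_at A x) c x v"
proof -
  have "linear (transition (chart_at A x) c x)"
    using chart_at[OF mcarrierI[OF assms(2,3)]]
    by (intro has_diff_linear[OF has_diff_transition[OF assms(1) _ assms(2) _ assms(3)]])
  then have "bounded_linear (\<lambda>v. \<pi> \<bullet> transition (chart_at A x) c x v)"
    using bounded_linear_compose[OF bounded_linear_inner_right] linear_conv_bounded_linear by blast
  then show ?thesis by (simp add: covec_def bounded_linear_Blinfun_apply)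
qed

lemma
  assumes "smooth_atlas A" "c \<in> A" "x \<in> fst c"
  shows covec_comps: "covec A c x (comps A c x p) = p"
    and comps_covec: "comps A c x (covec A c x \<pi>) = \<pi>"
proof -
  show "covec A c x (comps A c x p) = p"
    by (rule blinfun_eqI)
       (simp add: covec_apply[OF assms] comps_inner[OF assms] coord_vector_inverse[OF assms])
  show "comps A c x (covec A c x \<pi>) = \<pi>"
  proof (rule vector_eq_rdot[THEN iffD1], rule allI)
    show "comps A c x (covec A c x \<pi>) \<bullet> v = \<pi> \<bullet> v" for v
      by (simp add: covec_apply[OF assms] comps_inner[OF assms] coord_vector_inverse[OF assms])
  qed
qed

lemma linear_comps: "linear (comps A c x)"
  by (rule linearI) (simp_all add: comps_def blinfun.add_left blinfun.scaleR_left scaleR_left_distrib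
      sum.distrib scaleR_sum_right)

lemma inj_cot_chart:
  assumes "smooth_atlas A" "c \<in> A"
  shows "inj_on (snd (cot_chart A c)) (fst (cot_chart A c))"
proof (rule inj_onI)
  fix z z' :: "'a \<times> ('b \<Rightarrow>\<^sub>L real)"
  assume *: "z \<in> fst (cot_chart A c)" "z' \<in> fst (cot_chart A c)" "snd (cot_chart A c) z = snd (cot_chart A c) z'"
  then have x: "fst z = fst z'"
    using inj_onD[OF smooth_atlas_inj[OF assms], of "fst z" "fst z'"] by auto
  then show "z = z'"
    using * covec_comps[OF assms, of "fst z"] by (auto simp: prod_eq_iff) metis
qed

lemma cinv_cot_chart:
  assumes "smooth_atlas A" "c \<in> A" "x \<in> fst c"
  shows "cinv (cot_chart A c) (snd c x, \<pi>) = (x, covec A c x \<pi>)"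
  by (rule inv_into_f_eq[OF inj_cot_chart[OF assms(1,2)]]) (simp_all add: assms comps_covec[OF assms])

lemma smooth_atlas_cotangent:
  assumes A: "smooth_atlas A"
  shows "smooth_atlas (cotangent A)"
  unfolding smooth_atlas_def cotangent_def
proof (intro conjI ballI; elim imageE; (elim imageE)?; hypsubst)
  show "inj_on (snd (cot_chart A c)) (fst (cot_chart A c))" if "c \<in> A" for c
    by (rule inj_cot_chart[OF A that])
  fix c c' assume c: "c \<in> A" and c': "c' \<in> A"
  let ?O = "snd c ` (fst c \<inter> fst c')" and ?O' = "snd c' ` (fst c' \<inter> fst c)"
  have im: "snd (cot_chart A c) ` (fst (cot_chart A c) \<inter> fst (cot_chart A c')) = ?O \<times> UNIV" (is "?L = _")
  proof
    show "?L \<subseteq> ?O \<times> UNIV" by auto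
    show "?O \<times> UNIV \<subseteq> ?L"
    proof
      fix z assume "z \<in> ?O \<times> (UNIV :: 'b set)"
      then obtain x \<pi> where "z = (snd c x, \<pi>)" "x \<in> fst c" "x \<in> fst c'"
        by (auto elim!: SigmaE imageE simp del: image_Int)
      then show "z \<in> ?L"
        using comps_covec[OF A c] by (intro image_eqI[of _ _ "(x, covec A c x \<pi>)"]) auto
    qed
  qed
  have o: "open ?O" and o': "open ?O'" using smooth_atlas_open_Int[OF A] c c' by auto
  show oU: "open (snd (cot_chart A c) ` (fst (cot_chart A c) \<inter> fst (cot_chart A c')))"
    unfolding im using o by (simp add: open_Times)
  let ?U = "?O \<times> (UNIV :: 'b set)"
  have oU: "open ?U" using o by (simp add: open_Times)
  let ?t = "snd c' \<circ> cinv c" and ?t' = "snd c \<circ> cinv c'"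
  have t: "C_inf (\<lambda>z. ?t (fst z)) ?U"
    by (rule C_inf_compose[OF oU o smooth_atlas_transition[OF A c c'] C_inf_fst[OF oU C_inf_id]]) auto
  \<comment> \<open>Momenta change by the transpose of the derivative of the inverse transition
    \<open>?t'\<close>, taken at the new base coordinates.\<close>
  have "C_inf (\<lambda>z. (?t (fst z), \<Sum>b\<in>Basis. (snd z \<bullet> frechet_derivative ?t' (at (?t (fst z))) b) *\<^sub>R b)) ?U"
    by (intro C_inf_Pair C_inf_sum C_inf_scaleR C_inf_inner oU C_inf_snd C_inf_id C_inf_const t
        C_inf_frechet_apply[OF oU o' smooth_atlas_transition[OF A c' c]])
       (use smooth_atlas_cinv[OF A c] in auto)
  then show "C_inf (snd (cot_chart A c') \<circ> cinv (cot_chart A c))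
      (snd (cot_chart A c) ` (fst (cot_chart A c) \<inter> fst (cot_chart A c')))"
    unfolding im
  proof (rule C_inf_cong[OF oU, rotated])
    fix z assume "z \<in> ?U"
    then obtain x \<pi> where z: "z = (snd c x, \<pi>)" "x \<in> fst c" "x \<in> fst c'"
      by (auto elim!: SigmaE imageE)
    have "transition (chart_at A x) c x (coord_vector A c' x b) = transition c' c x b" for b
      using coord_vector_change[OF A c' c z(3,2), of b] coord_vector_inverse(2)[OF A c z(2)] by metis
    then show "(snd (cot_chart A c') \<circ> cinv (cot_chart A c)) z =
        (?t (fst z), \<Sum>b\<in>Basis. (snd z \<bullet> frechet_derivative ?t' (at (?t (fst z))) b) *\<^sub>R b)"
      unfolding comp_apply z(1) cinv_cot_chart[OF A c z(2)]
      using z by (simp add: comps_def covec_apply[OF A c] smooth_atlas_cinv[OF A c] transition_def comp_def)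
  qed
qed

lemma mcarrier_cotangent: "mcarrier (cotangent A) = mcarrier A \<times> UNIV"
  by (auto simp: mcarrier_def cotangent_def)

lemma chart_at_cotangent:
  assumes "z \<in> mcarrier (cotangent A)"
  obtains c where "c \<in> A" "fst z \<in> fst c" "chart_at (cotangent A) z = cot_chart A c"
  using chart_at[OF assms] by (auto simp: cotangent_def)

lemma smooth_map_on_fst_cotangent:
  assumes A: "smooth_atlas A"
  shows "smooth_map_on (cotangent A) A (mcarrier (cotangent A)) fst"
proof (rule smooth_map_onI)
  fix z assume z: "z \<in> mcarrier (cotangent A)"
  obtain c where c: "c \<in> A" "fst z \<in> fst c" using z by (auto simp: mcarrier_def cotangent_def)
  have k: "cot_chart A c \<in> cotangent A" using c by (simp add: cotangent_def)
  show "smooth_at (cotangent A) A (mcarrier (cotangent A)) fst z"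
    by (rule smooth_atI[OF smooth_atlas_cotangent[OF A] k _ c(1) open_UNIV _ C_inf_bounded_linear[OF bounded_linear_fst]])
       (use c(2) in \<open>auto simp: mem_Times_iff\<close>)
qed

lemma mderiv_fst_cotangent:
  assumes A: "smooth_atlas A" and c: "c \<in> A" "fst z \<in> fst c"
  shows "mderiv (cotangent A) A fst z (coord_vector (cotangent A) (cot_chart A c) z v) =
    coord_vector A c (fst z) (fst v)"
proof (rule mderiv_eq[OF smooth_atlas_cotangent[OF A] A _ c(1)])
  let ?k = "cot_chart A c"
  have k: "?k \<in> cotangent A" using c by (simp add: cotangent_def)
  then show "?k \<in> cotangent A" .
  have z: "snd ?k z \<in> snd ?k ` fst ?k" using c(2) by (intro imageI) (simp add: mem_Times_iff)
  note o = smooth_atlas_open[OF smooth_atlas_cotangent[OF A] k]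
  have *: "fst (cinv ?k \<xi>) \<in> fst c \<and> snd c (fst (cinv ?k \<xi>)) = fst \<xi>" if m: "\<xi> \<in> snd ?k ` fst ?k" for \<xi>
  proof -
    obtain x p where "x \<in> fst c" "\<xi> = (snd c x, comps A c x p)" using m by auto
    then show ?thesis using cinv_cot_chart[OF A c(1), of x] by simp
  qed
  have "\<forall>\<^sub>F \<xi> in nhds (snd ?k z). fst (cinv ?k \<xi>) \<in> fst c"
    using eventually_nhds_in_open[OF o z] by eventually_elim (use * in blast)
  moreover have "((\<lambda>\<xi>. snd c (fst (cinv ?k \<xi>))) has_derivative fst) (at (snd ?k z))"
    by (rule has_derivative_transform_within_open[OF bounded_linear_imp_has_derivative[OF bounded_linear_fst] o z])
       (simp add: conjunct2[OF *] del: cot_chart_simps)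
  moreover have "z \<in> fst ?k" using c(2) by (simp add: mem_Times_iff)
  ultimately show "has_diff ?k c fst z fst"
    using smooth_atlas_inj[OF A c(1)] inj_cot_chart[OF A c(1)] unfolding has_diff_def by blast
qed

section \<open>Product manifolds\<close>

definition prod_chart :: "('p, 'a) chart \<Rightarrow> ('r, 'b) chart \<Rightarrow> ('p \<times> 'r, 'a \<times> 'b) chart" where
  "prod_chart c d = (fst c \<times> fst d, map_prod (snd c) (snd d))"

lemma prod_chart_simps [simp]:
  "fst (prod_chart c d) = fst c \<times> fst d" "snd (prod_chart c d) z = (snd c (fst z), snd d (snd z))"
  by (auto simp: prod_chart_def map_prod_def split_beta)

lemma prod_atlas_eq: "A \<times>\<^sub>M B = (\<lambda>(c, d). prod_chart c d) ` (A \<times> B)"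
  unfolding prod_atlas_def prod_chart_def by force

lemma prod_chart_in: "c \<in> A \<Longrightarrow> d \<in> B \<Longrightarrow> prod_chart c d \<in> A \<times>\<^sub>M B"
  by (auto simp: prod_atlas_eq)

lemma prod_chartE:
  assumes "k \<in> A \<times>\<^sub>M B"
  obtains c d where "c \<in> A" "d \<in> B" "k = prod_chart c d"
  using assms by (auto simp: prod_atlas_eq)

lemma mcarrier_prod: "mcarrier (A \<times>\<^sub>M B) = mcarrier A \<times> mcarrier B"
  by (auto simp: mcarrier_def prod_atlas_eq)

lemma inj_prod_chart:
  "inj_on (snd c) (fst c) \<Longrightarrow> inj_on (snd d) (fst d) \<Longrightarrow> inj_on (snd (prod_chart c d)) (fst (prod_chart c d))"
  by (auto simp: inj_on_def)

lemma cinv_prod_chart: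
  assumes "inj_on (snd c) (fst c)" "inj_on (snd d) (fst d)" "x \<in> fst c" "y \<in> fst d"
  shows "cinv (prod_chart c d) (snd c x, snd d y) = (x, y)"
  by (rule inv_into_f_eq[OF inj_prod_chart]) (use assms in auto)

lemma smooth_atlas_prod:
  assumes A: "smooth_atlas A" and B: "smooth_atlas B"
  shows "smooth_atlas (A \<times>\<^sub>M B)"
  unfolding smooth_atlas_def
proof (intro conjI ballI)
  show "inj_on (snd k) (fst k)" if k: "k \<in> A \<times>\<^sub>M B" for k
    by (rule prod_chartE[OF k]) (use inj_prod_chart smooth_atlas_inj[OF A] smooth_atlas_inj[OF B] in blast)
  fix k k' assume "k \<in> A \<times>\<^sub>M B" and "k' \<in> A \<times>\<^sub>M B"
  then obtain c d c' d' where k: "c \<in> A" "d \<in> B" "k = prod_chart c d" and k': "c' \<in> A" "d' \<in> B" "k' = prod_chart c' d'"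
    by (elim prod_chartE) blast
  let ?X = "snd c ` (fst c \<inter> fst c')" and ?Y = "snd d ` (fst d \<inter> fst d')"
  have "snd k ` (fst k \<inter> fst k') = map_prod (snd c) (snd d) ` ((fst c \<inter> fst c') \<times> (fst d \<inter> fst d'))"
    by (simp add: k k' prod_chart_def Times_Int_Times)
  then have im: "snd k ` (fst k \<inter> fst k') = ?X \<times> ?Y" by (simp add: map_prod_surj_on)
  have oX: "open ?X" and oY: "open ?Y"
    using smooth_atlas_open_Int[OF A k(1) k'(1)] smooth_atlas_open_Int[OF B k(2) k'(2)] .
  then have o: "open (?X \<times> ?Y)" by (rule open_Times)
  then show "open (snd k ` (fst k \<inter> fst k'))" by (simp add: im)
  have "C_inf (\<lambda>z. ((snd c' \<circ> cinv c) (fst z), (snd d' \<circ> cinv d) (snd z))) (?X \<times> ?Y)"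
    by (intro C_inf_Pair o C_inf_compose[OF o oX smooth_atlas_transition[OF A k(1) k'(1)]]
          C_inf_compose[OF o oY smooth_atlas_transition[OF B k(2) k'(2)]] C_inf_fst C_inf_snd C_inf_id) auto
  then show "C_inf (snd k' \<circ> cinv k) (snd k ` (fst k \<inter> fst k'))"
    unfolding im
  proof (rule C_inf_cong[OF o, rotated])
    fix z assume "z \<in> ?X \<times> ?Y"
    then obtain x y where z: "z = (snd c x, snd d y)" "x \<in> fst c" "y \<in> fst d"
      by (auto elim!: SigmaE imageE)
    have i: "cinv k z = (x, y)"
      unfolding z(1) k(3) by (rule cinv_prod_chart[OF smooth_atlas_inj[OF A k(1)] smooth_atlas_inj[OF B k(2)] z(2,3)])
    show "(snd k' \<circ> cinv k) z = ((snd c' \<circ> cinv c) (fst z), (snd d' \<circ> cinv d) (snd z))"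
      unfolding comp_apply i
      by (simp add: z k' smooth_atlas_cinv[OF A k(1) z(2)] smooth_atlas_cinv[OF B k(2) z(3)])
  qed
qed

lemma smooth_map_on_fst_snd:
  assumes A: "smooth_atlas A" and B: "smooth_atlas B"
  shows "smooth_map_on (A \<times>\<^sub>M B) A (mcarrier (A \<times>\<^sub>M B)) fst"
    and "smooth_map_on (A \<times>\<^sub>M B) B (mcarrier (A \<times>\<^sub>M B)) snd"
proof -
  note P = smooth_atlas_prod[OF A B]
  {
    fix z assume "z \<in> mcarrier (A \<times>\<^sub>M B)"
    then have c: "chart_at A (fst z) \<in> A" "fst z \<in> fst (chart_at A (fst z))"
      and d: "chart_at B (snd z) \<in> B" "snd z \<in> fst (chart_at B (snd z))"
      using chart_at[of "fst z" A] chart_at[of "snd z" B] by (simp_all add: mcarrier_prod mem_Times_iff)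
    note k = prod_chart_in[OF c(1) d(1)]
    have 1: "smooth_at (A \<times>\<^sub>M B) A (mcarrier (A \<times>\<^sub>M B)) fst z"
      by (rule smooth_atI[OF P k _ c(1) open_UNIV _ C_inf_bounded_linear[OF bounded_linear_fst]])
         (use c d in \<open>auto simp: mem_Times_iff\<close>)
    have 2: "smooth_at (A \<times>\<^sub>M B) B (mcarrier (A \<times>\<^sub>M B)) snd z"
      by (rule smooth_atI[OF P k _ d(1) open_UNIV _ C_inf_bounded_linear[OF bounded_linear_snd]])
         (use c d in \<open>auto simp: mem_Times_iff\<close>)
    note 1 2
  }
  then show "smooth_map_on (A \<times>\<^sub>M B) A (mcarrier (A \<times>\<^sub>M B)) fst"
    "smooth_map_on (A \<times>\<^sub>M B) B (mcarrier (A \<times>\<^sub>M B)) snd"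
    by (blast intro: smooth_map_onI)+
qed

lemma smooth_map_on_Pair:
  assumes A: "smooth_atlas A" and B: "smooth_atlas B" and C: "smooth_atlas C"
    and f: "smooth_map_on A B S f" and g: "smooth_map_on A C S g"
  shows "smooth_map_on A (B \<times>\<^sub>M C) S (\<lambda>x. (f x, g x))"
proof (rule smooth_map_onI)
  fix x assume x: "x \<in> S"
  note c = chart_at[OF smooth_map_on_carrier(1)[OF f x]] and c' = chart_at[OF smooth_map_on_carrier(2)[OF f x]]
    and c'' = chart_at[OF smooth_map_on_carrier(2)[OF g x]]
  let ?c = "chart_at A x" and ?c' = "chart_at B (f x)" and ?c'' = "chart_at C (g x)"
  obtain W u where 1: "local_rep A B S f ?c ?c' W u" "snd ?c x \<in> W"
    using smooth_map_on_charts[OF A B f x c c'] .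
  obtain X v where 2: "local_rep A C S g ?c ?c'' X v" "snd ?c x \<in> X"
    using smooth_map_on_charts[OF A C g x c c''] .
  note u = local_repD[OF 1(1)] and v = local_repD[OF 2(1)]
  let ?Z = "W \<inter> X"
  have oZ: "open ?Z" using u(3) v(3) by blast
  have s: "C_inf (\<lambda>\<xi>. (u \<xi>, v \<xi>)) ?Z"
    by (intro C_inf_Pair oZ C_inf_subset[OF u(5)] C_inf_subset[OF v(5)]) auto
  show "smooth_at A (B \<times>\<^sub>M C) S (\<lambda>x. (f x, g x)) x"
    by (rule smooth_atI[OF A c prod_chart_in[OF c'(1) c''(1)] oZ _ s]) (use 1(2) 2(2) u(6,7) v(6,7) in auto)
qed

section \<open>The extended reset equation\<close>

text \<open>The preferred chart at \<open>z\<close> is the natural chart of some base chart, which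
  may differ from the preferred chart at \<open>fst z\<close>. The pairing of momentum and base
  velocity is the same in both, and this coordinate-free form is the one that composes with
  curves.\<close>

lemma liouville_form_eq:
  assumes A: "smooth_atlas A" and z: "z \<in> mcarrier (cotangent A)"
  shows "liouville_form A z v = blinfun_apply (snd z) (mderiv (cotangent A) A fst z v)"
proof -
  obtain c where c: "c \<in> A" "fst z \<in> fst c" "chart_at (cotangent A) z = cot_chart A c"
    using chart_at_cotangent[OF z] .
  have "coord_vector (cotangent A) (cot_chart A c) z v = v"
    using coord_vector_chart_at[OF smooth_atlas_cotangent[OF A] z] c(3) by simp
  then show ?thesis
    using mderiv_fst_cotangent[OF A c(1,2), of v] comps_inner[OF A c(1,2)]
    by (simp add: liouville_form_def c(3))
qed

lemma theta_form_curve: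
  assumes A: "smooth_atlas A" and \<Gamma>: "mdifferentiable euc (euc \<times>\<^sub>M cotangent A) \<Gamma> t"
  shows "theta_form A H (\<Gamma> t) (mderiv euc (euc \<times>\<^sub>M cotangent A) \<Gamma> t 1) =
    blinfun_apply (snd (snd (\<Gamma> t))) (mderiv euc A (\<lambda>s. fst (snd (\<Gamma> s))) t 1)
    - H (snd (\<Gamma> t)) * mderiv euc euc (\<lambda>s. fst (\<Gamma> s)) t (1::real)"
proof -
  let ?N = "cotangent A" and ?P = "euc \<times>\<^sub>M cotangent A"
  note E = smooth_atlas_euc and N = smooth_atlas_cotangent[OF A]
  note P = smooth_atlas_prod[OF E N]
  note pr = smooth_map_on_fst_snd[OF E N]
  have car: "\<Gamma> t \<in> mcarrier ?P" using mdifferentiable_carrier(2)[OF \<Gamma>] .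
  then have z: "snd (\<Gamma> t) \<in> mcarrier ?N" by (simp add: mcarrier_prod mem_Times_iff)
  have f: "mdifferentiable ?P euc fst (\<Gamma> t)" and s: "mdifferentiable ?P ?N snd (\<Gamma> t)"
    using smooth_map_on_carrier_mdifferentiable[OF P E pr(1) car]
      smooth_map_on_carrier_mdifferentiable[OF P N pr(2) car] .
  have q: "mdifferentiable ?N A fst (snd (\<Gamma> t))"
    using smooth_map_on_carrier_mdifferentiable[OF N A smooth_map_on_fst_cotangent[OF A] z] .
  show ?thesis
    unfolding theta_form_def pullback_def liouville_form_eq[OF A z] diff_fun_def
      mderiv_compose[OF E P N \<Gamma> s, symmetric] mderiv_compose[OF E P E \<Gamma> f, symmetric]
      mderiv_compose[OF E N A mdifferentiable_compose[OF E P N \<Gamma> s] q, symmetric] ..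
qed

lemma curve_through_compose:
  assumes A: "smooth_atlas A" and B: "smooth_atlas B" and f: "smooth_map_on A B S f" and sub: "f ` S \<subseteq> T"
    and \<gamma>: "curve_through A S x v \<gamma>"
  shows "curve_through B T (f x) (mderiv euc B (\<lambda>t. f (\<gamma> t)) 0 1) (\<lambda>t. f (\<gamma> t))"
proof -
  obtain e where e: "e > 0" "smooth_map_on euc A {-e<..<e} \<gamma>" "\<gamma> ` {-e<..<e} \<subseteq> S" "\<gamma> 0 = x"
    using \<gamma> by (auto simp: curve_through_def)
  have "smooth_map_on euc B {-e<..<e} (\<lambda>t. f (\<gamma> t))"
    by (rule smooth_map_on_compose[OF smooth_atlas_euc A B e(2) f e(3)])
  then show ?thesis using e sub by (auto simp: curve_through_def)
qed

lemma smooth_map_on_const_euc: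
  assumes "a \<in> mcarrier A"
  shows "smooth_map_on (euc :: (real, real) atlas) A X (\<lambda>t. a)"
proof (rule smooth_map_onI)
  fix t :: real
  obtain c where c: "c \<in> A" "a \<in> fst c" using assms by (auto simp: mcarrier_def)
  show "smooth_at euc A X (\<lambda>t. a) t"
    by (rule smooth_atI[OF smooth_atlas_euc euc_chart _ c(1) open_UNIV _ C_inf_const[of "snd c a"]]) (use c in auto)
qed

lemma mderiv_const_curve:
  assumes A: "smooth_atlas A" and a: "a \<in> mcarrier A"
  shows "mderiv euc A (\<lambda>t::real. a) t 1 = 0"
proof -
  note c = chart_at[OF a]
  have "mderiv euc A (\<lambda>t::real. a) t 1 = coord_vector A (chart_at A a) a 0"
    by (rule mderiv_curve(2)[OF A c(1)]) (simp_all add: c(2))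
  then show ?thesis using linear_0[OF linear_coord_vector[OF A c]] by simp
qed

text \<open>The common source of the kernel conditions on velocities: it serves curves in the impact
  location, curves in the guard, and their images under the reset.\<close>

lemma curve_tangent:
  assumes A: "smooth_atlas A" and f: "smooth_map_on A euc (mcarrier A) f" and x: "x \<in> mcarrier A"
    and \<gamma>: "mdifferentiable euc A \<gamma> (0::real)" "\<gamma> 0 = x" and zero: "\<forall>\<^sub>F t in nhds 0. f (\<gamma> t) = (0::real)"
  shows "diff_fun A f x (mderiv euc A \<gamma> 0 1) = 0"
proof -
  note E = smooth_atlas_euc
  have f': "mdifferentiable A euc f (\<gamma> 0)"
    using smooth_map_on_carrier_mdifferentiable[OF A E f x] \<gamma>(2) by simp
  have "diff_fun A f x (mderiv euc A \<gamma> 0 1) = mderiv euc euc (\<lambda>t. f (\<gamma> t)) 0 1"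
    using mderiv_compose[OF E A E \<gamma>(1) f'] \<gamma>(2) by (simp add: diff_fun_def)
  also have "mderiv euc euc (\<lambda>t. f (\<gamma> t)) 0 = mderiv euc euc (\<lambda>t::real. 0::real) 0"
    by (rule mderiv_curve_cong(2)[OF E mdifferentiable_compose[OF E A E \<gamma>(1) f'] zero, symmetric])
  finally show ?thesis by (simp add: mderiv_const_curve[OF E])
qed

lemma mderiv_ident_curve: "mderiv euc euc (\<lambda>t::real. t) t 1 = 1"
  using mderiv_curve(2)[OF smooth_atlas_euc euc_chart, of "\<lambda>t. t" t 1] by simp

text \<open>Lifts a map into the base to the cotangent bundle by keeping the momentum components
  constant in one chart.\<close>

lemma smooth_map_on_covec:
  assumes A: "smooth_atlas A" and M: "smooth_atlas M" and f: "smooth_map_on A M S f"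
    and c: "c \<in> M" "\<And>x. x \<in> S \<Longrightarrow> f x \<in> fst c"
  shows "smooth_map_on A (cotangent M) S (\<lambda>x. (f x, covec M c (f x) \<pi>))"
proof (rule smooth_map_onI)
  fix x assume x: "x \<in> S"
  note k = chart_at[OF smooth_map_on_carrier(1)[OF f x]]
  obtain W g where 1: "local_rep A M S f (chart_at A x) c W g" "snd (chart_at A x) x \<in> W"
    using smooth_map_on_charts[OF A M f x k c(1) c(2)[OF x]] .
  note g = local_repD[OF 1(1)]
  have k': "cot_chart M c \<in> cotangent M" using c(1) by (simp add: cotangent_def)
  show "smooth_at A (cotangent M) S (\<lambda>x. (f x, covec M c (f x) \<pi>)) x"
    by (rule smooth_atI[OF A k k' g(3) 1(2) C_inf_Pair[OF g(3,5) C_inf_const[of \<pi>]]])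
       (use c g(7) comps_covec[OF M c(1)] in auto)
qed

text \<open>Both pulled-back forms see only the velocity in time and the velocity of the base point;
  the velocity of the momentum does not enter. Two kinds of test curves therefore separate energy
  conservation from the condition on covectors, and together these two conditions are also
  sufficient.\<close>

lemma extended_reset_iff:
  fixes M :: "('p, 'a::euclidean_space) atlas"
  assumes M: "smooth_atlas M" and \<Delta>: "smooth_map_on M M \<Sigma> \<Delta>"
    and D: "smooth_map_on (cotangent M) (cotangent M) (\<Sigma> \<times> UNIV) D"
    and cover: "\<And>x p. x \<in> \<Sigma> \<Longrightarrow> fst (D (x, p)) = \<Delta> x"
  shows "solves_extended_reset M \<Delta> H (\<Sigma> \<times> UNIV) D \<longleftrightarrow>
    (\<forall>x\<in>\<Sigma>. \<forall>p. H (D (x, p)) = H (x, p) \<and>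
       (\<forall>u\<in>tangent_space M \<Sigma> x. blinfun_apply (snd (D (x, p))) (mderiv_on M M \<Sigma> \<Delta> x u) = blinfun_apply p u))"
proof -
  let ?N = "cotangent M" and ?P = "(euc :: (real, real) atlas) \<times>\<^sub>M cotangent M"
    and ?S = "\<Sigma> \<times> (UNIV :: ('a \<Rightarrow>\<^sub>L real) set)"
  let ?T = "(UNIV :: real set) \<times> ?S"
  note E = smooth_atlas_euc[where ?'a = real] and N = smooth_atlas_cotangent[OF M]
  note P = smooth_atlas_prod[OF E N]
  have Scar: "?S \<subseteq> mcarrier ?N" using smooth_map_on_carrier(1)[OF D] by blast
  then have Tcar: "?T \<subseteq> mcarrier ?P" by (auto simp: mcarrier_prod)
  note pr1 = smooth_map_on_cong_subset[OF smooth_map_on_fst_snd(1)[OF E N] Tcar refl]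
    and pr2 = smooth_map_on_cong_subset[OF smooth_map_on_fst_snd(2)[OF E N] Tcar refl]
  have q: "smooth_map_on ?N M ?S fst"
    by (rule smooth_map_on_cong_subset[OF smooth_map_on_fst_cotangent[OF M] Scar]) simp
  have "smooth_map_on ?P ?P ?T (\<lambda>w. (fst w, D (snd w)))"
    by (rule smooth_map_on_Pair[OF P E N pr1 smooth_map_on_compose[OF P N N pr2 D]]) auto
  then have F: "smooth_map_on ?P ?P ?T (map_prod id D)"
    by (rule smooth_map_on_cong_subset) (auto simp: map_prod_def split_beta)
  have "smooth_map_on ?P ?P ?T (\<lambda>w. (fst w, snd w))"
    by (rule smooth_map_on_Pair[OF P E N pr1 pr2])
  then have I: "smooth_map_on ?P ?P ?T id"
    by (rule smooth_map_on_cong_subset) auto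
  have base: "smooth_map_on ?P M ?T (\<lambda>w. fst (snd w))"
    by (rule smooth_map_on_compose[OF P N M pr2 q]) auto
  text \<open>Along a curve in the time-extended guard, both pullbacks reduce to a velocity in \<open>\<Sigma>\<close>
    and a velocity in time.\<close>
  have key: "pullback_on ?P ?P ?T (map_prod id D) (theta_form M H) w v =
        blinfun_apply (snd (D (snd w))) (mderiv_on M M \<Sigma> \<Delta> (fst (snd w)) (mderiv euc M (\<lambda>s. fst (snd (\<gamma> s))) 0 1))
        - H (D (snd w)) * mderiv euc euc (\<lambda>s. fst (\<gamma> s)) 0 1"
      "pullback_on ?P ?P ?T id (theta_form M H) w v =
        blinfun_apply (snd (snd w)) (mderiv euc M (\<lambda>s. fst (snd (\<gamma> s))) 0 1)
        - H (snd w) * mderiv euc euc (\<lambda>s. fst (\<gamma> s)) 0 1"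
      "mderiv euc M (\<lambda>s. fst (snd (\<gamma> s))) 0 1 \<in> tangent_space M \<Sigma> (fst (snd w))"
    if \<gamma>: "curve_through ?P ?T w v \<gamma>" for w v \<gamma>
  proof -
    note \<gamma>D = curve_throughD[OF P \<gamma>]
    have \<delta>: "curve_through M \<Sigma> (fst (snd w)) (mderiv euc M (\<lambda>s. fst (snd (\<gamma> s))) 0 1) (\<lambda>s. fst (snd (\<gamma> s)))"
      by (rule curve_through_compose[OF P M base _ \<gamma>]) auto
    then show "mderiv euc M (\<lambda>s. fst (snd (\<gamma> s))) 0 1 \<in> tangent_space M \<Sigma> (fst (snd w))"
      by (auto simp: tangent_space_def)
    note i = mderiv_on_curve[OF P P I \<gamma>] and F' = mderiv_on_curve[OF P P F \<gamma>] and d = mderiv_on_curve[OF M M \<Delta> \<delta>]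
    show "pullback_on ?P ?P ?T id (theta_form M H) w v =
        blinfun_apply (snd (snd w)) (mderiv euc M (\<lambda>s. fst (snd (\<gamma> s))) 0 1)
        - H (snd w) * mderiv euc euc (\<lambda>s. fst (\<gamma> s)) 0 1"
      using theta_form_curve[OF M i(2), of H] \<gamma>D(2) by (simp add: pullback_on_def i(1))
    have ev: "\<forall>\<^sub>F s in nhds 0. \<Delta> (fst (snd (\<gamma> s))) = fst (snd (map_prod id D (\<gamma> s)))"
      using \<gamma>D(4) by eventually_elim (auto simp: cover)
    have "mderiv euc M (\<lambda>s. fst (snd (map_prod id D (\<gamma> s)))) 0 =
        mderiv euc M (\<lambda>s. \<Delta> (fst (snd (\<gamma> s)))) 0"
      by (rule mderiv_curve_cong(2)[OF M d(2) ev])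
    moreover have "(\<lambda>s. fst (map_prod id D (\<gamma> s))) = (\<lambda>s. fst (\<gamma> s))"
      by (simp add: map_prod_def split_beta)
    ultimately show "pullback_on ?P ?P ?T (map_prod id D) (theta_form M H) w v =
        blinfun_apply (snd (D (snd w))) (mderiv_on M M \<Sigma> \<Delta> (fst (snd w)) (mderiv euc M (\<lambda>s. fst (snd (\<gamma> s))) 0 1))
        - H (D (snd w)) * mderiv euc euc (\<lambda>s. fst (\<gamma> s)) 0 1"
      unfolding pullback_on_def F'(1) d(1)
      using theta_form_curve[OF M F'(2), of H] \<gamma>D(2) by (simp add: map_prod_def split_beta)
  qed
  let ?eq = "\<lambda>x p. H (D (x, p)) = H (x, p) \<and>
       (\<forall>u\<in>tangent_space M \<Sigma> x. blinfun_apply (snd (D (x, p))) (mderiv_on M M \<Sigma> \<Delta> x u) = blinfun_apply p u)"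
  show ?thesis
  proof
    assume "solves_extended_reset M \<Delta> H ?S D"
    then have eq: "pullback_on ?P ?P ?T (map_prod id D) (theta_form M H) w v = pullback_on ?P ?P ?T id (theta_form M H) w v"
      if "curve_through ?P ?T w v \<gamma>" for w v \<gamma>
    proof -
      have "v \<in> tangent_space ?P ?T w" using that by (auto simp: tangent_space_def)
      then show ?thesis
        using \<open>solves_extended_reset M \<Delta> H ?S D\<close> curve_throughD(5)[OF P that]
        unfolding solves_extended_reset_def by blast
    qed
    have "?eq x p" if x: "x \<in> \<Sigma>" for x p
    proof
      have zS: "(x, p) \<in> ?S" using x by simp
      have xM: "x \<in> mcarrier M" using smooth_map_on_carrier(1)[OF \<Delta> x] .
      have zN: "(x, p) \<in> mcarrier ?N" using zS Scar by blast
      \<comment> \<open>Time runs and the state is frozen, so only the energy terms survive. The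
        constant curve in \<open>\<Sigma>\<close> shows that the differential of \<Delta> sends 0 to
        0.\<close>
      show "H (D (x, p)) = H (x, p)"
      proof -
        let ?\<gamma> = "\<lambda>t::real. (t, (x, p))"
        have "smooth_map_on euc ?P {-1<..<1} ?\<gamma>"
          by (rule smooth_map_on_Pair[OF E E N smooth_map_on_euc[OF C_inf_id] smooth_map_on_const_euc[OF zN]])
        then have \<gamma>: "curve_through ?P ?T (0, (x, p)) (mderiv euc ?P ?\<gamma> 0 1) ?\<gamma>"
          unfolding curve_through_def using x by (auto intro: exI[of _ 1])
        have "curve_through M \<Sigma> x (mderiv euc M (\<lambda>t::real. x) 0 1) (\<lambda>t. x)"
          unfolding curve_through_def using x smooth_map_on_const_euc[OF xM] by (auto intro: exI[of _ 1])
        from mderiv_on_curve(1)[OF M M \<Delta> this] have "mderiv_on M M \<Sigma> \<Delta> x 0 = 0"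
          using mderiv_const_curve[OF M xM] mderiv_const_curve[OF M smooth_map_on_carrier(2)[OF \<Delta> x]] by simp
        then show ?thesis
          using eq[OF \<gamma>] key(1,2)[OF \<gamma>] by (simp add: mderiv_const_curve[OF M xM] mderiv_ident_curve)
      qed
      show "\<forall>u\<in>tangent_space M \<Sigma> x. blinfun_apply (snd (D (x, p))) (mderiv_on M M \<Sigma> \<Delta> x u) = blinfun_apply p u"
      proof
        fix u assume "u \<in> tangent_space M \<Sigma> x"
        then obtain \<gamma> where \<gamma>: "curve_through M \<Sigma> x u \<gamma>" by (auto simp: tangent_space_def)
        note \<gamma>D = curve_throughD[OF M \<gamma>]
        obtain e where e: "e > 0" "smooth_map_on euc M {-e<..<e} \<gamma>" "\<gamma> ` {-e<..<e} \<subseteq> \<Sigma>"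
          using \<gamma> by (auto simp: curve_through_def)
        note c = chart_at[OF xM]
        let ?c = "chart_at M x"
        have "\<forall>\<^sub>F s in nhds 0. \<gamma> s \<in> fst ?c"
          using mdifferentiable_curve[OF M c(1) _ \<gamma>D(1)] c(2) \<gamma>D(2) by metis
        then obtain d where d: "d > 0" "\<And>s. \<bar>s\<bar> < d \<Longrightarrow> \<gamma> s \<in> fst ?c"
          by (auto simp: eventually_nhds_metric dist_real_def)
        define r where "r = min d e"
        have r: "r > 0" "{-r<..<r} \<subseteq> {-e<..<e}" "\<And>s. s \<in> {-r<..<r} \<Longrightarrow> \<gamma> s \<in> fst ?c"
          using d e(1) by (auto simp: r_def)
        \<comment> \<open>Time is frozen and the curve in \<open>\<Sigma>\<close> is lifted through
          \<open>(x, p)\<close>. Constant components need a single chart, hence the shortened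
          interval of length controlled by \<open>r\<close>.\<close>
        let ?\<zeta> = "\<lambda>s. (\<gamma> s, covec M ?c (\<gamma> s) (comps M ?c x p))"
        let ?\<gamma> = "\<lambda>s::real. (0::real, ?\<zeta> s)"
        have z0: "?\<zeta> 0 = (x, p)" using \<gamma>D(2) covec_comps[OF M c] by simp
        have "smooth_map_on euc ?N {-r<..<r} ?\<zeta>"
          by (rule smooth_map_on_covec[OF E M smooth_map_on_cong_subset[OF e(2) r(2) refl] c(1) r(3)])
        then have "smooth_map_on euc ?P {-r<..<r} ?\<gamma>"
          by (intro smooth_map_on_Pair[OF E E N] smooth_map_on_const_euc) simp_all
        then have \<Gamma>: "curve_through ?P ?T (0, (x, p)) (mderiv euc ?P ?\<gamma> 0 1) ?\<gamma>"
          unfolding curve_through_def using e(3) r z0 by (auto intro!: exI[of _ r])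
        show "blinfun_apply (snd (D (x, p))) (mderiv_on M M \<Sigma> \<Delta> x u) = blinfun_apply p u"
          using eq[OF \<Gamma>] key(1,2)[OF \<Gamma>] \<gamma>D(3) by (simp add: mderiv_const_curve[OF E])
      qed
    qed
    then show "\<forall>x\<in>\<Sigma>. \<forall>p. ?eq x p" by blast
  next
    assume R: "\<forall>x\<in>\<Sigma>. \<forall>p. ?eq x p"
    show "solves_extended_reset M \<Delta> H ?S D"
      unfolding solves_extended_reset_def
    proof (intro conjI ballI)
      show "smooth_map_on ?N ?N ?S D" by (rule D)
      show "fst (D z) = \<Delta> (fst z)" if "z \<in> ?S" for z using that cover by auto
      fix w v assume w: "w \<in> ?T" and "v \<in> tangent_space ?P ?T w"
      then obtain \<gamma> where \<gamma>: "curve_through ?P ?T w v \<gamma>" by (auto simp: tangent_space_def)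
      obtain t x p where "w = (t, (x, p))" "x \<in> \<Sigma>" using w by auto
      then show "pullback_on ?P ?P ?T (map_prod id D) (theta_form M H) w v = pullback_on ?P ?P ?T id (theta_form M H) w v"
        using key[OF \<gamma>] R by simp
    qed
  qed
qed

section \<open>Functions on the cotangent bundle in natural charts\<close>

lemma diff_fun_linear:
  assumes A: "smooth_atlas A" and f: "smooth_map_on A euc (mcarrier A) f" and x: "x \<in> mcarrier A"
  shows "bounded_linear (diff_fun A f x)"
  using linear_mderiv[OF A smooth_atlas_euc smooth_map_on_carrier_mdifferentiable[OF A smooth_atlas_euc f x]]
  by (simp add: diff_fun_def linear_conv_bounded_linear)

lemma cot_chart_in: "c \<in> A \<Longrightarrow> cot_chart A c \<in> cotangent A"
  by (simp add: cotangent_def)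

lemma cot_chart_image:
  assumes A: "smooth_atlas A" and c: "c \<in> A"
  shows "snd (cot_chart A c) ` fst (cot_chart A c) = snd c ` fst c \<times> UNIV"
proof
  show "snd (cot_chart A c) ` fst (cot_chart A c) \<subseteq> snd c ` fst c \<times> UNIV" by auto
  show "snd c ` fst c \<times> UNIV \<subseteq> snd (cot_chart A c) ` fst (cot_chart A c)"
  proof
    fix z assume "z \<in> snd c ` fst c \<times> (UNIV :: 'b set)"
    then obtain x \<pi> where "z = (snd c x, \<pi>)" "x \<in> fst c" by (auto elim!: SigmaE imageE)
    then show "z \<in> snd (cot_chart A c) ` fst (cot_chart A c)"
      using comps_covec[OF A c] by (intro image_eqI[of _ _ "(x, covec A c x \<pi>)"]) auto
  qed
qed

definition cot_rep :: "('p, 'a::euclidean_space) atlas \<Rightarrow> (('p, 'a) cot \<Rightarrow> real) \<Rightarrow> ('p, 'a) chart \<Rightarrow> 'a \<times> 'a \<Rightarrow> real" where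
  "cot_rep A H c z = H (cinv (cot_chart A c) z)"

lemma C_inf_cot_rep:
  assumes A: "smooth_atlas A" and H: "smooth_map_on (cotangent A) euc (mcarrier (cotangent A)) H" and c: "c \<in> A"
  shows "C_inf (cot_rep A H c) (snd c ` fst c \<times> UNIV)"
  using smooth_function_chart[OF smooth_atlas_cotangent[OF A] H cot_chart_in[OF c]]
  unfolding cot_chart_image[OF A c] cot_rep_def .

lemma cot_rep_eq:
  assumes A: "smooth_atlas A" and c: "c \<in> A" "x \<in> fst c"
  shows "cot_rep A H c (snd c x, comps A c x p) = H (x, p)"
  unfolding cot_rep_def cinv_cot_chart[OF A c] covec_comps[OF A c] ..



text \<open>Because \<open>comps\<close> is linear, a line in a fibre is a straight line in the
  natural chart with no base velocity. This turns one-variable derivatives of a Hamiltonian into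
  partial derivatives in charts and back.\<close>

lemma cot_rep_fibre_derivative:
  assumes A: "smooth_atlas A" and H: "smooth_map_on (cotangent A) euc (mcarrier (cotangent A)) H"
    and c: "c \<in> A" "x \<in> fst c"
  shows "((\<lambda>s. H (x, p + s *\<^sub>R k)) has_real_derivative
    frechet_derivative (cot_rep A H c) (at (snd c x, comps A c x p)) (0, comps A c x k)) (at 0)"
proof -
  let ?K = "cot_rep A H c" and ?z = "(snd c x, comps A c x p)"
  have o: "open (snd c ` fst c \<times> (UNIV :: 'b set))" using smooth_atlas_open[OF A c(1)] by (simp add: open_Times)
  have z: "?z \<in> snd c ` fst c \<times> UNIV" using c(2) by simp
  have D: "(?K has_derivative frechet_derivative ?K (at ?z)) (at ?z)"
    by (rule C_inf_has_derivative[OF C_inf_cot_rep[OF A H c(1)] o z])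
  have "((\<lambda>s::real. (snd c x, comps A c x p + s *\<^sub>R comps A c x k)) has_derivative
      (\<lambda>s. (0, s *\<^sub>R comps A c x k))) (at 0)"
    by (auto intro!: derivative_eq_intros)
  from has_derivative_compose[OF this, of ?K "frechet_derivative ?K (at ?z)"] D
  have "((\<lambda>s. ?K (snd c x, comps A c x p + s *\<^sub>R comps A c x k)) has_derivative
      (\<lambda>s. frechet_derivative ?K (at ?z) (0, s *\<^sub>R comps A c x k))) (at 0)"
    by simp
  moreover have "?K (snd c x, comps A c x p + s *\<^sub>R comps A c x k) = H (x, p + s *\<^sub>R k)" for s
    using cot_rep_eq[OF A c, of H "p + s *\<^sub>R k"]
    by (simp add: linear_add[OF linear_comps] linear_scale[OF linear_comps])
  moreover have "frechet_derivative ?K (at ?z) (0, s *\<^sub>R comps A c x k) =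
      frechet_derivative ?K (at ?z) (0, comps A c x k) * s" for s
    using linear_scale[OF has_derivative_linear[OF D], of s "(0, comps A c x k)"] by simp
  ultimately show ?thesis by (simp add: has_field_derivative_def)
qed

text \<open>What the reset equation uses of the mechanics; \<open>\<eta>\<close> stands for h
  composed with the projection to the configuration space. The first half of
  \<open>transversal\<close> makes \<open>f\<close> a complement to the tangent space of the guard.
  Together, \<open>\<beta>_d\<eta>\<close> and the second half make \<open>H\<close> affine with
  nonzero slope in the direction \<open>d\<eta>\<close> over reset states.\<close>

locale reset_system =
  fixes M :: "('p, 'a::euclidean_space) atlas" and \<Sigma> :: "'p set" and \<Delta> :: "'p \<Rightarrow> 'p" and \<eta> :: "'p \<Rightarrow> real"
    and H :: "('p, 'a) cot \<Rightarrow> real" and \<beta> f V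
  assumes M: "smooth_atlas M" and immersion: "immersion_on M M \<Sigma> \<Delta>"
    and \<eta>: "smooth_map_on M euc (mcarrier M) \<eta>" and \<eta>_guard: "\<And>x. x \<in> \<Sigma> \<Longrightarrow> \<eta> x = 0"
    and \<eta>_reset: "\<And>x. x \<in> \<Sigma> \<Longrightarrow> \<eta> (\<Delta> x) = 0"
    and tangent: "\<And>x. x \<in> \<Sigma> \<Longrightarrow> tangent_space M \<Sigma> x = {v. diff_fun M \<eta> x v = 0}"
    and H: "smooth_map_on (cotangent M) euc (mcarrier (cotangent M)) H"
    and quad: "quadratic_hamiltonian M H \<beta> f V"
    and \<beta>_d\<eta>: "\<And>x p. x \<in> \<Sigma> \<Longrightarrow> \<beta> (\<Delta> x) p (Blinfun (diff_fun M \<eta> (\<Delta> x))) = 0"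
    and transversal: "\<And>x. x \<in> \<Sigma> \<Longrightarrow> diff_fun M \<eta> x (f x) \<noteq> 0"
      "\<And>x. x \<in> \<Sigma> \<Longrightarrow> diff_fun M \<eta> (\<Delta> x) (f (\<Delta> x)) \<noteq> 0"
begin

lemma \<Delta>: "smooth_map_on M M \<Sigma> \<Delta>"
  using immersion by (simp add: immersion_on_def)

lemma guard_carrier: "x \<in> \<Sigma> \<Longrightarrow> x \<in> mcarrier M" "x \<in> \<Sigma> \<Longrightarrow> \<Delta> x \<in> mcarrier M"
  using smooth_map_on_carrier[OF \<Delta>] by blast+

definition d\<eta> :: "'p \<Rightarrow> 'a \<Rightarrow>\<^sub>L real" where
  "d\<eta> x = Blinfun (diff_fun M \<eta> x)"

lemma d\<eta>: "x \<in> mcarrier M \<Longrightarrow> blinfun_apply (d\<eta> x) v = diff_fun M \<eta> x v"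
  by (simp add: d\<eta>_def bounded_linear_Blinfun_apply diff_fun_linear[OF M \<eta>])

text \<open>The covector \<open>d\<eta>\<close> at the reset state lies in the kernel of the
  bilinear form, so the cross terms and the square term vanish and only the vector field notices the
  shift.\<close>

lemma H_add:
  assumes x: "x \<in> \<Sigma>"
  shows "H (\<Delta> x, q + \<mu> *\<^sub>R d\<eta> (\<Delta> x)) = H (\<Delta> x, q) + \<mu> * blinfun_apply (d\<eta> (\<Delta> x)) (f (\<Delta> x))"
proof -
  note y = guard_carrier(2)[OF x]
  have b: "bilinear (\<beta> (\<Delta> x))" and s: "\<And>p p'. \<beta> (\<Delta> x) p p' = \<beta> (\<Delta> x) p' p"
    and h: "\<And>p. H (\<Delta> x, p) = \<beta> (\<Delta> x) p p + blinfun_apply p (f (\<Delta> x)) + V (\<Delta> x)"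
    using quad y by (auto simp: quadratic_hamiltonian_def)
  have "\<beta> (\<Delta> x) (d\<eta> (\<Delta> x)) p = 0" "\<beta> (\<Delta> x) p (d\<eta> (\<Delta> x)) = 0" for p
    using \<beta>_d\<eta>[OF x] s unfolding d\<eta>_def by metis+
  then show ?thesis
    unfolding h by (simp add: bilinear_ladd[OF b] bilinear_radd[OF b] bilinear_lmul[OF b] bilinear_rmul[OF b]
        blinfun.add_left blinfun.scaleR_left)
qed

lemma reset_tangent:
  assumes x: "x \<in> \<Sigma>" and u: "u \<in> tangent_space M \<Sigma> x"
  shows "blinfun_apply (d\<eta> (\<Delta> x)) (mderiv_on M M \<Sigma> \<Delta> x u) = 0"
proof -
  obtain \<gamma> where \<gamma>: "curve_through M \<Sigma> x u \<gamma>" using u by (auto simp: tangent_space_def)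
  note \<gamma>D = curve_throughD[OF M \<gamma>] and d = mderiv_on_curve[OF M M \<Delta> \<gamma>]
  note y = guard_carrier(2)[OF x]
  have "\<forall>\<^sub>F t in nhds 0. \<eta> (\<Delta> (\<gamma> t)) = 0"
    using \<gamma>D(4) by eventually_elim (simp add: \<eta>_reset)
  from curve_tangent[OF M \<eta> y d(2) _ this] show ?thesis
    using \<gamma>D(2) by (simp add: d\<eta>[OF y] d(1))
qed

lemma zero_tangent: "x \<in> \<Sigma> \<Longrightarrow> 0 \<in> tangent_space M \<Sigma> x"
  using d\<eta>[OF guard_carrier(1), of x 0] by (simp add: tangent)

text \<open>\<open>mderiv_on\<close> is described one tangent vector at a time, which hides
  linearity. The derivative of a local extension is linear on the whole model space and restricts to
  it.\<close>

lemma mderiv_on_linear: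
  assumes x: "x \<in> \<Sigma>"
  obtains L where "linear L" "\<And>u. u \<in> tangent_space M \<Sigma> x \<Longrightarrow> mderiv_on M M \<Sigma> \<Delta> x u = L u"
proof -
  obtain c c' W g where 1: "x \<in> fst c" "snd c x \<in> W" "local_rep M M \<Sigma> \<Delta> c c' W g"
    using \<Delta> x unfolding smooth_map_on_iff_local_rep by meson
  note g = local_repD[OF 1(3)]
  define L where "L = (\<lambda>u. coord_vector M c' (\<Delta> x)
    (frechet_derivative g (at (snd c x)) (transition (chart_at M x) c x u)))"
  have lin: "linear (frechet_derivative g (at (snd c x)))"
    by (rule has_derivative_linear[OF C_inf_has_derivative[OF g(5,3) 1(2)]])
  note at = chart_at[OF guard_carrier(1)[OF x]]
  have "linear L"
    unfolding L_def
    using linear_compose[OF linear_compose[OF has_diff_linear[OF has_diff_transition[OF M at(1) g(1) at(2) 1(1)]] lin]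
        linear_coord_vector[OF M g(2) g(6)[OF 1(1) x 1(2)]]] by (simp add: comp_def)
  moreover have "mderiv_on M M \<Sigma> \<Delta> x u = L u" if u: "u \<in> tangent_space M \<Sigma> x" for u
    using mderiv_on_local_rep[OF M M 1(3,1,2), of "transition (chart_at M x) c x u"] u
    by (simp add: coord_vector_inverse(1)[OF M g(1) 1(1)] L_def)
  ultimately show ?thesis using that by blast
qed

section \<open>The augmented differential and the reset momentum\<close>

abbreviation \<A> :: "'p \<Rightarrow> 'a \<Rightarrow> 'a" where
  "\<A> \<equiv> augmented_differential M \<Sigma> \<Delta> f"

text \<open>The coefficient of \<open>f x\<close> when a tangent vector is split into a part tangent
  to the guard and a multiple of \<open>f x\<close>.\<close>

definition slope :: "'p \<Rightarrow> 'a \<Rightarrow> real" where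
  "slope x v = blinfun_apply (d\<eta> x) v / blinfun_apply (d\<eta> x) (f x)"

lemma transversal':
  assumes x: "x \<in> \<Sigma>"
  shows "blinfun_apply (d\<eta> x) (f x) \<noteq> 0" "blinfun_apply (d\<eta> (\<Delta> x)) (f (\<Delta> x)) \<noteq> 0"
  using transversal[OF x] d\<eta> guard_carrier[OF x] by simp_all

lemma slope_tangent:
  assumes "x \<in> \<Sigma>" shows "v - slope x v *\<^sub>R f x \<in> tangent_space M \<Sigma> x"
  using transversal'[OF assms] guard_carrier[OF assms]
  by (simp add: tangent[OF assms] d\<eta>[symmetric] slope_def blinfun.diff_right blinfun.scaleR_right)

lemma augmented_unique:
  assumes x: "x \<in> \<Sigma>" and L: "linear L" "\<And>u. u \<in> tangent_space M \<Sigma> x \<Longrightarrow> L u = mderiv_on M M \<Sigma> \<Delta> x u"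
    "L (f x) = f (\<Delta> x)"
  shows "L v = mderiv_on M M \<Sigma> \<Delta> x (v - slope x v *\<^sub>R f x) + slope x v *\<^sub>R f (\<Delta> x)"
proof -
  have "L v = L ((v - slope x v *\<^sub>R f x) + slope x v *\<^sub>R f x)" by simp
  also have "\<dots> = L (v - slope x v *\<^sub>R f x) + slope x v *\<^sub>R L (f x)"
    by (simp only: linear_add[OF L(1)] linear_scale[OF L(1)])
  finally show ?thesis using L(2)[OF slope_tangent[OF x]] L(3) by simp
qed

lemma augmented:
  assumes x: "x \<in> \<Sigma>"
  shows "linear (\<A> x)" "\<And>u. u \<in> tangent_space M \<Sigma> x \<Longrightarrow> \<A> x u = mderiv_on M M \<Sigma> \<Delta> x u"
    "\<A> x (f x) = f (\<Delta> x)"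
proof -
  obtain L where L: "linear L" "\<And>u. u \<in> tangent_space M \<Sigma> x \<Longrightarrow> mderiv_on M M \<Sigma> \<Delta> x u = L u"
    by (rule mderiv_on_linear[OF x]) blast
  \<comment> \<open>Written with \<open>L\<close> instead of \<open>mderiv_on\<close>, since
    expanding \<open>B\<close> by linearity also evaluates it at \<open>f x\<close>, which is not
    tangent to the guard.\<close>
  define B where "B = (\<lambda>v. L (v - slope x v *\<^sub>R f x) + slope x v *\<^sub>R f (\<Delta> x))"
  have sl: "linear (slope x)"
    by (rule linearI) (simp_all add: slope_def blinfun.add_right blinfun.scaleR_right add_divide_distrib)
  have "linear B" unfolding B_def
    by (intro linearI)
       (simp_all add: linear_add[OF sl] linear_scale[OF sl] linear_add[OF L(1)] linear_diff[OF L(1)]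
          linear_scale[OF L(1)] algebra_simps)
  moreover have "B u = mderiv_on M M \<Sigma> \<Delta> x u" if u: "u \<in> tangent_space M \<Sigma> x" for u
  proof -
    have "slope x u = 0" using u guard_carrier[OF x] by (simp add: slope_def tangent[OF x] d\<eta>)
    then show ?thesis using L(2)[OF u] by (simp add: B_def)
  qed
  moreover have "B (f x) = f (\<Delta> x)"
  proof -
    have "slope x (f x) = 1" using transversal'[OF x] by (simp add: slope_def)
    then show ?thesis using linear_0[OF L(1)] by (simp add: B_def)
  qed
  ultimately have B: "linear B \<and> (\<forall>u\<in>tangent_space M \<Sigma> x. B u = mderiv_on M M \<Sigma> \<Delta> x u) \<and> B (f x) = f (\<Delta> x)"
    by blast
  have "\<A> x = B"
    unfolding augmented_differential_def
    by (rule the_equality[where P = "\<lambda>L. linear L \<and> (\<forall>u\<in>tangent_space M \<Sigma> x. L u = mderiv_on M M \<Sigma> \<Delta> x u) \<and>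
             L (f x) = f (\<Delta> x)", OF B]) (intro ext, use augmented_unique[OF x] B in metis)
  with B show "linear (\<A> x)" "\<And>u. u \<in> tangent_space M \<Sigma> x \<Longrightarrow> \<A> x u = mderiv_on M M \<Sigma> \<Delta> x u"
    "\<A> x (f x) = f (\<Delta> x)" by auto
qed

lemma augmented_decomp:
  assumes x: "x \<in> \<Sigma>"
  shows "\<A> x v = mderiv_on M M \<Sigma> \<Delta> x (v - slope x v *\<^sub>R f x) + slope x v *\<^sub>R f (\<Delta> x)"
  by (rule augmented_unique[OF x augmented[OF x]])

text \<open>The reset keeps \<open>\<eta>\<close> at zero, so the guard part of \<open>v\<close>
  lands in the kernel of \<open>d\<eta>\<close> and only the part along \<open>f\<close>
  counts.\<close>

lemma d\<eta>_augmented: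
  assumes x: "x \<in> \<Sigma>"
  shows "blinfun_apply (d\<eta> (\<Delta> x)) (\<A> x v) = slope x v * blinfun_apply (d\<eta> (\<Delta> x)) (f (\<Delta> x))"
  unfolding augmented_decomp[OF x, of v]
  by (simp add: blinfun.add_right blinfun.scaleR_right reset_tangent[OF x slope_tangent[OF x]])

text \<open>A vector in the kernel has slope 0 and so is tangent to the guard, where the immersion
  property makes it 0. Surjectivity follows from equal dimensions.\<close>

lemma bij_augmented:
  assumes x: "x \<in> \<Sigma>"
  shows "bij (\<A> x)"
proof -
  note A = augmented[OF x]
  have "v = 0" if v: "\<A> x v = 0" for v
  proof -
    have "slope x v = 0" using d\<eta>_augmented[OF x, of v] v transversal'(2)[OF x] by simp
    then have T: "v \<in> tangent_space M \<Sigma> x" using slope_tangent[OF x, of v] by simp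
    have "mderiv_on M M \<Sigma> \<Delta> x v = mderiv_on M M \<Sigma> \<Delta> x 0"
      using A(2)[OF T] A(2)[OF zero_tangent[OF x]] v linear_0[OF A(1)] by simp
    then show ?thesis
      using immersion x T zero_tangent[OF x] unfolding immersion_on_def by (meson inj_onD)
  qed
  then have "inj (\<A> x)" using A(1) by (simp add: linear_injective_0)
  then show ?thesis using linear_injective_imp_surjective[OF A(1)] by (simp add: bij_def)
qed

text \<open>The inverse transpose that occurs in \<open>invariant_form\<close>. It satisfies the
  covector part of the reset equation and keeps the pairing with \<open>f\<close>; what may still be
  wrong is the energy.\<close>

definition push :: "'p \<Rightarrow> ('a \<Rightarrow>\<^sub>L real) \<Rightarrow> ('a \<Rightarrow>\<^sub>L real)" where
  "push x p = p o\<^sub>L Blinfun (inv (\<A> x))"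

lemma push:
  assumes x: "x \<in> \<Sigma>"
  shows "blinfun_apply (push x p) w = blinfun_apply p (inv (\<A> x) w)"
    and push_augmented: "blinfun_apply (push x p) (\<A> x v) = blinfun_apply p v"
proof -
  have "linear (inv (\<A> x))"
    by (rule inj_linear_imp_inv_linear[OF augmented(1)[OF x] bij_is_inj[OF bij_augmented[OF x]]])
  then show *: "blinfun_apply (push x p) w = blinfun_apply p (inv (\<A> x) w)" for w
    by (simp add: push_def bounded_linear_Blinfun_apply linear_conv_bounded_linear)
  show "blinfun_apply (push x p) (\<A> x v) = blinfun_apply p v"
    unfolding * by (simp add: inv_f_f[OF bij_is_inj[OF bij_augmented[OF x]]])
qed

text \<open>The solution of the energy balance: by \<open>H_add\<close>, adding a multiple of
  \<open>d\<eta>\<close> changes \<open>H\<close> at the reset state by that multiple times the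
  denominator.\<close>

definition multiplier :: "'p \<Rightarrow> ('a \<Rightarrow>\<^sub>L real) \<Rightarrow> real" where
  "multiplier x p = (H (x, p) - H (\<Delta> x, push x p)) / blinfun_apply (d\<eta> (\<Delta> x)) (f (\<Delta> x))"

definition reset_momentum :: "'p \<Rightarrow> ('a \<Rightarrow>\<^sub>L real) \<Rightarrow> ('a \<Rightarrow>\<^sub>L real)" where
  "reset_momentum x p = push x p + multiplier x p *\<^sub>R d\<eta> (\<Delta> x)"

lemma reset_momentum_solves:
  assumes x: "x \<in> \<Sigma>"
  shows "H (\<Delta> x, reset_momentum x p) = H (x, p)"
    "u \<in> tangent_space M \<Sigma> x \<Longrightarrow> blinfun_apply (reset_momentum x p) (mderiv_on M M \<Sigma> \<Delta> x u) = blinfun_apply p u"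
proof -
  show "H (\<Delta> x, reset_momentum x p) = H (x, p)"
    unfolding reset_momentum_def H_add[OF x] using transversal'(2)[OF x] by (simp add: multiplier_def)
  show "blinfun_apply (reset_momentum x p) (mderiv_on M M \<Sigma> \<Delta> x u) = blinfun_apply p u"
    if u: "u \<in> tangent_space M \<Sigma> x"
    using push_augmented[OF x, of p u] augmented(2)[OF x u] reset_tangent[OF x u]
    by (simp add: reset_momentum_def blinfun.add_left blinfun.scaleR_left)
qed

text \<open>Two candidates differ by a covector that vanishes on the image of the tangent space of
  the guard, hence by a multiple of \<open>d\<eta>\<close>. Equal energies force the multiple to be
  0, as the slope in \<open>H_add\<close> is nonzero.\<close>

lemma reset_momentum_unique:
  assumes x: "x \<in> \<Sigma>" and q: "H (\<Delta> x, q) = H (x, p)"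
    "\<And>u. u \<in> tangent_space M \<Sigma> x \<Longrightarrow> blinfun_apply q (mderiv_on M M \<Sigma> \<Delta> x u) = blinfun_apply p u"
  shows "q = reset_momentum x p"
proof -
  note A = augmented[OF x]
  let ?r = "q - reset_momentum x p" and ?n = "d\<eta> (\<Delta> x)" and ?f = "f (\<Delta> x)"
  \<comment> \<open>The factor is read off at \<open>f (\<Delta> x)\<close>, the one direction
    missing from the image of the tangent space.\<close>
  define \<mu> where "\<mu> = blinfun_apply ?r ?f / blinfun_apply ?n ?f"
  have "blinfun_apply ?r w = blinfun_apply (\<mu> *\<^sub>R ?n) w" for w
  proof -
    obtain v where w: "w = \<A> x v" using bij_augmented[OF x] by (metis bij_pointE)
    have "blinfun_apply ?r w = slope x v * blinfun_apply ?r ?f"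
      unfolding w augmented_decomp[OF x, of v]
      using q(2)[OF slope_tangent[OF x, of v]] reset_momentum_solves(2)[OF x slope_tangent[OF x, of v], of p]
      by (simp add: blinfun.add_right blinfun.scaleR_right blinfun.diff_left)
    moreover have "blinfun_apply ?n w = slope x v * blinfun_apply ?n ?f"
      unfolding w by (rule d\<eta>_augmented[OF x])
    ultimately show ?thesis
      using transversal'(2)[OF x] by (simp add: \<mu>_def blinfun.scaleR_left)
  qed
  then have "?r = \<mu> *\<^sub>R ?n" by (rule blinfun_eqI)
  then have q_eq: "q = reset_momentum x p + \<mu> *\<^sub>R ?n" by (simp add: algebra_simps)
  have "H (\<Delta> x, q) = H (\<Delta> x, reset_momentum x p) + \<mu> * blinfun_apply ?n ?f"
    unfolding q_eq by (rule H_add[OF x])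
  then have "\<mu> = 0" using q(1) reset_momentum_solves(1)[OF x] transversal'(2)[OF x] by simp
  then show ?thesis using q_eq by simp
qed

end

section \<open>Charts and the topology of the atlas\<close>

lemma openin_chart_preimage:
  assumes A: "smooth_atlas A" and c: "c \<in> A" and U: "open U"
  shows "openin (mtopology A) {y \<in> fst c. snd c y \<in> U}"
proof -
  have inj: "inj_on \<phi> D" if "(D, \<phi>) \<in> A" for D \<phi>
    using smooth_atlas_inj[OF A that] by simp
  have "open (\<phi> ` ({y \<in> fst c. snd c y \<in> U} \<inter> D))" if k: "(D, \<phi>) \<in> A" for D \<phi>
  proof -
    let ?t = "snd c \<circ> inv_into D \<phi>" and ?O = "\<phi> ` (D \<inter> fst c)"
    note o = smooth_atlas_open_Int[OF A k c, simplified] and t = smooth_atlas_transition[OF A k c, simplified]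
    have "\<phi> ` ({y \<in> fst c. snd c y \<in> U} \<inter> D) = ?O \<inter> ?t -` U"
    proof (intro equalityI subsetI)
      fix z assume "z \<in> \<phi> ` ({y \<in> fst c. snd c y \<in> U} \<inter> D)"
      then obtain y where "y \<in> fst c" "snd c y \<in> U" "y \<in> D" "z = \<phi> y" by blast
      then show "z \<in> ?O \<inter> ?t -` U" using inv_into_f_f[OF inj[OF k]] by simp
    next
      fix z assume z: "z \<in> ?O \<inter> ?t -` U"
      then obtain y where y: "y \<in> fst c" "y \<in> D" "z = \<phi> y" by blast
      then have "snd c y \<in> U" using z inv_into_f_f[OF inj[OF k]] by simp
      then show "z \<in> \<phi> ` ({y \<in> fst c. snd c y \<in> U} \<inter> D)" using y by blast
    qed
    then show ?thesis using continuous_open_preimage[OF C_inf_continuous_on[OF t] o U] by simp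
  qed
  then show ?thesis
    using openin_mtopology[of A, OF inj] mcarrierI[OF c] by blast
qed

lemma openin_chart_image:
  assumes A: "smooth_atlas A" and c: "c \<in> A" and U: "openin (mtopology A) U"
  shows "open (snd c ` (U \<inter> fst c))"
proof -
  have inj: "inj_on \<phi> D" if "(D, \<phi>) \<in> A" for D \<phi>
    using smooth_atlas_inj[OF A that] by simp
  have "\<forall>(D, \<phi>)\<in>A. open (\<phi> ` (U \<inter> D))"
    using U openin_mtopology[of A, OF inj] by blast
  then show ?thesis using c by (auto simp: split_beta)
qed

lemma topspace_mtopology:
  assumes A: "smooth_atlas A"
  shows "topspace (mtopology A) = mcarrier A"
proof -
  have inj: "inj_on \<phi> D" if "(D, \<phi>) \<in> A" for D \<phi>
    using smooth_atlas_inj[OF A that] by simp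
  have "\<phi> ` (mcarrier A \<inter> D) = \<phi> ` D" if "(D, \<phi>) \<in> A" for D \<phi>
    using mcarrierI[OF that] by auto
  then have "openin (mtopology A) (mcarrier A)"
    using openin_mtopology[of A, OF inj] smooth_atlas_open[OF A] by fastforce
  moreover have "topspace (mtopology A) \<subseteq> mcarrier A"
    using openin_topspace[of "mtopology A"] openin_mtopology[of A, OF inj] by blast
  ultimately show ?thesis using openin_subset by blast
qed

section \<open>Smoothness, existence and uniqueness of the extended reset\<close>

context reset_system
begin

definition \<alpha> :: "('p, 'a) chart \<Rightarrow> 'a \<Rightarrow> 'a \<Rightarrow> real" where
  "\<alpha> c \<xi> v = frechet_derivative (\<lambda>\<xi>. \<eta> (cinv c \<xi>)) (at \<xi>) v"

text \<open>The vector field \<open>f\<close> is smooth because it is the fibre derivative of \<open>H\<close> along the zero section.\<close>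

definition f_rep :: "('p, 'a) chart \<Rightarrow> 'a \<Rightarrow> 'a" where
  "f_rep c \<xi> = (\<Sum>b\<in>Basis. frechet_derivative (cot_rep M H c) (at (\<xi>, 0)) (0, b) *\<^sub>R b)"

lemma \<alpha>_eq: "c \<in> M \<Longrightarrow> x \<in> fst c \<Longrightarrow> \<alpha> c (snd c x) v = blinfun_apply (d\<eta> x) (coord_vector M c x v)"
  using diff_fun_chart[OF M \<eta>] d\<eta>[OF mcarrierI] by (simp add: \<alpha>_def)

lemma C_inf_\<alpha>:
  fixes \<kappa> :: "'x::euclidean_space \<Rightarrow> 'a"
  assumes "c \<in> M" "open W" "C_inf \<kappa> W" "C_inf v W" "\<kappa> ` W \<subseteq> snd c ` fst c"
  shows "C_inf (\<lambda>z. \<alpha> c (\<kappa> z) (v z)) W"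
  unfolding \<alpha>_def
  by (rule C_inf_frechet_apply[OF assms(2) smooth_atlas_open[OF M assms(1)] smooth_function_chart[OF M \<eta> assms(1)]
        assms(3,4,5)])

lemma linear_\<alpha>: "c \<in> M \<Longrightarrow> \<xi> \<in> snd c ` fst c \<Longrightarrow> linear (\<alpha> c \<xi>)"
  using has_derivative_linear[OF C_inf_has_derivative[OF smooth_function_chart[OF M \<eta>] smooth_atlas_open[OF M]]]
  by (simp add: \<alpha>_def[abs_def])

lemma f_rep_eq:
  assumes c: "c \<in> M" "x \<in> fst c"
  shows "coord_vector M c x (f_rep c (snd c x)) = f x"
proof -
  have x: "x \<in> mcarrier M" using mcarrierI[OF c] .
  have bil: "bilinear (\<beta> x)" and h: "\<And>p. H (x, p) = \<beta> x p p + blinfun_apply p (f x) + V x"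
    using quad x by (auto simp: quadratic_hamiltonian_def)
  let ?T = "transition (chart_at M x) c x"
  have "frechet_derivative (cot_rep M H c) (at (snd c x, 0)) (0, b) = b \<bullet> ?T (f x)" for b
  proof -
    let ?k = "covec M c x b"
    have 0: "comps M c x 0 = 0" using linear_0[OF linear_comps] .
    have "((\<lambda>s. H (x, 0 + s *\<^sub>R ?k)) has_real_derivative
        frechet_derivative (cot_rep M H c) (at (snd c x, 0)) (0, b)) (at 0)"
      using cot_rep_fibre_derivative[OF M H c, of 0 ?k] by (simp add: 0 comps_covec[OF M c])
    moreover have "H (x, 0 + s *\<^sub>R ?k) = s * s * \<beta> x ?k ?k + s * blinfun_apply ?k (f x) + V x" for s
      unfolding h by (simp add: bilinear_lmul[OF bil] bilinear_rmul[OF bil] blinfun.scaleR_left)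
    \<comment> \<open>The bilinear form contributes a term of second order in \<open>s\<close>, so
      the derivative at 0 sees only the vector field.\<close>
    moreover have "((\<lambda>s. s * s * \<beta> x ?k ?k + s * blinfun_apply ?k (f x) + V x) has_real_derivative
        blinfun_apply ?k (f x)) (at 0)"
      by (auto intro!: derivative_eq_intros)
    ultimately have "frechet_derivative (cot_rep M H c) (at (snd c x, 0)) (0, b) = blinfun_apply ?k (f x)"
      using DERIV_unique by simp
    then show ?thesis by (simp add: covec_apply[OF M c])
  qed
  then have "f_rep c (snd c x) = ?T (f x)"
    by (simp add: f_rep_def euclidean_representation inner_commute[of _ "?T (f x)"])
  then show ?thesis by (simp add: coord_vector_inverse(1)[OF M c])
qed

lemma C_inf_f_rep:
  assumes c: "c \<in> M"
  shows "C_inf (f_rep c) (snd c ` fst c)"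
proof -
  note o = smooth_atlas_open[OF M c]
  then have o': "open (snd c ` fst c \<times> (UNIV :: 'a set))" by (simp add: open_Times)
  show ?thesis
    unfolding f_rep_def[abs_def]
    by (intro C_inf_sum C_inf_scaleR C_inf_const o C_inf_Pair C_inf_id
        C_inf_frechet_apply[OF o o' C_inf_cot_rep[OF M H c]]) auto
qed

text \<open>The augmented differential in charts.  The formula makes sense off the guard as well, where
  \<open>augmented_differential\<close> does not.\<close>

definition A_rep :: "('p, 'a) chart \<Rightarrow> ('p, 'a) chart \<Rightarrow> ('a \<Rightarrow> 'a) \<Rightarrow> 'a \<Rightarrow> 'a \<Rightarrow> 'a" where
  "A_rep c c' g \<xi> v = frechet_derivative g (at \<xi>) v + (\<alpha> c \<xi> v / \<alpha> c \<xi> (f_rep c \<xi>)) *\<^sub>R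
     (f_rep c' (g \<xi>) - frechet_derivative g (at \<xi>) (f_rep c \<xi>))"

text \<open>Collects on one neighbourhood all that the smoothness proofs need. At guard points the
  formula is \<open>\<A>\<close> in charts and so invertible; off the guard, invertibility near
  \<open>x0\<close> comes from \<open>C_inf_inverse_linear\<close>.\<close>

lemma A_rep:
  assumes x0: "x0 \<in> \<Sigma>" "x0 \<in> fst c" "snd c x0 \<in> W" and g: "local_rep M M \<Sigma> \<Delta> c c' W g"
  obtains W' where "open W'" "snd c x0 \<in> W'" "W' \<subseteq> W" "g ` W' \<subseteq> snd c' ` fst c'"
    "\<And>\<xi>. \<xi> \<in> W' \<Longrightarrow> linear (A_rep c c' g \<xi>)" "\<And>\<xi>. \<xi> \<in> W' \<Longrightarrow> bij (A_rep c c' g \<xi>)"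
    "\<And>v. C_inf (\<lambda>\<xi>. A_rep c c' g \<xi> v) W'" "\<And>v. C_inf (\<lambda>\<xi>. inv (A_rep c c' g \<xi>) v) W'"
    "\<And>\<xi>. \<xi> \<in> W' \<Longrightarrow> \<alpha> c' (g \<xi>) (f_rep c' (g \<xi>)) \<noteq> 0"
    "\<And>x v. x \<in> \<Sigma> \<Longrightarrow> x \<in> fst c \<Longrightarrow> snd c x \<in> W' \<Longrightarrow>
        \<A> x (coord_vector M c x v) = coord_vector M c' (\<Delta> x) (A_rep c c' g (snd c x) v)"
proof -
  note gD = local_repD[OF g]
  have o: "open (snd c ` fst c)" and o': "open (snd c' ` fst c')"
    using smooth_atlas_open[OF M] gD(1,2) by auto
  define W0 where "W0 = W \<inter> g -` (snd c' ` fst c')"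
  have oW0: "open W0" unfolding W0_def
    using continuous_open_preimage[OF C_inf_continuous_on[OF gD(5)] gD(3) o'] .
  have W0: "W0 \<subseteq> snd c ` fst c" "g ` W0 \<subseteq> snd c' ` fst c'" "W0 \<subseteq> W" using gD(4) by (auto simp: W0_def)
  have fr: "C_inf (f_rep c) W0" by (rule C_inf_subset[OF C_inf_f_rep[OF gD(1)] W0(1)])
  have gs: "C_inf g W0" by (rule C_inf_subset[OF gD(5) W0(3)])
  have fg: "C_inf (\<lambda>\<xi>. f_rep c' (g \<xi>)) W0"
    by (rule C_inf_compose[OF oW0 o' C_inf_f_rep[OF gD(2)] gs W0(2)])
  have a1: "C_inf (\<lambda>\<xi>. \<alpha> c \<xi> (f_rep c \<xi>)) W0"
    by (rule C_inf_\<alpha>[OF gD(1) oW0 C_inf_id fr]) (use W0 in auto)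
  have a2: "C_inf (\<lambda>\<xi>. \<alpha> c' (g \<xi>) (f_rep c' (g \<xi>))) W0"
    by (rule C_inf_\<alpha>[OF gD(2) oW0 gs fg W0(2)])
  \<comment> \<open>The two conditions keep the denominators of \<open>A_rep\<close> and, in charts,
    of \<open>multiplier\<close> away from 0; at guard points both follow from
    transversality.\<close>
  define W1 where "W1 = W0 \<inter> (\<lambda>\<xi>. \<alpha> c \<xi> (f_rep c \<xi>)) -` (- {0}) \<inter> (W0 \<inter> (\<lambda>\<xi>. \<alpha> c' (g \<xi>) (f_rep c' (g \<xi>))) -` (- {0}))"
  have z: "open (- {0::real})" by (rule open_Compl) (rule closed_singleton)
  have oW1: "open W1" unfolding W1_def
    using continuous_open_preimage[OF C_inf_continuous_on[OF a1] oW0 z]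
      continuous_open_preimage[OF C_inf_continuous_on[OF a2] oW0 z] by blast
  have W1: "W1 \<subseteq> W0" "\<And>\<xi>. \<xi> \<in> W1 \<Longrightarrow> \<alpha> c \<xi> (f_rep c \<xi>) \<noteq> 0" "\<And>\<xi>. \<xi> \<in> W1 \<Longrightarrow> \<alpha> c' (g \<xi>) (f_rep c' (g \<xi>)) \<noteq> 0"
    by (auto simp: W1_def)
  have \<Delta>c': "\<Delta> x \<in> fst c'" "snd c' (\<Delta> x) = g (snd c x)" if "x \<in> \<Sigma>" "x \<in> fst c" "snd c x \<in> W" for x
    using gD(6,7)[of x] that by auto
  have W1I: "snd c x \<in> W1" if x: "x \<in> \<Sigma>" "x \<in> fst c" "snd c x \<in> W" for x
  proof -
    note y = \<Delta>c'[OF x]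
    have "\<alpha> c (snd c x) (f_rep c (snd c x)) \<noteq> 0" "\<alpha> c' (g (snd c x)) (f_rep c' (g (snd c x))) \<noteq> 0"
      using transversal'[OF x(1)] \<alpha>_eq[OF gD(1) x(2)] \<alpha>_eq[OF gD(2) y(1)] f_rep_eq[OF gD(1) x(2)] f_rep_eq[OF gD(2) y(1)]
      by (simp_all add: y(2)[symmetric])
    moreover have "snd c x \<in> W0" unfolding W0_def using x(3) y by (auto simp: y(2)[symmetric])
    ultimately show ?thesis by (simp add: W1_def)
  qed
  have lin: "linear (A_rep c c' g \<xi>)" if "\<xi> \<in> W1" for \<xi>
  proof -
    have l1: "linear (frechet_derivative g (at \<xi>))"
      by (rule has_derivative_linear[OF C_inf_has_derivative[OF gs oW0]]) (use that W1 in blast)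
    have l2: "linear (\<alpha> c \<xi>)" by (rule linear_\<alpha>[OF gD(1)]) (use that W1 W0 in blast)
    show ?thesis
      unfolding A_rep_def
      by (intro linearI) (simp_all add: linear_add[OF l1] linear_scale[OF l1] linear_add[OF l2] linear_scale[OF l2]
          add_divide_distrib algebra_simps)
  qed
  have smooth: "C_inf (\<lambda>\<xi>. A_rep c c' g \<xi> v) W1" for v
    unfolding A_rep_def
    by (intro C_inf_add C_inf_scaleR C_inf_diff C_inf_divide oW1 W1(2) C_inf_subset[OF a1 W1(1)]
        C_inf_subset[OF C_inf_frechet_derivative[OF gs oW0] W1(1)] C_inf_subset[OF fg W1(1)]
        C_inf_subset[OF C_inf_frechet_apply[OF oW0 oW0 gs C_inf_id fr] W1(1)]
        C_inf_subset[OF C_inf_\<alpha>[OF gD(1) oW0 C_inf_id C_inf_const] W1(1)]) (use W0 in auto)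
  have A: "\<A> x (coord_vector M c x v) = coord_vector M c' (\<Delta> x) (A_rep c c' g (snd c x) v)"
    if x: "x \<in> \<Sigma>" "x \<in> fst c" "snd c x \<in> W" for x v
  proof -
    note y = \<Delta>c'[OF x]
    let ?J = "coord_vector M c x" and ?J' = "coord_vector M c' (\<Delta> x)" and ?\<xi> = "snd c x"
    have lJ: "linear ?J" and lJ': "linear ?J'"
      using linear_coord_vector[OF M] gD(1,2) x(2) y(1) by auto
    have lg: "linear (frechet_derivative g (at ?\<xi>))"
      by (rule has_derivative_linear[OF C_inf_has_derivative[OF gD(5,3) x(3)]])
    define s where "s = slope x (?J v)"
    have s: "s = \<alpha> c ?\<xi> v / \<alpha> c ?\<xi> (f_rep c ?\<xi>)"
      by (simp add: s_def slope_def \<alpha>_eq[OF gD(1) x(2)] f_rep_eq[OF gD(1) x(2)])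
    \<comment> \<open>The part of \<open>?J v\<close> tangent to the guard. Only on such vectors may
      the derivative of the extension \<open>g\<close> be read as the differential of
      \<Delta>.\<close>
    have u: "?J v - s *\<^sub>R f x = ?J (v - s *\<^sub>R f_rep c ?\<xi>)"
      by (simp add: linear_diff[OF lJ] linear_scale[OF lJ] f_rep_eq[OF gD(1) x(2)])
    have "?J (v - s *\<^sub>R f_rep c ?\<xi>) \<in> tangent_space M \<Sigma> x"
      using slope_tangent[OF x(1), of "?J v"] unfolding s_def[symmetric] u .
    from mderiv_on_local_rep[OF M M g x(2,3) this]
    have "\<A> x (?J v) = ?J' (frechet_derivative g (at ?\<xi>) (v - s *\<^sub>R f_rep c ?\<xi>)) + s *\<^sub>R f (\<Delta> x)"
      unfolding augmented_decomp[OF x(1), of "?J v"] s_def[symmetric] u by simp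
    also have "f (\<Delta> x) = ?J' (f_rep c' (g ?\<xi>))" using f_rep_eq[OF gD(2) y(1)] y(2) by simp
    also have "?J' (frechet_derivative g (at ?\<xi>) (v - s *\<^sub>R f_rep c ?\<xi>)) + s *\<^sub>R ?J' (f_rep c' (g ?\<xi>))
        = ?J' (A_rep c c' g ?\<xi> v)"
      by (simp add: A_rep_def s[symmetric] linear_diff[OF lg] linear_scale[OF lg] linear_add[OF lJ'] linear_diff[OF lJ']
          linear_scale[OF lJ'] scaleR_diff_right)
    finally show ?thesis .
  qed
  have inj: "inj (A_rep c c' g (snd c x0))"
  proof (rule injI)
    fix v w assume "A_rep c c' g (snd c x0) v = A_rep c c' g (snd c x0) w"
    then have "\<A> x0 (coord_vector M c x0 v) = \<A> x0 (coord_vector M c x0 w)" using A[OF x0] by simp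
    then show "v = w"
      using bij_is_inj[OF bij_augmented[OF x0(1)]] bij_is_inj[OF bij_coord_vector[OF M gD(1) x0(2)]]
      by (simp add: inj_eq)
  qed
  obtain W' where W': "open W'" "snd c x0 \<in> W'" "W' \<subseteq> W1" "\<And>\<xi>. \<xi> \<in> W' \<Longrightarrow> bij (A_rep c c' g \<xi>)"
    "\<And>v. C_inf (\<lambda>\<xi>. inv (A_rep c c' g \<xi>) v) W'"
    by (rule C_inf_inverse_linear[OF oW1 lin smooth W1I[OF x0] inj]) (assumption, rule that)
  show ?thesis
  proof (rule that[OF W'(1,2) _ _ _ W'(4) _ W'(5)])
    show "W' \<subseteq> W" "g ` W' \<subseteq> snd c' ` fst c'" using W'(3) W1(1) W0(2,3) by blast+
    show "linear (A_rep c c' g \<xi>)" "\<alpha> c' (g \<xi>) (f_rep c' (g \<xi>)) \<noteq> 0" if "\<xi> \<in> W'" for \<xi>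
      using that W'(3) lin W1(3) by auto
    show "C_inf (\<lambda>\<xi>. A_rep c c' g \<xi> v) W'" for v by (rule C_inf_subset[OF smooth W'(3)])
    show "\<A> x (coord_vector M c x v) = coord_vector M c' (\<Delta> x) (A_rep c c' g (snd c x) v)"
      if "x \<in> \<Sigma>" "x \<in> fst c" "snd c x \<in> W'" for x v
      using A that W' W1 W0 by blast
  qed
qed

definition extended_reset :: "('p, 'a) cot \<Rightarrow> ('p, 'a) cot" where
  "extended_reset z = (\<Delta> (fst z), reset_momentum (fst z) (snd z))"

lemma smooth_extended_reset: "smooth_map_on (cotangent M) (cotangent M) (\<Sigma> \<times> UNIV) extended_reset"
proof (rule smooth_map_onI)
  fix z0 :: "('p, 'a) cot" assume "z0 \<in> \<Sigma> \<times> UNIV"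
  then have x0: "fst z0 \<in> \<Sigma>" by auto
  obtain c c' W g where 1: "fst z0 \<in> fst c" "snd c (fst z0) \<in> W" "local_rep M M \<Sigma> \<Delta> c c' W g"
    using \<Delta> x0 unfolding smooth_map_on_iff_local_rep by meson
  note gD = local_repD[OF 1(3)]
  let ?A = "A_rep c c' g"
  obtain W' where W': "open W'" "snd c (fst z0) \<in> W'" "W' \<subseteq> W" "g ` W' \<subseteq> snd c' ` fst c'"
    "\<And>\<xi>. \<xi> \<in> W' \<Longrightarrow> linear (?A \<xi>)" "\<And>\<xi>. \<xi> \<in> W' \<Longrightarrow> bij (?A \<xi>)"
    "\<And>v. C_inf (\<lambda>\<xi>. inv (?A \<xi>) v) W'" "\<And>\<xi>. \<xi> \<in> W' \<Longrightarrow> \<alpha> c' (g \<xi>) (f_rep c' (g \<xi>)) \<noteq> 0"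
    "\<And>x v. x \<in> \<Sigma> \<Longrightarrow> x \<in> fst c \<Longrightarrow> snd c x \<in> W' \<Longrightarrow>
        \<A> x (coord_vector M c x v) = coord_vector M c' (\<Delta> x) (?A (snd c x) v)"
    by (rule A_rep[OF x0 1(1,2,3)]) (rule that)
  let ?U = "W' \<times> (UNIV :: 'a set)"
  have oU: "open ?U" using W'(1) by (simp add: open_Times)
  have oc: "open (snd c ` fst c \<times> (UNIV :: 'a set))" "open (snd c' ` fst c' \<times> (UNIV :: 'a set))" "open (snd c' ` fst c')"
    using smooth_atlas_open[OF M] gD(1,2) by (auto simp: open_Times)
  have sub: "W' \<subseteq> snd c ` fst c" using W'(3) gD(4) by blast
  have f1: "C_inf (\<lambda>z. fst z) ?U" and s1: "C_inf (\<lambda>z. snd z) ?U"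
    by (intro C_inf_fst C_inf_snd C_inf_id oU)+
  have g1: "C_inf (\<lambda>z. g (fst z)) ?U"
    by (rule C_inf_compose[OF oU W'(1) C_inf_subset[OF gD(5) W'(3)] f1]) auto
  \<comment> \<open>\<open>q\<close>, \<open>n\<close> and \<open>m\<close> express
    \<open>push\<close>, \<open>d\<eta>\<close> at the reset state and \<open>multiplier\<close> in
    charts. Unlike those, they are meaningful and smooth off the guard too, as local extendability
    demands.\<close>
  define q where "q = (\<lambda>z. \<Sum>b\<in>Basis. (snd z \<bullet> inv (?A (fst z)) b) *\<^sub>R b)"
  have q1: "C_inf q ?U" unfolding q_def
    by (intro C_inf_sum C_inf_scaleR C_inf_inner oU s1 C_inf_const C_inf_compose[OF oU W'(1) W'(7) f1]) auto
  define n where "n = (\<lambda>z::'a \<times> 'a. \<Sum>b\<in>Basis. \<alpha> c' (g (fst z)) b *\<^sub>R b)"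
  have n1: "C_inf n (W' \<times> (UNIV :: 'a set))" unfolding n_def
    by (intro C_inf_sum C_inf_scaleR oU C_inf_const C_inf_\<alpha>[OF gD(2) oU g1]) (use W'(4) in auto)
  define m where "m = (\<lambda>z. (cot_rep M H c z - cot_rep M H c' (g (fst z), q z)) / \<alpha> c' (g (fst z)) (f_rep c' (g (fst z))))"
  have m1: "C_inf m ?U" unfolding m_def
    by (intro C_inf_divide C_inf_diff oU C_inf_subset[OF C_inf_cot_rep[OF M H gD(1)]]
        C_inf_compose[OF oU oc(2) C_inf_cot_rep[OF M H gD(2)]] C_inf_Pair g1 q1
        C_inf_\<alpha>[OF gD(2) oU g1] C_inf_compose[OF oU oc(3) C_inf_f_rep[OF gD(2)] g1])
       (use W'(4,8) sub in auto)
  have s: "C_inf (\<lambda>z. (g (fst z), q z + m z *\<^sub>R n z)) ?U"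
    by (intro C_inf_Pair C_inf_add C_inf_scaleR oU g1 q1 m1 n1)
  have "extended_reset y \<in> fst (cot_chart M c') \<and>
      snd (cot_chart M c') (extended_reset y) = (\<lambda>z. (g (fst z), q z + m z *\<^sub>R n z)) (snd (cot_chart M c) y)"
    if y: "y \<in> fst (cot_chart M c)" "y \<in> \<Sigma> \<times> UNIV" "snd (cot_chart M c) y \<in> ?U" for y
  proof -
    obtain x p where yx: "y = (x, p)" by (cases y)
    have x: "x \<in> \<Sigma>" "x \<in> fst c" "snd c x \<in> W'" using y by (auto simp: yx)
    have \<Delta>x: "\<Delta> x \<in> fst c'" "snd c' (\<Delta> x) = g (snd c x)" using gD(6,7)[of x] x W'(3) by auto
    let ?z = "(snd c x, comps M c x p)"
    have push_b: "blinfun_apply (push x p) (coord_vector M c' (\<Delta> x) b) = comps M c x p \<bullet> inv (?A (snd c x)) b" for b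
    proof -
      have "?A (snd c x) (inv (?A (snd c x)) b) = b"
        using W'(6)[OF x(3)] by (simp add: bij_is_surj surj_f_inv_f)
      then have "coord_vector M c' (\<Delta> x) b = \<A> x (coord_vector M c x (inv (?A (snd c x)) b))"
        using W'(9)[OF x] by simp
      then show ?thesis by (simp add: push_augmented[OF x(1)] comps_inner[OF M gD(1) x(2)])
    qed
    have q: "comps M c' (\<Delta> x) (push x p) = q ?z"
      by (simp add: comps_def[of M c'] q_def push_b)
    have n: "comps M c' (\<Delta> x) (d\<eta> (\<Delta> x)) = n ?z"
      by (simp add: comps_def n_def \<Delta>x(2)[symmetric] \<alpha>_eq[OF gD(2) \<Delta>x(1)])
    have m: "multiplier x p = m ?z"
      using cot_rep_eq[OF M gD(1) x(2), of H p] cot_rep_eq[OF M gD(2) \<Delta>x(1), of H "push x p"]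
        \<alpha>_eq[OF gD(2) \<Delta>x(1)] f_rep_eq[OF gD(2) \<Delta>x(1)]
      by (simp add: multiplier_def m_def \<Delta>x(2) q)
    show ?thesis
      using \<Delta>x by (simp add: yx extended_reset_def reset_momentum_def linear_add[OF linear_comps]
          linear_scale[OF linear_comps] q n m)
  qed
  then show "smooth_at (cotangent M) (cotangent M) (\<Sigma> \<times> UNIV) extended_reset z0"
    by (intro smooth_atI[OF smooth_atlas_cotangent[OF M] cot_chart_in[OF gD(1)] _ cot_chart_in[OF gD(2)] oU _ s])
       (use 1(1) W'(2) in \<open>auto simp: mem_Times_iff\<close>)
qed

lemma solves_iff:
  "solves_extended_reset M \<Delta> H (\<Sigma> \<times> UNIV) D \<longleftrightarrow> (\<forall>z\<in>\<Sigma> \<times> UNIV. D z = extended_reset z)"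
proof
  assume D: "solves_extended_reset M \<Delta> H (\<Sigma> \<times> UNIV) D"
  then have s: "smooth_map_on (cotangent M) (cotangent M) (\<Sigma> \<times> UNIV) D"
    and cover: "\<And>x p. x \<in> \<Sigma> \<Longrightarrow> fst (D (x, p)) = \<Delta> x"
    by (auto simp: solves_extended_reset_def)
  note eq = extended_reset_iff[OF M \<Delta> s cover, THEN iffD1, OF _ D]
  show "\<forall>z\<in>\<Sigma> \<times> UNIV. D z = extended_reset z"
  proof (rule ballI)
    fix z :: "('p, 'a) cot" assume "z \<in> \<Sigma> \<times> UNIV"
    then obtain x p where z: "z = (x, p)" "x \<in> \<Sigma>" by auto
    have Dz: "D (x, p) = (\<Delta> x, snd (D (x, p)))" using cover[OF z(2), of p] by (simp add: prod_eq_iff)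
    have "H (D (x, p)) = H (x, p)"
      "\<And>u. u \<in> tangent_space M \<Sigma> x \<Longrightarrow> blinfun_apply (snd (D (x, p))) (mderiv_on M M \<Sigma> \<Delta> x u) = blinfun_apply p u"
      using eq z(2) by blast+
    then have "snd (D (x, p)) = reset_momentum x p"
      using Dz by (intro reset_momentum_unique[OF z(2)]) metis+
    then show "D z = extended_reset z" using Dz by (simp add: z extended_reset_def)
  qed
next
  assume D: "\<forall>z\<in>\<Sigma> \<times> UNIV. D z = extended_reset z"
  have s: "smooth_map_on (cotangent M) (cotangent M) (\<Sigma> \<times> UNIV) D"
    by (rule smooth_map_on_cong_subset[OF smooth_extended_reset order_refl]) (use D in blast)
  have D': "D (x, p) = (\<Delta> x, reset_momentum x p)" if "x \<in> \<Sigma>" for x p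
    using D that by (simp add: extended_reset_def)
  show "solves_extended_reset M \<Delta> H (\<Sigma> \<times> UNIV) D"
    by (rule extended_reset_iff[OF M \<Delta> s, THEN iffD2])
       (use D' reset_momentum_solves in auto)
qed

text \<open>The reset equation constrains \<open>D\<close> on the guard alone; extensionality fixes
  the values elsewhere, so that uniqueness can hold for total functions.\<close>

theorem unique_extended_reset:
  "\<exists>!D. D \<in> extensional (\<Sigma> \<times> UNIV) \<and> solves_extended_reset M \<Delta> H (\<Sigma> \<times> UNIV) D"
  unfolding solves_iff
proof (rule ex1I[of _ "restrict extended_reset (\<Sigma> \<times> UNIV)"])
  fix D assume D: "D \<in> extensional (\<Sigma> \<times> UNIV) \<and> (\<forall>z\<in>\<Sigma> \<times> UNIV. D z = extended_reset z)"
  show "D = restrict extended_reset (\<Sigma> \<times> UNIV)"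
    by (rule extensionalityI[of _ "\<Sigma> \<times> UNIV"]) (use D in auto)
qed auto

end

section \<open>The bundle isomorphism under the invariance conditions\<close>

context reset_system
begin

lemma reset_embedding:
  assumes emb: "embedding_map (subtopology (mtopology M) \<Sigma>) (mtopology M) \<Delta>"
  shows "homeomorphic_map (subtopology (mtopology M) \<Sigma>) (subtopology (mtopology M) (\<Delta> ` \<Sigma>)) \<Delta>"
    and "inj_on \<Delta> \<Sigma>"
proof -
  have top: "topspace (subtopology (mtopology M) \<Sigma>) = \<Sigma>"
    using guard_carrier by (auto simp: topspace_mtopology[OF M])
  show hom: "homeomorphic_map (subtopology (mtopology M) \<Sigma>) (subtopology (mtopology M) (\<Delta> ` \<Sigma>)) \<Delta>"
    using emb unfolding embedding_map_def top .
  show "inj_on \<Delta> \<Sigma>" using homeomorphic_imp_injective_map[OF hom] unfolding top .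
qed

text \<open>Extends the inverse of the reset smoothly to a full neighbourhood of
  \<open>\<Delta> x0\<close>. The inverse function theorem controls only points near
  \<open>x0\<close>. That no remote guard point is sent close to \<open>\<Delta> x0\<close> is where
  the reset must be an embedding and not merely an injective immersion.\<close>

lemma local_inverse:
  assumes emb: "embedding_map (subtopology (mtopology M) \<Sigma>) (mtopology M) \<Delta>"
    and x0: "x0 \<in> \<Sigma>" "x0 \<in> fst c" "snd c x0 \<in> W'" and W': "open W'" "W' \<subseteq> W"
    and g: "local_rep M M \<Sigma> \<Delta> c c' W g" and inj: "inj (A_rep c c' g (snd c x0))"
  obtains Y k where "open Y" "snd c' (\<Delta> x0) \<in> Y" "C_inf k Y" "k ` Y \<subseteq> W'"
    "\<And>y. y \<in> \<Sigma> \<Longrightarrow> \<Delta> y \<in> fst c' \<Longrightarrow> snd c' (\<Delta> y) \<in> Y \<Longrightarrow> y \<in> fst c \<and> snd c y = k (snd c' (\<Delta> y))"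
proof -
  note gD = local_repD[OF g]
  let ?\<xi> = "snd c x0" and ?\<eta> = "\<lambda>\<xi>. \<eta> (cinv c \<xi>)"
  \<comment> \<open>The coefficient of the rank-one term of \<open>A_rep\<close>, frozen at the base
    point.\<close>
  define e where "e = (1 / \<alpha> c ?\<xi> (f_rep c ?\<xi>)) *\<^sub>R (f_rep c' (g ?\<xi>) - frechet_derivative g (at ?\<xi>) (f_rep c ?\<xi>))"
  text \<open>On the guard \<open>\<eta>\<close> vanishes, so there \<open>\<Psi>\<close> agrees with the reset; the correction term
    makes its derivative at the base point the augmented differential, which is invertible.\<close>
  define \<Psi> where "\<Psi> = (\<lambda>\<xi>. g \<xi> + ?\<eta> \<xi> *\<^sub>R e)"
  have sub: "W' \<subseteq> snd c ` fst c" using W'(2) gD(4) by blast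
  have g': "C_inf g W'" by (rule C_inf_subset[OF gD(5) W'(2)])
  have \<eta>': "C_inf ?\<eta> W'" by (rule C_inf_subset[OF smooth_function_chart[OF M \<eta> gD(1)] sub])
  have \<Psi>: "C_inf \<Psi> W'" unfolding \<Psi>_def
    by (intro C_inf_add C_inf_scaleR W'(1) g' \<eta>' C_inf_const)
  have "(\<Psi> has_derivative (\<lambda>v. frechet_derivative g (at ?\<xi>) v + \<alpha> c ?\<xi> v *\<^sub>R e)) (at ?\<xi>)"
    unfolding \<Psi>_def \<alpha>_def
    by (intro has_derivative_add has_derivative_scaleR_left C_inf_has_derivative[OF g' W'(1) x0(3)]
        C_inf_has_derivative[OF \<eta>' W'(1) x0(3)])
  moreover have "(\<lambda>v. frechet_derivative g (at ?\<xi>) v + \<alpha> c ?\<xi> v *\<^sub>R e) = A_rep c c' g ?\<xi>"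
    by (auto simp: A_rep_def e_def)
  ultimately have "frechet_derivative \<Psi> (at ?\<xi>) = A_rep c c' g ?\<xi>"
    using frechet_derivative_at by metis
  then obtain U' Y k where k: "open U'" "U' \<subseteq> W'" "?\<xi> \<in> U'" "open Y" "\<Psi> ?\<xi> \<in> Y" "homeomorphism U' Y \<Psi> k" "C_inf k Y"
    using C_inf_inverse_function[OF W'(1) \<Psi> x0(3)] inj by metis
  have \<Psi>_eq: "\<Psi> (snd c y) = snd c' (\<Delta> y)" "\<Delta> y \<in> fst c'" if "y \<in> \<Sigma>" "y \<in> fst c" "snd c y \<in> W'" for y
    using gD(6,7)[of y] that W'(2) \<eta>_guard[OF that(1)] smooth_atlas_cinv[OF M gD(1) that(2)]
    by (auto simp: \<Psi>_def)
  note hom = reset_embedding(1)[OF emb] and \<Delta>inj = reset_embedding(2)[OF emb]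
  \<comment> \<open>The guard points near \<open>x0\<close> form a relatively open set, and the
    embedding keeps its image relatively open. With \<open>O2\<close> cutting out this image,
    injectivity of the reset sends every guard point with value in \<open>O2\<close> back into
    \<open>?O1\<close>.\<close>
  let ?O1 = "\<Sigma> \<inter> {y \<in> fst c. snd c y \<in> U'}"
  have "openin (subtopology (mtopology M) \<Sigma>) ?O1"
    unfolding openin_subtopology using openin_chart_preimage[OF M gD(1) k(1)] by blast
  then have "openin (subtopology (mtopology M) (\<Delta> ` \<Sigma>)) (\<Delta> ` ?O1)"
    using homeomorphic_imp_open_map[OF hom] unfolding open_map_def by blast
  then obtain O2 where O2: "openin (mtopology M) O2" "\<Delta> ` ?O1 = O2 \<inter> \<Delta> ` \<Sigma>"
    unfolding openin_subtopology by blast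
  define Y' where "Y' = Y \<inter> snd c' ` (O2 \<inter> fst c')"
  have "open Y'" unfolding Y'_def using k(4) openin_chart_image[OF M gD(2) O2(1)] by blast
  moreover have "snd c' (\<Delta> x0) \<in> Y'"
  proof -
    have "\<Delta> x0 \<in> O2" using O2(2) x0 k(3) by blast
    then show ?thesis using \<Psi>_eq[OF x0] k(5) by (auto simp: Y'_def)
  qed
  moreover have "C_inf k Y'" by (rule C_inf_subset[OF k(7)]) (simp add: Y'_def)
  moreover have "k ` Y' \<subseteq> W'" using k(2,6) by (auto simp: Y'_def homeomorphism_def)
  moreover have "y \<in> fst c \<and> snd c y = k (snd c' (\<Delta> y))"
    if y: "y \<in> \<Sigma>" "\<Delta> y \<in> fst c'" "snd c' (\<Delta> y) \<in> Y'" for y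
  proof -
    have "snd c' (\<Delta> y) \<in> snd c' ` (fst c' \<inter> O2)" using y(3) by (auto simp: Y'_def)
    then have "\<Delta> y \<in> O2" using smooth_atlas_image_IntD[OF M gD(2) y(2)] by blast
    then have "\<Delta> y \<in> \<Delta> ` ?O1" using O2(2) y(1) by blast
    then have yO: "y \<in> ?O1" using inj_onD[OF \<Delta>inj] y(1) by blast
    then have "k (\<Psi> (snd c y)) = snd c y" using k(6) by (simp add: homeomorphism_def)
    then show ?thesis using \<Psi>_eq[of y] yO k(2) by auto
  qed
  ultimately show ?thesis using that by blast
qed

definition pull :: "'p \<Rightarrow> ('a \<Rightarrow>\<^sub>L real) \<Rightarrow> ('a \<Rightarrow>\<^sub>L real)" where
  "pull x q = q o\<^sub>L Blinfun (\<A> x)"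

lemma pull: "x \<in> \<Sigma> \<Longrightarrow> blinfun_apply (pull x q) v = blinfun_apply q (\<A> x v)"
  using augmented(1) by (simp add: pull_def bounded_linear_Blinfun_apply linear_conv_bounded_linear)

lemma push_pull: "x \<in> \<Sigma> \<Longrightarrow> push x (pull x q) = q" "x \<in> \<Sigma> \<Longrightarrow> pull x (push x p) = p"
proof -
  assume x: "x \<in> \<Sigma>"
  show "push x (pull x q) = q"
    by (rule blinfun_eqI) (simp add: pull[OF x] push[OF x] surj_f_inv_f[OF bij_is_surj[OF bij_augmented[OF x]]])
  show "pull x (push x p) = p"
    by (rule blinfun_eqI) (simp add: pull[OF x] push_augmented[OF x])
qed

text \<open>\<open>push\<close> preserves each summand of \<open>H\<close> separately: the form and
  the potential by invariance, the linear term because \<open>\<A>\<close> carries \<open>f\<close>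
  to \<open>f\<close>. Hence there is no energy defect to repair, and the reset is
  \<open>push\<close> on fibres.\<close>

theorem linear_bundle_iso_reset:
  assumes emb: "smooth_embedding_on M M \<Sigma> \<Delta>" and inv\<beta>: "invariant_form M \<Sigma> \<Delta> f \<beta>"
    and invV: "invariant_potential \<Sigma> \<Delta> V" and D: "solves_extended_reset M \<Delta> H (\<Sigma> \<times> UNIV) D"
  shows "linear_bundle_iso M \<Sigma> \<Delta> D"
proof -
  have emb': "embedding_map (subtopology (mtopology M) \<Sigma>) (mtopology M) \<Delta>"
    using emb by (simp add: smooth_embedding_on_def)
  note \<Delta>inj = reset_embedding(2)[OF emb']
  have D_eq: "D (x, p) = (\<Delta> x, push x p)" if x: "x \<in> \<Sigma>" for x p
  proof -
    have h: "\<And>p. H (y, p) = \<beta> y p p + blinfun_apply p (f y) + V y" if "y \<in> mcarrier M" for y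
      using quad that by (auto simp: quadratic_hamiltonian_def)
    have "\<beta> (\<Delta> x) (push x p) (push x p) = \<beta> x p p"
      using inv\<beta> x by (simp add: invariant_form_def Let_def push_def)
    moreover have "blinfun_apply (push x p) (f (\<Delta> x)) = blinfun_apply p (f x)"
      using push_augmented[OF x, of p "f x"] augmented(3)[OF x] by simp
    moreover have "V (\<Delta> x) = V x" using invV x by (simp add: invariant_potential_def)
    ultimately have "H (\<Delta> x, push x p) = H (x, p)"
      using h guard_carrier[OF x] by simp
    then have "multiplier x p = 0" by (simp add: multiplier_def)
    then have "extended_reset (x, p) = (\<Delta> x, push x p)"
      by (simp add: extended_reset_def reset_momentum_def)
    then show ?thesis using D[unfolded solves_iff] x by simp
  qed
  let ?S = "\<Sigma> \<times> (UNIV :: ('a \<Rightarrow>\<^sub>L real) set)" and ?T = "\<Delta> ` \<Sigma> \<times> (UNIV :: ('a \<Rightarrow>\<^sub>L real) set)"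
  have injD: "inj_on D ?S"
  proof (rule inj_onI)
    fix z z' assume z: "z \<in> ?S" "z' \<in> ?S" "D z = D z'"
    obtain x p x' p' where 1: "z = (x, p)" "z' = (x', p')" "x \<in> \<Sigma>" "x' \<in> \<Sigma>" using z(1,2) by auto
    have "\<Delta> x = \<Delta> x'" using z(3) 1 D_eq by simp
    then have xx: "x = x'" using inj_onD[OF \<Delta>inj] 1 by blast
    then have "push x p = push x p'" using z(3) 1 D_eq by simp
    then have "p = p'" using push_pull(2)[OF 1(3)] by metis
    then show "z = z'" using 1 xx by simp
  qed
  have imD: "D ` ?S = ?T"
  proof
    show "D ` ?S \<subseteq> ?T" using D_eq by auto
    show "?T \<subseteq> D ` ?S"
    proof
      fix w assume "w \<in> ?T"
      then obtain x q where w: "w = (\<Delta> x, q)" "x \<in> \<Sigma>" by auto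
      then have "w = D (x, pull x q)" using D_eq push_pull(1) by simp
      then show "w \<in> D ` ?S" using w(2) by blast
    qed
  qed
  have invD: "inv_into ?S D (\<Delta> x, q) = (x, pull x q)" if x: "x \<in> \<Sigma>" for x q
    by (rule inv_into_f_eq[OF injD]) (use x D_eq push_pull(1) in auto)
  have "smooth_map_on (cotangent M) (cotangent M) ?T (inv_into ?S D)"
  proof (rule smooth_map_onI)
    fix w assume "w \<in> ?T"
    then obtain x0 q0 where w: "w = (\<Delta> x0, q0)" and x0: "x0 \<in> \<Sigma>" by auto
    obtain c c' W g where 1: "x0 \<in> fst c" "snd c x0 \<in> W" "local_rep M M \<Sigma> \<Delta> c c' W g"
      using \<Delta> x0 unfolding smooth_map_on_iff_local_rep by meson
    note gD = local_repD[OF 1(3)]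
    let ?A = "A_rep c c' g"
    obtain W' where W': "open W'" "snd c x0 \<in> W'" "W' \<subseteq> W" "g ` W' \<subseteq> snd c' ` fst c'"
      "\<And>\<xi>. \<xi> \<in> W' \<Longrightarrow> linear (?A \<xi>)" "\<And>\<xi>. \<xi> \<in> W' \<Longrightarrow> bij (?A \<xi>)"
      "\<And>v. C_inf (\<lambda>\<xi>. ?A \<xi> v) W'"
      "\<And>x v. x \<in> \<Sigma> \<Longrightarrow> x \<in> fst c \<Longrightarrow> snd c x \<in> W' \<Longrightarrow>
        \<A> x (coord_vector M c x v) = coord_vector M c' (\<Delta> x) (?A (snd c x) v)"
      by (rule A_rep[OF x0 1(1,2,3)]) (rule that)
    obtain X k where k: "open X" "snd c' (\<Delta> x0) \<in> X" "C_inf k X" "k ` X \<subseteq> W'"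
      "\<And>y. y \<in> \<Sigma> \<Longrightarrow> \<Delta> y \<in> fst c' \<Longrightarrow> snd c' (\<Delta> y) \<in> X \<Longrightarrow> y \<in> fst c \<and> snd c y = k (snd c' (\<Delta> y))"
      by (rule local_inverse[OF emb' x0 1(1) W'(2,1,3) 1(3) bij_is_inj[OF W'(6)[OF W'(2)]]]) (rule that)
    let ?X = "X \<times> (UNIV :: 'a set)"
    have oX: "open ?X" using k(1) by (simp add: open_Times)
    have k1: "C_inf (\<lambda>z. k (fst z)) ?X"
      by (rule C_inf_compose[OF oX k(1,3) C_inf_fst[OF oX C_inf_id]]) auto
    \<comment> \<open>The inverse bundle map in charts: \<open>k\<close> recovers the base point,
      and the transpose of \<open>A_rep\<close> at that point acts on the momentum.\<close>
    define \<rho> where "\<rho> = (\<lambda>z. (k (fst z), \<Sum>b\<in>Basis. (snd z \<bullet> ?A (k (fst z)) b) *\<^sub>R b))"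
    have s: "C_inf \<rho> ?X" unfolding \<rho>_def
      by (intro C_inf_Pair C_inf_sum C_inf_scaleR C_inf_inner C_inf_snd C_inf_id C_inf_const oX k1
          C_inf_compose[OF oX W'(1) W'(7) k1]) (use k(4) in auto)
    have "inv_into ?S D y \<in> fst (cot_chart M c) \<and>
        snd (cot_chart M c) (inv_into ?S D y) = \<rho> (snd (cot_chart M c') y)"
      if y: "y \<in> fst (cot_chart M c')" "y \<in> ?T" "snd (cot_chart M c') y \<in> ?X" for y
    proof -
      obtain x q where yx: "y = (\<Delta> x, q)" "x \<in> \<Sigma>" using y(2) by auto
      have \<Delta>x: "\<Delta> x \<in> fst c'" "snd c' (\<Delta> x) \<in> X" using y by (auto simp: yx)
      have x: "x \<in> fst c" "snd c x = k (snd c' (\<Delta> x))" using k(5)[OF yx(2) \<Delta>x] by auto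
      have xW: "snd c x \<in> W'" using x(2) k(4) \<Delta>x(2) by auto
      have "comps M c x (pull x q) = (\<Sum>b\<in>Basis. (comps M c' (\<Delta> x) q \<bullet> ?A (snd c x) b) *\<^sub>R b)"
        by (simp add: comps_def[of M c] pull[OF yx(2)] W'(8)[OF yx(2) x(1) xW] comps_inner[OF M gD(2) \<Delta>x(1)])
      then show ?thesis using x by (simp add: yx(1) invD[OF yx(2)] \<rho>_def)
    qed
    then show "smooth_at (cotangent M) (cotangent M) ?T (inv_into ?S D) w"
      using gD(6)[OF 1(1) x0 1(2)] k(2)
      by (intro smooth_atI[OF smooth_atlas_cotangent[OF M] cot_chart_in[OF gD(2)] _ cot_chart_in[OF gD(1)] oX _ s])
         (auto simp: w)
  qed
  moreover have "\<exists>L. linear L \<and> bij L \<and> (\<forall>p. D (x, p) = (\<Delta> x, L p))" if x: "x \<in> \<Sigma>" for x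
  proof (intro exI[of _ "push x"] conjI allI)
    show "linear (push x)"
      unfolding push_def[abs_def]
      by (rule bounded_linear.linear[OF bounded_bilinear.bounded_linear_left[OF bounded_bilinear_blinfun_compose]])
    show "bij (push x)"
      by (rule o_bij[of "pull x"]) (simp_all add: fun_eq_iff push_pull[OF x])
    show "D (x, p) = (\<Delta> x, push x p)" for p by (rule D_eq[OF x])
  qed
  ultimately show ?thesis
    using D injD imD by (auto simp: linear_bundle_iso_def solves_extended_reset_def bij_betw_def)
qed

end

section \<open>Mechanical systems with impacts\<close>

lemma open_real_zeroE:
  assumes "open U" "(0::real) \<in> U"
  obtains e where "e > 0" "\<And>t. \<bar>t\<bar> < e \<Longrightarrow> t \<in> U"
  using assms unfolding open_dist dist_real_def by (metis diff_0_right)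

text \<open>Nondegeneracy of the symplectic form, which gives meaning to the definite descriptions
  in \<open>ham_vector_field\<close> and \<open>controlled_field\<close>.\<close>

lemma symplectic_dual:
  assumes "linear \<l>"
  shows "symplectic_form A z (THE X. \<forall>w. symplectic_form A z X w = \<l> w) w = \<l> w"
proof -
  let ?P = "\<lambda>X. \<forall>w. symplectic_form A z X w = \<l> w"
  have l1: "linear (\<lambda>v. \<l> (0, v))" and l2: "linear (\<lambda>v. \<l> (v, 0))"
    using linear_compose[OF _ assms, of "\<lambda>v. (0, v)"] linear_compose[OF _ assms, of "\<lambda>v. (v, 0)"]
    by (simp_all add: comp_def linear_iff)
  define X0 where "X0 = (\<Sum>b\<in>Basis. \<l> (0, b) *\<^sub>R b, - (\<Sum>b\<in>Basis. \<l> (b, 0) *\<^sub>R b))"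
  have X0: "?P X0"
  proof
    fix w
    have "\<l> w = \<l> (0, snd w) + \<l> (fst w, 0)" using linear_add[OF assms, of "(0, snd w)" "(fst w, 0)"] by simp
    then show "symplectic_form A z X0 w = \<l> w"
      using inner_sum_Basis_linear[OF l1, of "snd w"] inner_sum_Basis_linear[OF l2, of "fst w"]
      by (simp add: symplectic_form_def X0_def inner_commute)
  qed
  have "X = X0" if X: "?P X" for X
  proof -
    have e: "symplectic_form A z X w = symplectic_form A z X0 w" for w using X X0 by metis
    have "fst X \<bullet> v = fst X0 \<bullet> v" "v \<bullet> snd X = v \<bullet> snd X0" for v
      using e[of "(0, v)"] e[of "(v, 0)"] by (simp_all add: symplectic_form_def)
    then have "fst X = fst X0" "snd X = snd X0" by (metis vector_eq_rdot, metis vector_eq_ldot)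
    then show ?thesis by (simp add: prod_eq_iff)
  qed
  from theI[of ?P, OF X0 this] show ?thesis by blast
qed

text \<open>The second claim is Hamilton's equation for positions: pairing \<theta> with the base
  velocity of the Hamiltonian field is the derivative of \<open>K\<close> in the fibre direction
  \<theta>. It is used on two levels, for \<open>G\<close> over the configuration space and for
  \<open>H\<close> over the phase space.\<close>

lemma
  assumes A: "smooth_atlas A" and K: "smooth_map_on (cotangent A) euc (mcarrier (cotangent A)) K"
    and z: "z \<in> mcarrier (cotangent A)"
  shows symplectic_ham_vector_field:
      "symplectic_form A z (ham_vector_field A K z) w = diff_fun (cotangent A) K z w"
    and ham_vector_field_fibre_derivative:
      "((\<lambda>s. K (fst z, snd z + s *\<^sub>R \<theta>)) has_real_derivative
         blinfun_apply \<theta> (mderiv (cotangent A) A fst z (ham_vector_field A K z))) (at 0)"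
proof -
  let ?N = "cotangent A"
  note N = smooth_atlas_cotangent[OF A]
  show *: "symplectic_form A z (ham_vector_field A K z) w = diff_fun ?N K z w" for w
    unfolding ham_vector_field_def
    by (rule symplectic_dual) (use bounded_linear.linear[OF diff_fun_linear[OF N K z]] in simp)
  obtain c where c: "c \<in> A" "fst z \<in> fst c" "chart_at ?N z = cot_chart A c"
    using chart_at_cotangent[OF z] .
  have J: "coord_vector ?N (cot_chart A c) z = (\<lambda>v. v)"
    using coord_vector_chart_at[OF N z] c(3) by simp
  let ?X = "ham_vector_field A K z" and ?n = "comps A c (fst z) \<theta>"
  have zc: "z \<in> fst (cot_chart A c)" using c(2) by (simp add: mem_Times_iff)
  have "blinfun_apply \<theta> (mderiv ?N A fst z ?X) = ?n \<bullet> fst ?X"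
    using mderiv_fst_cotangent[OF A c(1,2), of ?X] by (simp add: J comps_inner[OF A c(1,2)])
  also have "\<dots> = diff_fun ?N K z (0, ?n)"
    using *[of "(0, ?n)"] by (simp add: symplectic_form_def inner_commute)
  also have "\<dots> = frechet_derivative (cot_rep A K c) (at (snd c (fst z), comps A c (fst z) (snd z))) (0, ?n)"
    using diff_fun_chart[OF N K cot_chart_in[OF c(1)] zc, of "(0, ?n)"] unfolding J cot_rep_def[abs_def] by simp
  finally show "((\<lambda>s. K (fst z, snd z + s *\<^sub>R \<theta>)) has_real_derivative
         blinfun_apply \<theta> (mderiv ?N A fst z ?X)) (at 0)"
    using cot_rep_fibre_derivative[OF A K c(1,2), of "snd z" \<theta>] by simp
qed

section \<open>The guard of a mechanical system, its tangent spaces and the reset\<close>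

locale mechanical_system =
  fixes Q :: "('q, 'a::euclidean_space) atlas" and G :: "('q, 'a) phase \<Rightarrow> real" and h :: "'q \<Rightarrow> real"
  assumes Q: "smooth_atlas Q"
    and G: "smooth_map_on (cotangent Q) euc (mcarrier (cotangent Q)) G"
    and h: "smooth_map_on Q euc (mcarrier Q) h"
    and S: "embedded_submanifold Q 1 (impact_location Q h)"
begin

abbreviation "M \<equiv> cotangent Q"
abbreviation "S \<equiv> impact_location Q h"
abbreviation "\<Sigma> \<equiv> guard Q G h"

lemmas M = smooth_atlas_cotangent[OF Q]

definition \<eta> :: "('q, 'a) phase \<Rightarrow> real" where
  "\<eta> x = h (fst x)"

definition dh :: "'q \<Rightarrow> 'a \<Rightarrow>\<^sub>L real" where
  "dh q = Blinfun (diff_fun Q h q)"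

definition rate :: "('q, 'a) phase \<Rightarrow> real" where
  "rate x = pullback M Q fst (diff_fun Q h) x (ham_vector_field Q G x)"

lemma fst_carrier: "x \<in> mcarrier M \<Longrightarrow> fst x \<in> mcarrier Q"
  by (auto simp: mcarrier_cotangent)

lemma dh: "q \<in> mcarrier Q \<Longrightarrow> blinfun_apply (dh q) v = diff_fun Q h q v"
  by (simp add: dh_def bounded_linear_Blinfun_apply diff_fun_linear[OF Q h])

lemma \<eta>: "smooth_map_on M euc (mcarrier M) \<eta>"
  unfolding \<eta>_def
  by (rule smooth_map_on_compose[OF M Q smooth_atlas_euc smooth_map_on_fst_cotangent[OF Q] h])
     (use fst_carrier in blast)

lemma mdifferentiable_fst: "x \<in> mcarrier M \<Longrightarrow> mdifferentiable M Q fst x"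
  by (rule smooth_map_on_carrier_mdifferentiable[OF M Q smooth_map_on_fst_cotangent[OF Q]])

lemma diff_fun_\<eta>:
  assumes x: "x \<in> mcarrier M"
  shows "diff_fun M \<eta> x v = diff_fun Q h (fst x) (mderiv M Q fst x v)"
  using mderiv_compose[OF M Q smooth_atlas_euc mdifferentiable_fst[OF x]
      smooth_map_on_carrier_mdifferentiable[OF Q smooth_atlas_euc h fst_carrier[OF x]]]
  by (simp add: diff_fun_def \<eta>_def[abs_def])

lemma rate_eq:
  assumes x: "x \<in> mcarrier M"
  shows "rate x = diff_fun M \<eta> x (ham_vector_field Q G x)"
  by (simp add: rate_def pullback_def diff_fun_\<eta>[OF x])

lemma rate_fibre_derivative:
  assumes x: "x \<in> mcarrier M"
  shows "((\<lambda>s. G (fst x, snd x + s *\<^sub>R dh (fst x))) has_real_derivative rate x) (at 0)"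
  using ham_vector_field_fibre_derivative[OF Q G x, of "dh (fst x)"]
  by (simp add: rate_def pullback_def dh[OF fst_carrier[OF x]])

lemma comps_dh:
  assumes c: "c \<in> Q" "q \<in> fst c"
  shows "comps Q c q (dh q) = (\<Sum>b\<in>Basis. frechet_derivative (\<lambda>\<xi>. h (cinv c \<xi>)) (at (snd c q)) b *\<^sub>R b)"
  by (simp add: comps_def dh[OF mcarrierI[OF c]] diff_fun_chart[OF Q h c])

text \<open>\<open>rate\<close> in a natural chart, as the fibre derivative of \<open>G\<close> in
  the direction dh. This form avoids the definite description in \<open>ham_vector_field\<close> and
  is visibly continuous, which makes the guard relatively open.\<close>

definition rate_rep :: "('q, 'a) chart \<Rightarrow> 'a \<times> 'a \<Rightarrow> real" where
  "rate_rep c z = frechet_derivative (cot_rep Q G c) (at z)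
     (0, \<Sum>b\<in>Basis. frechet_derivative (\<lambda>\<xi>. h (cinv c \<xi>)) (at (fst z)) b *\<^sub>R b)"

lemma rate_rep:
  assumes c: "c \<in> Q" "q \<in> fst c"
  shows "rate (q, y) = rate_rep c (snd c q, comps Q c q y)"
proof -
  have "(q, y) \<in> mcarrier M" using mcarrierI[OF c] by (simp add: mcarrier_cotangent)
  from DERIV_unique[OF rate_fibre_derivative[OF this, simplified] cot_rep_fibre_derivative[OF Q G c, of y "dh q"]]
  show ?thesis by (simp add: rate_rep_def comps_dh[OF c])
qed

lemma continuous_on_rate_rep:
  assumes c: "c \<in> Q"
  shows "continuous_on (snd c ` fst c \<times> UNIV) (rate_rep c)"
proof -
  note o = smooth_atlas_open[OF Q c]
  have o': "open (snd c ` fst c \<times> (UNIV :: 'a set))" using o by (simp add: open_Times)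
  have "C_inf (rate_rep c) (snd c ` fst c \<times> UNIV)"
    unfolding rate_rep_def[abs_def]
    by (intro C_inf_frechet_apply[OF o' o' C_inf_cot_rep[OF Q G c]] C_inf_Pair C_inf_sum C_inf_scaleR
        C_inf_const C_inf_id o' C_inf_compose[OF o' o C_inf_frechet_derivative[OF smooth_function_chart[OF Q h c] o]]
        C_inf_fst) auto
  then show ?thesis by (rule C_inf_continuous_on)
qed

lemma guard_iff: "x \<in> \<Sigma> \<longleftrightarrow> x \<in> mcarrier M \<and> fst x \<in> S \<and> rate x > 0"
  by (simp add: guard_def rate_def)

text \<open>The guard is open in the part of the phase space over \<open>S\<close>, so a curve over \<open>S\<close> that
  starts in the guard stays there for some time.\<close>

lemma guard_curve:
  assumes x: "x \<in> \<Sigma>" and c: "c \<in> Q" "fst x \<in> fst c" and e: "e > 0"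
    and \<gamma>: "\<And>t. \<bar>t\<bar> < e \<Longrightarrow> fst (\<gamma> t) \<in> fst c \<inter> S \<and> snd (cot_chart Q c) (\<gamma> t) = \<kappa> t"
    and \<gamma>0: "\<gamma> 0 = x" and \<kappa>: "C_inf \<kappa> {-e<..<e}" "(\<kappa> has_vector_derivative w) (at 0)"
  obtains d where "d > 0" "d \<le> e" "\<And>t. \<bar>t\<bar> < d \<Longrightarrow> \<gamma> t \<in> \<Sigma>"
    "curve_through M \<Sigma> x (coord_vector M (cot_chart Q c) x w) \<gamma>"
proof -
  have \<gamma>R: "rate (\<gamma> t) = rate_rep c (\<kappa> t)" "\<kappa> t \<in> snd c ` fst c \<times> UNIV" if "\<bar>t\<bar> < e" for t
  proof -
    have e: "\<kappa> t = (snd c (fst (\<gamma> t)), comps Q c (fst (\<gamma> t)) (snd (\<gamma> t)))" using \<gamma>[OF that] by simp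
    then show "\<kappa> t \<in> snd c ` fst c \<times> UNIV" using \<gamma>[OF that] by simp
    show "rate (\<gamma> t) = rate_rep c (\<kappa> t)"
      using \<gamma>[OF that] rate_rep[OF c(1), of "fst (\<gamma> t)" "snd (\<gamma> t)"] e by simp
  qed
  have o: "open {-e<..<e}" by simp
  have "continuous_on {-e<..<e} (\<lambda>t. rate_rep c (\<kappa> t))"
    by (rule continuous_on_compose2[OF continuous_on_rate_rep[OF c(1)] C_inf_continuous_on[OF \<kappa>(1)]])
       (rule image_subsetI, rule \<gamma>R(2), auto)
  from continuous_open_preimage[OF this o open_greaterThan[of 0]]
  have "open ({-e<..<e} \<inter> (\<lambda>t. rate_rep c (\<kappa> t)) -` {0<..})" .
  moreover have "0 \<in> {-e<..<e} \<inter> (\<lambda>t. rate_rep c (\<kappa> t)) -` {0<..}"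
    using e \<gamma>R(1)[of 0] \<gamma>0 x by (simp add: guard_iff)
  ultimately obtain d0 where d0: "d0 > 0" "\<And>t. \<bar>t\<bar> < d0 \<Longrightarrow> \<bar>t\<bar> < e \<and> rate_rep c (\<kappa> t) > 0"
    by (rule open_real_zeroE) (rule that, assumption, auto)
  define d where "d = min d0 e"
  have d: "d > 0" "d \<le> e" using d0 e by (auto simp: d_def)
  have \<Sigma>: "\<gamma> t \<in> \<Sigma>" if "\<bar>t\<bar> < d" for t
  proof -
    have t: "\<bar>t\<bar> < d0" "\<bar>t\<bar> < e" using that by (auto simp: d_def)
    have "\<gamma> t \<in> mcarrier M" using \<gamma>[OF t(2)] mcarrierI[OF c(1)] by (auto simp: mcarrier_cotangent mem_Times_iff)
    then show ?thesis using \<gamma>[OF t(2)] \<gamma>R(1)[OF t(2)] d0(2)[OF t(1)] by (simp add: guard_iff)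
  qed
  have "curve_through M \<Sigma> (\<gamma> 0) (coord_vector M (cot_chart Q c) (\<gamma> 0) w) \<gamma>"
  proof (rule curve_throughI[OF M cot_chart_in[OF c(1)] d(1) C_inf_subset[OF \<kappa>(1)] _ \<kappa>(2)])
    show "{-d<..<d} \<subseteq> {-e<..<e}" using d by auto
    show "\<gamma> t \<in> fst (cot_chart Q c) \<inter> \<Sigma> \<and> snd (cot_chart Q c) (\<gamma> t) = \<kappa> t" if "\<bar>t\<bar> < d" for t
      using \<gamma>[of t] \<Sigma>[OF that] that d by (simp add: mem_Times_iff)
  qed
  then show ?thesis using that[OF d \<Sigma>] \<gamma>0 by simp
qed

text \<open>The positive rate in the definition of the guard is a value of dh at the impact
  position.\<close>

lemma dh_nonzero: "x \<in> \<Sigma> \<Longrightarrow> dh (fst x) \<noteq> 0"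
proof
  assume x: "x \<in> \<Sigma>" and "dh (fst x) = 0"
  then have "diff_fun Q h (fst x) v = 0" for v
    using dh[OF fst_carrier, of x v] by (simp add: guard_iff)
  then show False using x by (simp add: guard_iff rate_def pullback_def)
qed

text \<open>Straight lines in a slice chart give curves in \<open>S\<close> whose velocities fill a
  subspace of codimension 1. Since h is 0 on \<open>S\<close>, this subspace lies in the kernel of
  dh, which has codimension at least 1 because dh is nonzero; so the two coincide and every kernel
  vector is a velocity.\<close>

lemma impact_curve:
  assumes q: "q \<in> S" and u: "blinfun_apply (dh q) u = 0" "dh q \<noteq> 0"
  obtains e :: real and \<sigma> where "e > 0" "smooth_map_on euc Q {-e<..<e} \<sigma>" "\<sigma> 0 = q"
    "\<And>t. \<bar>t\<bar> < e \<Longrightarrow> \<sigma> t \<in> S" "mderiv euc Q \<sigma> 0 1 = u"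
proof -
  note E = smooth_atlas_euc
  have qQ: "q \<in> mcarrier Q" using q by (simp add: impact_location_def)
  obtain D \<phi> Y where comp: "compatible_chart Q (D, \<phi>)" and D: "q \<in> D" and Y: "subspace Y" "dim Y + 1 = DIM('a)"
    and slice: "\<phi> ` (D \<inter> S) = \<phi> ` D \<inter> Y"
    using S q unfolding embedded_submanifold_def by blast
  have cD: "openin (mtopology Q) D" "inj_on \<phi> D" "open (\<phi> ` D)"
    "smooth_map_on Q euc D \<phi>" "smooth_map_on euc Q (\<phi> ` D) (inv_into D \<phi>)"
    using comp by (auto simp: compatible_chart_def)
  let ?\<psi> = "inv_into D \<phi>" and ?\<xi> = "\<phi> q"
  have \<psi>q: "?\<psi> ?\<xi> = q" using cD(2) D by simp
  have \<xi>D: "?\<xi> \<in> \<phi> ` D" using D by simp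
  have \<xi>Y: "?\<xi> \<in> Y" using slice D q by blast
  have d\<psi>: "mdifferentiable euc Q ?\<psi> ?\<xi>"
    by (rule smooth_map_on_mdifferentiable[OF E Q cD(5) \<xi>D])
       (use eventually_nhds_in_open[OF cD(3) \<xi>D] in \<open>auto simp: euc_def\<close>)
  have "\<forall>\<^sub>F \<xi> in nhds (snd c q). cinv c \<xi> \<in> D" if c: "c \<in> Q" "q \<in> fst c" for c
  proof -
    have "snd c q \<in> snd c ` (D \<inter> fst c)" using c(2) D by blast
    from eventually_nhds_in_open[OF openin_chart_image[OF Q c(1) cD(1)] this]
    show ?thesis by eventually_elim (use smooth_atlas_cinv[OF Q c(1)] in auto)
  qed
  then have d\<phi>: "mdifferentiable Q euc \<phi> (?\<psi> ?\<xi>)"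
    unfolding \<psi>q by (rule smooth_map_on_mdifferentiable[OF Q E cD(4) D])
  define L where "L = mderiv euc Q ?\<psi> ?\<xi>"
  have L: "linear L" unfolding L_def by (rule linear_mderiv[OF E Q d\<psi>])
  \<comment> \<open>The chart is a differentiable left inverse of its own inverse, and the chain
    rule turns this into a left inverse of \<open>L\<close>.\<close>
  have "inj L"
  proof -
    have "has_diff (UNIV, \<lambda>x. x) (UNIV, \<lambda>x. x) (\<lambda>x::'a. x) ?\<xi> (\<lambda>v. v)"
      using has_diff_ident[OF E euc_chart] by simp
    from mderiv_cong[OF E E this euc_chart euc_chart, of "\<lambda>\<xi>. \<phi> (?\<psi> \<xi>)"] mderiv_eq[OF E E euc_chart euc_chart this]
    have "mderiv euc euc (\<lambda>\<xi>. \<phi> (?\<psi> \<xi>)) ?\<xi> v = v" for v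
      using eventually_mono[OF eventually_nhds_in_open[OF cD(3) \<xi>D], of "\<lambda>\<xi>. \<xi> = \<phi> (?\<psi> \<xi>)"] f_inv_into_f[of _ \<phi> D]
      by simp
    then have "mderiv Q euc \<phi> (?\<psi> ?\<xi>) (L v) = v" for v
      unfolding L_def using mderiv_compose[OF E Q E d\<psi> d\<phi>] by metis
    then show ?thesis by (rule inj_on_inverseI)
  qed
  have curve: "\<exists>e>0. smooth_map_on euc Q {-e<..<e} (\<lambda>t. ?\<psi> (?\<xi> + t *\<^sub>R w)) \<and>
      (\<forall>t. \<bar>t\<bar> < e \<longrightarrow> ?\<psi> (?\<xi> + t *\<^sub>R w) \<in> S) \<and> mderiv euc Q (\<lambda>t. ?\<psi> (?\<xi> + t *\<^sub>R w)) 0 1 = L w \<and>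
      mdifferentiable euc Q (\<lambda>t. ?\<psi> (?\<xi> + t *\<^sub>R w)) 0"
    if w: "w \<in> Y" for w
  proof -
    have "open ((\<lambda>t::real. ?\<xi> + t *\<^sub>R w) -` \<phi> ` D)"
      by (rule open_vimage[OF cD(3)]) (intro continuous_intros)
    moreover have "0 \<in> (\<lambda>t::real. ?\<xi> + t *\<^sub>R w) -` \<phi> ` D" using \<xi>D by simp
    ultimately obtain e where e: "e > 0" "\<And>t. \<bar>t\<bar> < e \<Longrightarrow> ?\<xi> + t *\<^sub>R w \<in> \<phi> ` D"
      by (rule open_real_zeroE) (rule that, assumption, blast)
    have lin: "smooth_map_on euc euc X (\<lambda>t::real. ?\<xi> + t *\<^sub>R w)" for X
      by (intro smooth_map_on_euc C_inf_add C_inf_scaleR C_inf_const C_inf_id open_UNIV)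
    have 1: "smooth_map_on euc Q {-e<..<e} (\<lambda>t. ?\<psi> (?\<xi> + t *\<^sub>R w))"
      by (rule smooth_map_on_compose[OF E E Q lin cD(5)]) (use e(2) in auto)
    have 2: "?\<psi> (?\<xi> + t *\<^sub>R w) \<in> S" if t: "\<bar>t\<bar> < e" for t
    proof -
      have "?\<xi> + t *\<^sub>R w \<in> Y" using \<xi>Y w Y(1) by (intro subspace_add subspace_scale)
      then have "?\<xi> + t *\<^sub>R w \<in> \<phi> ` (D \<inter> S)" using e(2)[OF t] slice by blast
      then obtain s where "s \<in> D" "s \<in> S" "?\<xi> + t *\<^sub>R w = \<phi> s" by blast
      then show ?thesis using cD(2) by simp
    qed
    have "((\<lambda>t::real. ?\<xi> + t *\<^sub>R w) has_vector_derivative w) (at 0)"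
      by (auto intro!: derivative_eq_intros)
    with mderiv_curve[OF E euc_chart, of "\<lambda>t. ?\<xi> + t *\<^sub>R w" 0 w]
    have d: "mdifferentiable euc euc (\<lambda>t::real. ?\<xi> + t *\<^sub>R w) 0"
      "mderiv euc euc (\<lambda>t::real. ?\<xi> + t *\<^sub>R w) 0 1 = w" by auto
    have d\<psi>': "mdifferentiable euc Q ?\<psi> (?\<xi> + 0 *\<^sub>R w)" using d\<psi> by simp
    have "mderiv euc Q (\<lambda>t. ?\<psi> (?\<xi> + t *\<^sub>R w)) 0 1 = L w"
      using mderiv_compose[OF E E Q d(1) d\<psi>', of 1] d(2) by (simp add: L_def)
    then show ?thesis using e(1) 1 2 mdifferentiable_compose[OF E E Q d(1) d\<psi>'] by blast
  qed
  let ?K = "{v. blinfun_apply (dh q) v = 0}"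
  have K: "subspace ?K" by (auto simp: subspace_def blinfun.add_right blinfun.scaleR_right)
  have sub: "L ` Y \<subseteq> ?K"
  proof (rule image_subsetI)
    fix w assume w: "w \<in> Y"
    obtain e where e: "e > 0" "\<And>t. \<bar>t\<bar> < e \<Longrightarrow> ?\<psi> (?\<xi> + t *\<^sub>R w) \<in> S"
      "mderiv euc Q (\<lambda>t. ?\<psi> (?\<xi> + t *\<^sub>R w)) 0 1 = L w" "mdifferentiable euc Q (\<lambda>t. ?\<psi> (?\<xi> + t *\<^sub>R w)) 0"
      using curve[OF w] by blast
    have "\<forall>\<^sub>F t in nhds 0. t \<in> {-e<..<e}" using e(1) by (intro eventually_nhds_in_open) auto
    then have "\<forall>\<^sub>F t in nhds 0. h (?\<psi> (?\<xi> + t *\<^sub>R w)) = 0"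
      by eventually_elim (use e(2) in \<open>auto simp: impact_location_def\<close>)
    from curve_tangent[OF Q h qQ e(4) _ this] show "L w \<in> ?K" using e(3) \<psi>q by (simp add: dh[OF qQ])
  qed
  have "dim ?K < DIM('a)"
  proof -
    obtain v where "blinfun_apply (dh q) v \<noteq> 0" using u(2) by (metis blinfun_eqI zero_blinfun.rep_eq)
    then have "?K \<noteq> UNIV" by blast
    then show ?thesis using dim_subset_UNIV[of ?K] K by (metis dim_eq_full le_neq_implies_less span_eq_iff)
  qed
  moreover have "dim (L ` Y) = dim Y" by (rule dim_image_eq[OF L]) (use \<open>inj L\<close> in \<open>auto simp: inj_on_def\<close>)
  ultimately have "L ` Y = ?K"
    using Y by (intro subspace_dim_equal[OF linear_subspace_image[OF L Y(1)] K sub]) simp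
  then obtain w where w: "w \<in> Y" "u = L w" using u(1) by blast
  obtain e where "e > 0" "smooth_map_on euc Q {-e<..<e} (\<lambda>t. ?\<psi> (?\<xi> + t *\<^sub>R w))"
      "\<And>t. \<bar>t\<bar> < e \<Longrightarrow> ?\<psi> (?\<xi> + t *\<^sub>R w) \<in> S" "mderiv euc Q (\<lambda>t. ?\<psi> (?\<xi> + t *\<^sub>R w)) 0 1 = L w"
    using curve[OF w(1)] by blast
  then show ?thesis using that[of e "\<lambda>t. ?\<psi> (?\<xi> + t *\<^sub>R w)"] \<psi>q w(2) by simp
qed

text \<open>For the harder inclusion, the base part of \<open>v\<close> is realised by a curve in
  \<open>S\<close> and the momentum part by a straight line in the natural chart.
  \<open>guard_curve\<close> keeps the combined curve in the guard.\<close>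

lemma tangent_guard:
  assumes x: "x \<in> \<Sigma>"
  shows "tangent_space M \<Sigma> x = {v. diff_fun M \<eta> x v = 0}"
proof (intro equalityI subsetI CollectI)
  have xM: "x \<in> mcarrier M" and xS: "fst x \<in> S" using x by (auto simp: guard_iff)
  {
    fix v assume "v \<in> tangent_space M \<Sigma> x"
    then obtain \<gamma> where \<gamma>: "curve_through M \<Sigma> x v \<gamma>" by (auto simp: tangent_space_def)
    note \<gamma>D = curve_throughD[OF M \<gamma>]
    have "\<forall>\<^sub>F t in nhds 0. \<eta> (\<gamma> t) = 0"
      using \<gamma>D(4) by eventually_elim (simp add: guard_iff impact_location_def \<eta>_def)
    from curve_tangent[OF M \<eta> xM \<gamma>D(1,2) this] show "diff_fun M \<eta> x v = 0" using \<gamma>D(3) by simp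
  }
  fix v assume "v \<in> {v. diff_fun M \<eta> x v = 0}"
  then have v: "diff_fun M \<eta> x v = 0" by simp
  obtain q y where xq: "x = (q, y)" by (cases x)
  have qQ: "q \<in> mcarrier Q" using fst_carrier[OF xM] xq by simp
  define c where "c = chart_at Q q"
  have c: "c \<in> Q" "q \<in> fst c" using chart_at[OF qQ] by (simp_all add: c_def)
  obtain w where w: "v = coord_vector M (cot_chart Q c) x w"
    using coord_vector_inverse(1)[OF M cot_chart_in[OF c(1)], of x] c(2) xq by (metis cot_chart_simps(1) mem_Times_iff UNIV_I fst_conv)
  define u where "u = coord_vector Q c q (fst w)"
  have "mderiv M Q fst x v = u"
    using mderiv_fst_cotangent[OF Q c(1), of x w] c(2) by (simp add: w u_def xq)
  then have u0: "blinfun_apply (dh q) u = 0" using v diff_fun_\<eta>[OF xM, of v] by (simp add: dh[OF qQ] xq)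
  have "dh q \<noteq> 0" "q \<in> S" using dh_nonzero[OF x] xS xq by auto
  note curve = impact_curve[OF this(2) u0 this(1)]
  obtain e :: real and \<sigma> where \<sigma>: "e > 0" "smooth_map_on euc Q {-e<..<e} \<sigma>" "\<sigma> 0 = q"
    "\<And>t. \<bar>t\<bar> < e \<Longrightarrow> \<sigma> t \<in> S" "mderiv euc Q \<sigma> 0 1 = u"
    by (rule curve) (rule that)
  have z0: "0 \<in> {-e<..<e}" using \<sigma>(1) by simp
  obtain W g where W: "local_rep euc Q {-e<..<e} \<sigma> (UNIV, \<lambda>t. t) c W g" "snd (UNIV :: real set, \<lambda>t::real. t) 0 \<in> W"
    by (rule smooth_map_on_charts[OF smooth_atlas_euc Q \<sigma>(2) z0 euc_chart _ c(1)]) (use c(2) \<sigma>(3) in auto)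
  note g = local_repD[OF W(1)]
  obtain r0 where r0: "r0 > 0" "\<And>t. \<bar>t\<bar> < r0 \<Longrightarrow> t \<in> W"
    using open_real_zeroE[OF g(3)] W(2) by auto
  define r where "r = min r0 e"
  have r: "r > 0" "\<And>t. \<bar>t\<bar> < r \<Longrightarrow> t \<in> W \<and> \<bar>t\<bar> < e" using r0 \<sigma>(1) by (auto simp: r_def)
  have rW: "{-r<..<r} \<subseteq> W" using r(2) by auto
  have \<sigma>c: "\<sigma> t \<in> fst c" "snd c (\<sigma> t) = g t" if "\<bar>t\<bar> < r" for t
    using g(6,7)[of t] r(2)[OF that] by (auto simp: abs_less_iff)
  define \<gamma> where "\<gamma> = (\<lambda>t. (\<sigma> t, covec Q c (\<sigma> t) (comps Q c q y + t *\<^sub>R snd w)))"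
  define \<kappa> where "\<kappa> = (\<lambda>t. (g t, comps Q c q y + t *\<^sub>R snd w))"
  have \<gamma>0: "\<gamma> 0 = x" using \<sigma>(3) covec_comps[OF Q c] by (simp add: \<gamma>_def xq)
  have \<gamma>\<kappa>: "fst (\<gamma> t) \<in> fst c \<inter> S \<and> snd (cot_chart Q c) (\<gamma> t) = \<kappa> t" if "\<bar>t\<bar> < r" for t
    using \<sigma>c[OF that] \<sigma>(4) r(2)[OF that] comps_covec[OF Q c(1)] by (simp add: \<gamma>_def \<kappa>_def)
  have \<kappa>s: "C_inf \<kappa> {-r<..<r}" unfolding \<kappa>_def
    by (intro C_inf_Pair C_inf_add C_inf_scaleR C_inf_const C_inf_id C_inf_subset[OF g(5) rW]) auto
  have "(g has_derivative frechet_derivative g (at 0)) (at 0)"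
    by (rule C_inf_has_derivative[OF g(5,3)]) (use W(2) in simp)
  moreover have "(\<lambda>t. t *\<^sub>R frechet_derivative g (at 0) 1) = frechet_derivative g (at 0)"
    using linear_scale[OF has_derivative_linear[OF calculation], of _ 1, symmetric] by (intro ext) simp
  ultimately have gd: "(g has_vector_derivative frechet_derivative g (at 0) 1) (at 0)"
    by (simp add: has_vector_derivative_def)
  \<comment> \<open>The velocity of \<open>\<sigma>\<close> is known as a tangent vector only; its
    components in \<open>c\<close> follow since \<open>coord_vector\<close> is injective.\<close>
  have "frechet_derivative g (at 0) 1 = fst w"
  proof -
    have o: "open {-r<..<r}" "0 \<in> {-r<..<r}" using r(1) by auto
    have ev: "\<forall>\<^sub>F t in nhds 0. \<sigma> t \<in> fst c"
      using eventually_nhds_in_open[OF o] by eventually_elim (use \<sigma>c in auto)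
    have "((\<lambda>t. snd c (\<sigma> t)) has_vector_derivative frechet_derivative g (at 0) 1) (at 0)"
      by (rule has_vector_derivative_transform_within_open[OF gd o]) (use \<sigma>c in auto)
    from mderiv_curve(2)[OF Q c(1) ev this]
    have "coord_vector Q c q (frechet_derivative g (at 0) 1) = coord_vector Q c q (fst w)"
      using \<sigma>(3,5) by (simp add: u_def)
    then show ?thesis using bij_coord_vector[OF Q c] by (simp add: bij_is_inj inj_eq)
  qed
  with gd have "(\<kappa> has_vector_derivative (fst w, snd w)) (at 0)"
    unfolding \<kappa>_def by (auto intro!: has_vector_derivative_Pair derivative_eq_intros)
  then have \<kappa>d: "(\<kappa> has_vector_derivative w) (at 0)" by simp
  obtain d where "curve_through M \<Sigma> x (coord_vector M (cot_chart Q c) x w) \<gamma>"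
    by (rule guard_curve[OF x c(1) _ r(1) \<gamma>\<kappa> \<gamma>0 \<kappa>s \<kappa>d]) (use c(2) xq in auto)
  then show "v \<in> tangent_space M \<Sigma> x" by (auto simp: tangent_space_def w)
qed

text \<open>Energy conservation along the vertical line through \<open>x\<close> in direction \<open>dh\<close> shows that the
  state after the impact is again transversal to the guard.\<close>

lemma reset_transversal:
  assumes reset: "impact_reset Q G h \<Delta>" and \<Delta>: "smooth_map_on M M \<Sigma> \<Delta>" and x: "x \<in> \<Sigma>"
  shows "rate (\<Delta> x) \<noteq> 0"
proof -
  have xM: "x \<in> mcarrier M" and xS: "fst x \<in> S" and xr: "rate x > 0" using x by (auto simp: guard_iff)
  obtain q y where xq: "x = (q, y)" by (cases x)
  have qQ: "q \<in> mcarrier Q" using fst_carrier[OF xM] xq by simp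
  define c where "c = chart_at Q q"
  have c: "c \<in> Q" "q \<in> fst c" using chart_at[OF qQ] by (simp_all add: c_def)
  define n where "n = comps Q c q (dh q)"
  define \<gamma> where "\<gamma> = (\<lambda>t. (q, y + t *\<^sub>R dh q))"
  define \<kappa> where "\<kappa> = (\<lambda>t. (snd c q, comps Q c q y + t *\<^sub>R n))"
  have \<gamma>0: "\<gamma> 0 = x" by (simp add: \<gamma>_def xq)
  have \<kappa>s: "C_inf \<kappa> {-1<..<1}" unfolding \<kappa>_def
    by (intro C_inf_Pair C_inf_add C_inf_scaleR C_inf_const C_inf_id) auto
  have \<kappa>d: "(\<kappa> has_vector_derivative (0, n)) (at 0)"
    unfolding \<kappa>_def by (auto intro!: has_vector_derivative_Pair derivative_eq_intros)
  obtain d where d: "d > 0" "\<And>t. \<bar>t\<bar> < d \<Longrightarrow> \<gamma> t \<in> \<Sigma>"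
    "curve_through M \<Sigma> x (coord_vector M (cot_chart Q c) x (0, n)) \<gamma>"
    by (rule guard_curve[OF x c(1), of 1 \<gamma> \<kappa> "(0, n)", OF _ _ _ \<gamma>0 \<kappa>s \<kappa>d])
       (use c(2) xq xS in \<open>auto simp: \<gamma>_def \<kappa>_def n_def linear_add[OF linear_comps] linear_scale[OF linear_comps]\<close>)
  have ev: "\<forall>\<^sub>F t in nhds 0. t \<in> {-d<..<d}" using d(1) by (intro eventually_nhds_in_open) auto
  obtain \<epsilon> where \<Delta>\<gamma>: "\<Delta> (\<gamma> t) = (q, y + (t + \<epsilon> t) *\<^sub>R dh q)" "G (\<Delta> (\<gamma> t)) = G (\<gamma> t)" if "\<bar>t\<bar> < d" for t
  proof -
    have "\<exists>\<epsilon>. \<Delta> (\<gamma> t) = (q, y + (t + \<epsilon>) *\<^sub>R dh q)" if t: "\<bar>t\<bar> < d" for t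
    proof -
      have "fst (\<Delta> (\<gamma> t)) = fst (\<gamma> t) \<and> (\<exists>\<epsilon>. \<forall>v. blinfun_apply (snd (\<Delta> (\<gamma> t))) v =
          blinfun_apply (snd (\<gamma> t)) v + \<epsilon> * diff_fun Q h (fst (\<gamma> t)) v)"
        using reset d(2)[OF t] unfolding impact_reset_def by blast
      then obtain \<epsilon> where \<epsilon>: "fst (\<Delta> (\<gamma> t)) = q"
        "\<And>v. blinfun_apply (snd (\<Delta> (\<gamma> t))) v = blinfun_apply (y + t *\<^sub>R dh q) v + \<epsilon> * blinfun_apply (dh q) v"
        unfolding \<gamma>_def by (auto simp: dh[OF qQ])
      have "snd (\<Delta> (\<gamma> t)) = y + (t + \<epsilon>) *\<^sub>R dh q"
        by (rule blinfun_eqI) (simp add: \<epsilon>(2) blinfun.add_left blinfun.scaleR_left algebra_simps)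
      then show ?thesis using \<epsilon>(1) by (auto simp: prod_eq_iff)
    qed
    then obtain \<epsilon> where "\<And>t. \<bar>t\<bar> < d \<Longrightarrow> \<Delta> (\<gamma> t) = (q, y + (t + \<epsilon> t) *\<^sub>R dh q)" by metis
    moreover have "G (\<Delta> (\<gamma> t)) = G (\<gamma> t)" if "\<bar>t\<bar> < d" for t
      using reset d(2)[OF that] unfolding impact_reset_def by blast
    ultimately show ?thesis using that by blast
  qed
  define \<kappa>' where "\<kappa>' = (\<lambda>t. snd (cot_chart Q c) (\<Delta> (\<gamma> t)))"
  have \<kappa>': "\<kappa>' t = (snd c q, comps Q c q y + (t + \<epsilon> t) *\<^sub>R n)" if "\<bar>t\<bar> < d" for t
    using \<Delta>\<gamma>(1)[OF that] by (simp add: \<kappa>'_def n_def linear_add[OF linear_comps] linear_scale[OF linear_comps])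
  have \<Delta>x: "\<Delta> x = (q, y + \<epsilon> 0 *\<^sub>R dh q)" "\<Delta> x \<in> fst (cot_chart Q c)"
    using \<Delta>\<gamma>(1)[of 0] d(1) \<gamma>0 c(2) by auto
  \<comment> \<open>Differentiability is inherited from \<Delta> along a curve in the guard;
    \<epsilon> was chosen separately for each \<open>t\<close>.\<close>
  obtain w' where w': "(\<kappa>' has_vector_derivative w') (at 0)"
    using mdifferentiable_curve[OF M cot_chart_in[OF c(1)] _ mderiv_on_curve(2)[OF M M \<Delta> d(3)]] \<Delta>x(2) \<gamma>0
    unfolding \<kappa>'_def by metis
  \<comment> \<open>A linear functional that is constant along the curve annihilates its velocity.
    Applied to the base part and to the momentum part orthogonal to \<open>n\<close>, this confines
    \<open>w'\<close> to the line of \<open>(0, n)\<close>.\<close>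
  have const: "m \<bullet> w' = 0" if m: "\<And>t. \<bar>t\<bar> < d \<Longrightarrow> m \<bullet> \<kappa>' t = m \<bullet> \<kappa>' 0" for m
  proof -
    have "((\<lambda>t. m \<bullet> \<kappa>' t) has_vector_derivative m \<bullet> w') (at 0)"
      using bounded_linear.has_vector_derivative[OF bounded_linear_inner_right w'] .
    moreover have "((\<lambda>t. m \<bullet> \<kappa>' t) has_vector_derivative 0) (at 0)"
    proof (rule has_vector_derivative_transform_within_open)
      show "((\<lambda>t. m \<bullet> \<kappa>' 0) has_vector_derivative 0) (at 0)" by simp
      show "open {-d<..<d}" "0 \<in> {-d<..<d}" using d(1) by auto
      show "m \<bullet> \<kappa>' 0 = m \<bullet> \<kappa>' t" if "t \<in> {-d<..<d}" for t
        by (rule m[symmetric]) (use that in auto)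
    qed
    ultimately show ?thesis using vector_derivative_unique_at by blast
  qed
  have n0: "n \<noteq> 0"
  proof
    assume "n = 0"
    then have "dh q = 0" using covec_comps[OF Q c, of "dh q"] covec_comps[OF Q c, of 0] linear_0[OF linear_comps, of Q c q]
      by (simp add: n_def)
    then show False using dh_nonzero[OF x] xq by simp
  qed
  define a where "a = (snd w' \<bullet> n) / (n \<bullet> n)"
  have "fst w' = 0"
  proof -
    have "(fst w', 0) \<bullet> w' = 0" by (rule const) (use \<kappa>' d(1) in \<open>simp add: inner_prod_def\<close>)
    then show ?thesis by (simp add: inner_prod_def)
  qed
  moreover have "snd w' = a *\<^sub>R n"
  proof -
    let ?m = "snd w' - a *\<^sub>R n"
    have mn: "?m \<bullet> n = 0" using n0 by (simp add: a_def inner_diff_left)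
    have "(0, ?m) \<bullet> w' = 0"
      by (rule const) (use \<kappa>' d(1) mn in \<open>simp add: inner_prod_def inner_add_right\<close>)
    then have "?m \<bullet> snd w' = 0" by (simp add: inner_prod_def)
    then have "?m \<bullet> ?m = 0" using mn by (simp add: inner_diff_right)
    then show ?thesis by simp
  qed
  ultimately have w'_eq: "w' = a *\<^sub>R (0, n)" by (simp add: prod_eq_iff)
  let ?K = "cot_rep Q G c"
  have o: "open (snd c ` fst c \<times> (UNIV :: 'a set))" using smooth_atlas_open[OF Q c(1)] by (simp add: open_Times)
  have "\<kappa>' 0 \<in> snd c ` fst c \<times> UNIV" using \<kappa>'[of 0] d(1) c(2) by simp
  from C_inf_has_derivative[OF C_inf_cot_rep[OF Q G c(1)] o this]
  have D: "(?K has_derivative frechet_derivative ?K (at (\<kappa>' 0))) (at (\<kappa>' 0))" .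
  have "((\<lambda>t. ?K (\<kappa>' t)) has_derivative (\<lambda>t. frechet_derivative ?K (at (\<kappa>' 0)) (t *\<^sub>R w'))) (at 0)"
    using has_derivative_compose[OF w'[unfolded has_vector_derivative_def] D] .
  moreover have "frechet_derivative ?K (at (\<kappa>' 0)) (t *\<^sub>R w') = (a * rate (\<Delta> x)) * t" for t
  proof -
    have "rate (\<Delta> x) = frechet_derivative ?K (at (\<kappa>' 0)) (0, n)"
      using rate_rep[OF c, of "y + \<epsilon> 0 *\<^sub>R dh q"] \<kappa>'[of 0] d(1)
      by (simp add: \<Delta>x(1) rate_rep_def comps_dh[OF c, symmetric] n_def linear_add[OF linear_comps] linear_scale[OF linear_comps])
    then show ?thesis
      unfolding w'_eq using linear_scale[OF has_derivative_linear[OF D], of "t * a" "(0, n)"] by simp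
  qed
  ultimately have 1: "((\<lambda>t. ?K (\<kappa>' t)) has_real_derivative a * rate (\<Delta> x)) (at 0)"
    by (simp add: has_field_derivative_def)
  have "((\<lambda>t. G (\<gamma> t)) has_real_derivative a * rate (\<Delta> x)) (at 0)"
  proof (rule has_field_derivative_transform_within_open[OF 1, of "{-d<..<d}"])
    show "?K (\<kappa>' t) = G (\<gamma> t)" if "t \<in> {-d<..<d}" for t
    proof -
      have t: "\<bar>t\<bar> < d" using that by auto
      show ?thesis
        using cot_rep_eq[OF Q c, of G "snd (\<Delta> (\<gamma> t))"] \<Delta>\<gamma>[OF t] by (simp add: \<kappa>'_def)
    qed
  qed (use d(1) in auto)
  moreover have "((\<lambda>t. G (\<gamma> t)) has_real_derivative rate x) (at 0)"
    using rate_fibre_derivative[OF xM] by (simp add: \<gamma>_def xq)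
  ultimately have "a * rate (\<Delta> x) = rate x" using DERIV_unique by blast
  then show ?thesis using xr by auto
qed

text \<open>The base component of a field is determined by its symplectic pairing with vertical
  vectors, and the pulled-back force vanishes on these.\<close>

lemma mderiv_fst_controlled_field:
  assumes x: "x \<in> mcarrier M"
  shows "mderiv M Q fst x (controlled_field Q G F x u) = mderiv M Q fst x (ham_vector_field Q G x)"
proof -
  let ?F = "\<lambda>w. blinfun_apply (F u (fst x)) (mderiv M Q fst x w)"
  let ?l = "\<lambda>w. diff_fun M G x w - ?F w"
  note lm = linear_mderiv[OF M Q mdifferentiable_fst[OF x]]
  have lF: "linear ?F"
    using linear_compose[OF lm bounded_linear.linear[OF blinfun.bounded_linear_right]] by (simp add: comp_def)
  have "linear ?l"
    by (rule linear_compose_sub[OF bounded_linear.linear[OF diff_fun_linear[OF M G x]] lF])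
  note X = symplectic_dual[OF this, of Q x]
  have "controlled_field Q G F x u = (THE X. \<forall>w. symplectic_form Q x X w = ?l w)"
    unfolding controlled_field_def pullback_def by (simp add: algebra_simps)
  then have X: "symplectic_form Q x (controlled_field Q G F x u) w = ?l w" for w using X by simp
  obtain c where c: "c \<in> Q" "fst x \<in> fst c" "chart_at M x = cot_chart Q c"
    using chart_at_cotangent[OF x] .
  have J: "coord_vector M (cot_chart Q c) x = (\<lambda>v. v)"
    using coord_vector_chart_at[OF M x] c(3) by simp
  have m: "mderiv M Q fst x w = coord_vector Q c (fst x) (fst w)" for w
    using mderiv_fst_cotangent[OF Q c(1,2), of w] by (simp add: J)
  have "mderiv M Q fst x (0, v) = 0" for v
    using m[of "(0, v)"] linear_0[OF linear_coord_vector[OF Q c(1,2)]] by simp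
  then have "fst (controlled_field Q G F x u) \<bullet> v = fst (ham_vector_field Q G x) \<bullet> v" for v
    using X[of "(0, v)"] symplectic_ham_vector_field[OF Q G x, of "(0, v)"] by (simp add: symplectic_form_def)
  then have "fst (controlled_field Q G F x u) = fst (ham_vector_field Q G x)" by (metis vector_eq_rdot)
  then show ?thesis by (simp add: m)
qed

text \<open>The envelope theorem in the fibre direction \<open>d\<eta>\<close>: controls act by vertical forces,
  so they do not contribute to the velocity of \<open>\<eta>\<close>.\<close>

lemma optimal_hamiltonian_fibre_derivative:
  assumes min: "regular_minimizer Q G U F l" and H_def: "H = optimal_hamiltonian Q G U F l"
    and H: "smooth_map_on (cotangent M) euc (mcarrier (cotangent M)) H" and x: "x \<in> mcarrier M"
  shows "((\<lambda>s. H (x, p + s *\<^sub>R Blinfun (diff_fun M \<eta> x))) has_real_derivative rate x) (at 0)"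
proof -
  let ?n = "Blinfun (diff_fun M \<eta> x)" and ?B = "control_bracket Q G F l"
  have car: "(x, p') \<in> mcarrier (cotangent M)" for p' using x by (simp add: mcarrier_cotangent[of M])
  obtain us where us: "\<And>z. z \<in> mcarrier (cotangent M) \<Longrightarrow> is_arg_min (?B z) (\<lambda>u. u \<in> U) (us z)"
    using min unfolding regular_minimizer_def by blast
  have le: "H (x, p') \<le> ?B (x, p') u" and eq: "H (x, p') = ?B (x, p') (us (x, p'))" and usU: "us (x, p') \<in> U"
    if "u \<in> U" for p' u
  proof -
    have m: "us (x, p') \<in> U" "\<And>u. u \<in> U \<Longrightarrow> ?B (x, p') (us (x, p')) \<le> ?B (x, p') u"
      using us[OF car[of p']] by (auto simp: is_arg_min_linorder)
    show "us (x, p') \<in> U" by (rule m(1))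
    show "H (x, p') = ?B (x, p') (us (x, p'))"
      unfolding H_def optimal_hamiltonian_def by (rule Least_equality) (use m in auto)
    then show "H (x, p') \<le> ?B (x, p') u" using m(2)[OF that] by simp
  qed
  have u0: "us (x, p) \<in> U" using us[OF car[of p]] by (simp add: is_arg_min_linorder)
  let ?u = "us (x, p)" and ?X = "controlled_field Q G F x (us (x, p))"
  have r: "blinfun_apply ?n ?X = rate x"
    by (simp add: bounded_linear_Blinfun_apply diff_fun_linear[OF M \<eta> x] diff_fun_\<eta>[OF x]
        mderiv_fst_controlled_field[OF x] rate_eq[OF x])
  obtain c where c: "c \<in> M" "x \<in> fst c" using x by (auto simp: mcarrier_def)
  obtain E where E: "((\<lambda>s. H (x, p + s *\<^sub>R ?n)) has_real_derivative E) (at 0)"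
    using cot_rep_fibre_derivative[OF M H c] by blast
  have "((\<lambda>s. H (x, p + s *\<^sub>R ?n) - s * rate x) has_real_derivative E - rate x) (at 0)"
    by (auto intro!: derivative_eq_intros E)
  moreover have "H (x, p + s *\<^sub>R ?n) - s * rate x \<le> H (x, p + 0 *\<^sub>R ?n) - 0 * rate x" for s
  proof -
    have "H (x, p + s *\<^sub>R ?n) \<le> ?B (x, p + s *\<^sub>R ?n) ?u" by (rule le[OF u0])
    also have "\<dots> = ?B (x, p) ?u + s * rate x"
      by (simp add: control_bracket_def blinfun.add_left blinfun.scaleR_left r)
    finally show ?thesis using eq[OF u0, of p] by simp
  qed
  ultimately have "E - rate x = 0"
    by (intro DERIV_local_max[of "\<lambda>s. H (x, p + s *\<^sub>R ?n) - s * rate x" "E - rate x" 0 1]) auto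
  with E show ?thesis by simp
qed

lemma optimal_quadratic_fibre:
  assumes min: "regular_minimizer Q G U F l" and H_def: "H = optimal_hamiltonian Q G U F l"
    and H: "smooth_map_on (cotangent M) euc (mcarrier (cotangent M)) H"
    and quad: "quadratic_hamiltonian M H \<beta> f V" and x: "x \<in> mcarrier M"
  shows "\<beta> x p (Blinfun (diff_fun M \<eta> x)) = 0" "diff_fun M \<eta> x (f x) = rate x"
proof -
  let ?n = "Blinfun (diff_fun M \<eta> x)"
  have b: "bilinear (\<beta> x)" and s: "\<And>p p'. \<beta> x p p' = \<beta> x p' p"
    and h: "\<And>p. H (x, p) = \<beta> x p p + blinfun_apply p (f x) + V x"
    using quad x by (auto simp: quadratic_hamiltonian_def)
  have n: "blinfun_apply ?n v = diff_fun M \<eta> x v" for v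
    by (simp add: bounded_linear_Blinfun_apply diff_fun_linear[OF M \<eta> x])
  have eq: "2 * \<beta> x p ?n + diff_fun M \<eta> x (f x) = rate x" for p
  proof -
    have "H (x, p + s *\<^sub>R ?n) = \<beta> x p p + 2 * s * \<beta> x p ?n + s * s * \<beta> x ?n ?n
        + blinfun_apply p (f x) + s * diff_fun M \<eta> x (f x) + V x" for s
      by (simp add: h bilinear_ladd[OF b] bilinear_radd[OF b] bilinear_lmul[OF b] bilinear_rmul[OF b]
          blinfun.add_left blinfun.scaleR_left n s[of ?n p] algebra_simps)
    moreover have "((\<lambda>s. \<beta> x p p + 2 * s * \<beta> x p ?n + s * s * \<beta> x ?n ?n
        + blinfun_apply p (f x) + s * diff_fun M \<eta> x (f x) + V x) has_real_derivative
        2 * \<beta> x p ?n + diff_fun M \<eta> x (f x)) (at 0)"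
      by (auto intro!: derivative_eq_intros)
    ultimately show ?thesis
      using DERIV_unique optimal_hamiltonian_fibre_derivative[OF min H_def H x, of p] by simp
  qed
  \<comment> \<open>At \<open>p = 0\<close> the bilinear term is absent, which isolates the vector
    field; since the rate does not depend on \<open>p\<close>, the bilinear term then vanishes for
    every \<open>p\<close>.\<close>
  have "\<beta> x 0 ?n = 0" using bilinear_lzero[OF b] .
  then show 1: "diff_fun M \<eta> x (f x) = rate x" using eq[of 0] by simp
  show "\<beta> x p ?n = 0" using eq[of p] 1 by simp
qed

text \<open>Hamilton's equation for \<open>H\<close> and the envelope theorem compute the same fibre
  derivative, so the sign condition of the extended guard is that of the guard.\<close>

lemma extended_guard_eq:
  assumes min: "regular_minimizer Q G U F l" and H_def: "H = optimal_hamiltonian Q G U F l"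
    and H: "smooth_map_on (cotangent M) euc (mcarrier (cotangent M)) H"
  shows "extended_guard Q G h H = \<Sigma> \<times> UNIV"
proof -
  have "pullback (cotangent M) M fst (pullback M Q fst (diff_fun Q h)) z (ham_vector_field M H z) = rate (fst z)"
    if z: "z \<in> mcarrier (cotangent M)" for z
  proof -
    have x: "fst z \<in> mcarrier M" using z by (auto simp: mcarrier_cotangent[of M])
    from DERIV_unique[OF ham_vector_field_fibre_derivative[OF M H z]
        optimal_hamiltonian_fibre_derivative[OF min H_def H x, of "snd z"]]
    show ?thesis
      by (simp add: pullback_def bounded_linear_Blinfun_apply diff_fun_linear[OF M \<eta> x] diff_fun_\<eta>[OF x])
  qed
  then show ?thesis
    by (auto simp: extended_guard_def guard_iff mcarrier_cotangent[of M])
qed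

text \<open>Everywhere \<open>d\<eta>\<close> takes the value \<open>rate\<close> on
  \<open>f\<close>. This is positive on the guard by definition, and nonzero after the impact by
  \<open>reset_transversal\<close>.\<close>

lemma reset_system:
  assumes reset: "impact_reset Q G h \<Delta>" and immersion: "immersion_on M M \<Sigma> \<Delta>"
    and min: "regular_minimizer Q G U F l" and H_def: "H = optimal_hamiltonian Q G U F l"
    and H: "smooth_map_on (cotangent M) euc (mcarrier (cotangent M)) H"
    and quad: "quadratic_hamiltonian M H \<beta> f V"
  shows "reset_system M \<Sigma> \<Delta> \<eta> H \<beta> f V"
proof
  have \<Delta>: "smooth_map_on M M \<Sigma> \<Delta>" using immersion by (simp add: immersion_on_def)
  note fibre = optimal_quadratic_fibre[OF min H_def H quad]
  show "smooth_atlas M" "immersion_on M M \<Sigma> \<Delta>" "smooth_map_on M euc (mcarrier M) \<eta>"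
    "smooth_map_on (cotangent M) euc (mcarrier (cotangent M)) H" "quadratic_hamiltonian M H \<beta> f V"
    by (rule M immersion \<eta> H quad)+
  fix x assume x: "x \<in> \<Sigma>"
  have \<Delta>x: "fst (\<Delta> x) = fst x" using reset x by (simp add: impact_reset_def)
  show "\<eta> x = 0" using x by (simp add: guard_iff \<eta>_def impact_location_def)
  then show "\<eta> (\<Delta> x) = 0" using \<Delta>x by (simp add: \<eta>_def)
  show "tangent_space M \<Sigma> x = {v. diff_fun M \<eta> x v = 0}" by (rule tangent_guard[OF x])
  note car = smooth_map_on_carrier[OF \<Delta> x]
  show "\<beta> (\<Delta> x) p (Blinfun (diff_fun M \<eta> (\<Delta> x))) = 0" for p by (rule fibre(1)[OF car(2)])
  show "diff_fun M \<eta> x (f x) \<noteq> 0" using fibre(2)[OF car(1)] x by (simp add: guard_iff)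
  show "diff_fun M \<eta> (\<Delta> x) (f (\<Delta> x)) \<noteq> 0"
    using fibre(2)[OF car(2)] reset_transversal[OF reset \<Delta> x] by simp
qed

end

theorem theorem5p2:
  fixes Q :: "('q, 'a::euclidean_space) atlas"
    and G :: "('q, 'a) phase \<Rightarrow> real"
    and U :: "(real ^ 'm) set"
    and F :: "real ^ 'm \<Rightarrow> 'q \<Rightarrow> 'a \<Rightarrow>\<^sub>L real"
    and l :: "('q, 'a) phase \<Rightarrow> real ^ 'm \<Rightarrow> real"
    and h :: "'q \<Rightarrow> real"
    and \<Delta> :: "('q, 'a) phase \<Rightarrow> ('q, 'a) phase"
    and H :: "('q, 'a) extended \<Rightarrow> real"
  assumes Q: "smooth_manifold Q"
    and G: "smooth_map_on (cotangent Q) euc (mcarrier (cotangent Q)) G"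
    and U: "closed U"
    and F: "smooth_map_on (euc \<times>\<^sub>M Q) (cotangent Q) (U \<times> mcarrier Q) (\<lambda>(u, q). (q, F u q))"
    and h: "smooth_map_on Q euc (mcarrier Q) h"
    and S: "embedded_submanifold Q 1 (impact_location Q h)"
    and reset: "impact_reset Q G h \<Delta>"
    and hybrid: "hybrid_reset (cotangent Q) (guard Q G h) \<Delta>"
    and immersion: "immersion_on (cotangent Q) (cotangent Q) (guard Q G h) \<Delta>"
    and l: "smooth_map_on (cotangent Q \<times>\<^sub>M euc) euc (mcarrier (cotangent Q) \<times> U) (\<lambda>(x, u). l x u)"
    and minimizer: "regular_minimizer Q G U F l"
    and H_def: "H = optimal_hamiltonian Q G U F l"
    and H: "smooth_map_on (cotangent (cotangent Q)) euc (mcarrier (cotangent (cotangent Q))) H"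
  shows "extended_guard Q G h H = {z \<in> mcarrier (cotangent (cotangent Q)). fst z \<in> guard Q G h} \<and>
         (\<forall>\<beta> f V. quadratic_hamiltonian (cotangent Q) H \<beta> f V \<longrightarrow>
           (\<exists>!D. D \<in> extensional (extended_guard Q G h H) \<and>
                 solves_extended_reset (cotangent Q) \<Delta> H (extended_guard Q G h H) D)) \<and>
         (\<forall>\<beta> f V. quadratic_hamiltonian (cotangent Q) H \<beta> f V \<and>
             smooth_embedding_on (cotangent Q) (cotangent Q) (guard Q G h) \<Delta> \<and>
             invariant_form (cotangent Q) (guard Q G h) \<Delta> f \<beta> \<and>
             invariant_potential (guard Q G h) \<Delta> V \<longrightarrow>
           (\<forall>D. solves_extended_reset (cotangent Q) \<Delta> H (extended_guard Q G h H) D \<longrightarrow>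
                linear_bundle_iso (cotangent Q) (guard Q G h) \<Delta> D))"
proof -
  interpret mechanical_system Q G h
    by unfold_locales (use Q G h S in \<open>auto intro: smooth_manifold_atlas\<close>)
  note system = reset_system[OF reset immersion minimizer H_def H]
  have guard: "extended_guard Q G h H = guard Q G h \<times> UNIV"
    by (rule extended_guard_eq[OF minimizer H_def H])
  have "guard Q G h \<times> UNIV = {z \<in> mcarrier (cotangent (cotangent Q)). fst z \<in> guard Q G h}"
    by (auto simp: mcarrier_cotangent[of "cotangent Q"] guard_def)
  then show ?thesis
    unfolding guard
    using reset_system.unique_extended_reset[OF system] reset_system.linear_bundle_iso_reset[OF system]
    by blast
qed

end
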